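(* Let $\lambda$ be an infinite regular cardinal. The following categories are dually equivalent: (1) the category of varieties of $\lambda$-ary ultra-quantitative algebras (for arbitrary $\lambda$-ary signatures) and concrete functors over $\mathsf{UMet}$; (2) the category of strongly $\lambda$-accessible monads on $\mathsf{UMet}$ and monad morphisms.
   Context: Metric spaces are extended: distance $\infty$ is allowed. $\mathsf{UMet}$ is the category of (extended) ultrametric spaces ($d(x,z)\le\max\{d(x,y),d(y,z)\}$) and nonexpanding maps. It is cartesian closed (hom-space $[A,B]$ = nonexpanding maps with the supremum metric). All categories, functors and monads are enriched: hom-sets are (ultra)metric spaces, composition is nonexpanding, functors are nonexpanding on hom-spaces (a monad is enriched iff its underlying endofunctor is). Every set is regarded as a discrete space (distances $0$ or $\infty$). Strongly $\lambda$-accessible: let $K:\mathsf{Set}_\lambda\hookrightarrow\mathsf{UMet}$ be the full embedding of (representatives of all) discrete spaces of cardinality less than $\lambda$. An enriched endofunctor $T$ is strongly $\lambda$-accessible if it is the enriched left Kan extension of its restriction along $K$, $T=\mathrm{Lan}_K(T\circ K)$. A monad is strongly $\lambda$-accessible if its endofunctor is. Algebras: a $\lambda$-ary signature $\Sigma$ is a set of operation symbols whose arities are cardinals $n<\lambda$. An ultra-quantitative $\Sigma$-algebra is an ultrametric space $A$ with a nonexpanding operation $\sigma_A:A^n\to A$ ($A^n$ with the supremum metric) for every $n$-ary $\sigma\in\Sigma$; homomorphisms are nonexpanding maps preserving operations. They form $\Sigma\text{-}\mathsf{UMet}$ (hom-sets with the supremum metric). Let $V=\{x_i\mid i<\lambda\}$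 be a set of variables and $T_\Sigma V$ the (discrete) algebra of terms. A quantitative equation is an expression $l=_\varepsilon r$ with $l,r\in T_\Sigma V$ and $\varepsilon\ge 0$ rational; an algebra $A$ satisfies it if for every map $f:V\to |A|$ with homomorphic extension $f^\sharp:T_\Sigma V\to A$ one has $d(f^\sharp(l),f^\sharp(r))\le\varepsilon$. A variety of $\lambda$-ary ultra-quantitative algebras is a full subcategory of some $\Sigma\text{-}\mathsf{UMet}$ ($\Sigma$ $\lambda$-ary) consisting of all algebras satisfying a given set of quantitative equations. Concrete functors: each variety $\mathcal V$ has its forgetful functor $U_{\mathcal V}:\mathcal V\to\mathsf{UMet}$; a concrete functor $\mathcal V\to\mathcal W$ is an (enriched) functor $F$ with $U_{\mathcal W}\circ F=U_{\mathcal V}$. Two categories are dually equivalent if one is equivalent to the opposite of the other. *)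

theory Defs
  imports "HOL-Library.FuncSet" "HOL-Library.Extended_Nonnegative_Real"
begin

unbundle cardinal_syntax

section \<open>Ordinary categories\<close>

text \<open>
  Hom-sets are indexed by their two objects and need not be disjoint, so composition
  and the arrow parts of functors take the objects as arguments.
  \<open>cmp C a b c g f\<close> is the composite of \<open>f : a \<rightarrow> b\<close> and \<open>g : b \<rightarrow> c\<close>.
  Functors and natural transformations are extensional (\<open>undefined\<close> outside their domain),
  so that equality in HOL is equality of functors and of natural transformations.
\<close>

record ('o, 'a) cat =
  obj :: "'o set"
  hom :: "'o \<Rightarrow> 'o \<Rightarrow> 'a set"
  idn :: "'o \<Rightarrow> 'a"
  cmp :: "'o \<Rightarrow> 'o \<Rightarrow> 'o \<Rightarrow> 'a \<Rightarrow> 'a \<Rightarrow> 'a"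

definition category :: "('o, 'a, 'm) cat_scheme \<Rightarrow> bool" where
  "category C \<longleftrightarrow>
     (\<forall>a\<in>obj C. idn C a \<in> hom C a a) \<and>
     (\<forall>a\<in>obj C. \<forall>b\<in>obj C. \<forall>c\<in>obj C. \<forall>f\<in>hom C a b. \<forall>g\<in>hom C b c.
        cmp C a b c g f \<in> hom C a c) \<and>
     (\<forall>a\<in>obj C. \<forall>b\<in>obj C. \<forall>f\<in>hom C a b.
        cmp C a a b f (idn C a) = f \<and> cmp C a b b (idn C b) f = f) \<and>
     (\<forall>a\<in>obj C. \<forall>b\<in>obj C. \<forall>c\<in>obj C. \<forall>d\<in>obj C.
        \<forall>f\<in>hom C a b. \<forall>g\<in>hom C b c. \<forall>h\<in>hom C c d.
        cmp C a c d h (cmp C a b c g f) = cmp C a b d (cmp C b c d h g) f)"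

definition op_cat :: "('o, 'a) cat \<Rightarrow> ('o, 'a) cat" where
  "op_cat C = \<lparr>obj = obj C, hom = (\<lambda>a b. hom C b a), idn = idn C,
     cmp = (\<lambda>a b c g f. cmp C c b a f g)\<rparr>"

definition full_subcat :: "('o, 'a, 'm) cat_scheme \<Rightarrow> 'o set \<Rightarrow> ('o, 'a, 'm) cat_scheme" where
  "full_subcat C S = C\<lparr>obj := S\<rparr>"

record ('o, 'a, 'p, 'b) fctr =
  fobj :: "'o \<Rightarrow> 'p"
  farr :: "'o \<Rightarrow> 'o \<Rightarrow> 'a \<Rightarrow> 'b"

definition is_functor ::
  "('o, 'a, 'm) cat_scheme \<Rightarrow> ('p, 'b, 'n) cat_scheme \<Rightarrow> ('o, 'a, 'p, 'b) fctr \<Rightarrow> bool" where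
  "is_functor C D F \<longleftrightarrow>
     fobj F \<in> obj C \<rightarrow>\<^sub>E obj D \<and>
     farr F \<in> extensional (obj C) \<and>
     (\<forall>a\<in>obj C. farr F a \<in> extensional (obj C)) \<and>
     (\<forall>a\<in>obj C. \<forall>b\<in>obj C. farr F a b \<in> hom C a b \<rightarrow>\<^sub>E hom D (fobj F a) (fobj F b)) \<and>
     (\<forall>a\<in>obj C. farr F a a (idn C a) = idn D (fobj F a)) \<and>
     (\<forall>a\<in>obj C. \<forall>b\<in>obj C. \<forall>c\<in>obj C. \<forall>f\<in>hom C a b. \<forall>g\<in>hom C b c.
        farr F a c (cmp C a b c g f) =
        cmp D (fobj F a) (fobj F b) (fobj F c) (farr F b c g) (farr F a b f))"

definition id_functor :: "('o, 'a, 'm) cat_scheme \<Rightarrow> ('o, 'a, 'o, 'a) fctr" where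
  "id_functor C = \<lparr>fobj = (\<lambda>a\<in>obj C. a), farr = (\<lambda>a\<in>obj C. \<lambda>b\<in>obj C. \<lambda>f\<in>hom C a b. f)\<rparr>"

text \<open>\<open>comp_functor C G F\<close> is \<open>G \<circ> F\<close>; \<open>C\<close> is the domain of \<open>F\<close>.\<close>

definition comp_functor ::
  "('o, 'a, 'm) cat_scheme \<Rightarrow> ('p, 'b, 'q, 'c) fctr \<Rightarrow> ('o, 'a, 'p, 'b) fctr \<Rightarrow> ('o, 'a, 'q, 'c) fctr" where
  "comp_functor C G F =
     \<lparr>fobj = (\<lambda>a\<in>obj C. fobj G (fobj F a)),
      farr = (\<lambda>a\<in>obj C. \<lambda>b\<in>obj C. \<lambda>f\<in>hom C a b. farr G (fobj F a) (fobj F b) (farr F a b f))\<rparr>"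

definition nat_trans ::
  "('o, 'a, 'm) cat_scheme \<Rightarrow> ('p, 'b, 'n) cat_scheme \<Rightarrow> ('o, 'a, 'p, 'b) fctr \<Rightarrow>
   ('o, 'a, 'p, 'b) fctr \<Rightarrow> ('o \<Rightarrow> 'b) \<Rightarrow> bool" where
  "nat_trans C D F G \<alpha> \<longleftrightarrow>
     \<alpha> \<in> (\<Pi>\<^sub>E a\<in>obj C. hom D (fobj F a) (fobj G a)) \<and>
     (\<forall>a\<in>obj C. \<forall>b\<in>obj C. \<forall>f\<in>hom C a b.
        cmp D (fobj F a) (fobj F b) (fobj G b) (\<alpha> b) (farr F a b f) =
        cmp D (fobj F a) (fobj G a) (fobj G b) (farr G a b f) (\<alpha> a))"

definition is_iso :: "('o, 'a, 'm) cat_scheme \<Rightarrow> 'o \<Rightarrow> 'o \<Rightarrow> 'a \<Rightarrow> bool" where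
  "is_iso C a b f \<longleftrightarrow> f \<in> hom C a b \<and>
     (\<exists>g\<in>hom C b a. cmp C a b a g f = idn C a \<and> cmp C b a b f g = idn C b)"

definition nat_iso ::
  "('o, 'a, 'm) cat_scheme \<Rightarrow> ('p, 'b, 'n) cat_scheme \<Rightarrow> ('o, 'a, 'p, 'b) fctr \<Rightarrow>
   ('o, 'a, 'p, 'b) fctr \<Rightarrow> ('o \<Rightarrow> 'b) \<Rightarrow> bool" where
  "nat_iso C D F G \<alpha> \<longleftrightarrow> nat_trans C D F G \<alpha> \<and>
     (\<forall>a\<in>obj C. is_iso D (fobj F a) (fobj G a) (\<alpha> a))"

definition equivalent_categories :: "('o, 'a) cat \<Rightarrow> ('p, 'b) cat \<Rightarrow> bool" where
  "equivalent_categories C D \<longleftrightarrow> category C \<and> category D \<and>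
     (\<exists>F G \<eta> \<epsilon>. is_functor C D F \<and> is_functor D C G \<and>
        nat_iso C C (id_functor C) (comp_functor C G F) \<eta> \<and>
        nat_iso D D (comp_functor D F G) (id_functor D) \<epsilon>)"

definition dually_equivalent :: "('o, 'a) cat \<Rightarrow> ('p, 'b) cat \<Rightarrow> bool" where
  "dually_equivalent C D \<longleftrightarrow> equivalent_categories C (op_cat D)"

section \<open>Extended ultrametric spaces\<close>

text \<open>
  Distances are normalised to \<open>0\<close> off the underlying set, so that equality in HOL is equality
  of spaces.
\<close>

record 'a space =
  pts :: "'a set"
  dst :: "'a \<Rightarrow> 'a \<Rightarrow> ennreal"

definition ultrametric_space :: "'a space \<Rightarrow> bool" where
  "ultrametric_space X \<longleftrightarrow>
     (\<forall>x\<in>pts X. \<forall>y\<in>pts X. dst X x y = 0 \<longleftrightarrow> x = y) \<and>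
     (\<forall>x\<in>pts X. \<forall>y\<in>pts X. dst X x y = dst X y x) \<and>
     (\<forall>x\<in>pts X. \<forall>y\<in>pts X. \<forall>z\<in>pts X. dst X x z \<le> max (dst X x y) (dst X y z)) \<and>
     (\<forall>x y. x \<notin> pts X \<or> y \<notin> pts X \<longrightarrow> dst X x y = 0)"

definition nonexpanding_maps :: "'a space \<Rightarrow> 'b space \<Rightarrow> ('a \<Rightarrow> 'b) set" where
  "nonexpanding_maps X Y = {f \<in> pts X \<rightarrow>\<^sub>E pts Y.
     \<forall>x\<in>pts X. \<forall>y\<in>pts X. dst Y (f x) (f y) \<le> dst X x y}"

definition sup_space :: "('a \<Rightarrow> 'b) set \<Rightarrow> 'a set \<Rightarrow> 'b space \<Rightarrow> ('a \<Rightarrow> 'b) space" where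
  "sup_space H I Y = \<lparr>pts = H,
     dst = (\<lambda>f g. if f \<in> H \<and> g \<in> H then (SUP i\<in>I. dst Y (f i) (g i)) else 0)\<rparr>"

definition mapping_space :: "'a space \<Rightarrow> 'b space \<Rightarrow> ('a \<Rightarrow> 'b) space" where
  "mapping_space X Y = sup_space (nonexpanding_maps X Y) (pts X) Y"

definition power_space :: "'a space \<Rightarrow> 'i set \<Rightarrow> ('i \<Rightarrow> 'a) space" where
  "power_space X n = sup_space (n \<rightarrow>\<^sub>E pts X) n X"

definition discrete_space :: "'a set \<Rightarrow> 'a space" where
  "discrete_space A = \<lparr>pts = A, dst = (\<lambda>x y. if x \<in> A \<and> y \<in> A \<and> x \<noteq> y then \<infinity> else 0)\<rparr>"

definition isometric_iso :: "'a space \<Rightarrow> 'b space \<Rightarrow> ('a \<Rightarrow> 'b) \<Rightarrow> bool" where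
  "isometric_iso X Y f \<longleftrightarrow> bij_betw f (pts X) (pts Y) \<and>
     (\<forall>x\<in>pts X. \<forall>y\<in>pts X. dst Y (f x) (f y) = dst X x y)"

section \<open>Enriched categories\<close>

record ('o, 'a) ecat = "('o, 'a) cat" +
  hdist :: "'o \<Rightarrow> 'o \<Rightarrow> 'a \<Rightarrow> 'a \<Rightarrow> ennreal"

definition hom_space :: "('o, 'a) ecat \<Rightarrow> 'o \<Rightarrow> 'o \<Rightarrow> 'a space" where
  "hom_space C a b = \<lparr>pts = hom C a b, dst = hdist C a b\<rparr>"

definition enriched_category :: "('o, 'a) ecat \<Rightarrow> bool" where
  "enriched_category C \<longleftrightarrow> category C \<and>
     (\<forall>a\<in>obj C. \<forall>b\<in>obj C. ultrametric_space (hom_space C a b)) \<and>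
     (\<forall>a\<in>obj C. \<forall>b\<in>obj C. \<forall>c\<in>obj C.
        \<forall>f\<in>hom C a b. \<forall>f'\<in>hom C a b. \<forall>g\<in>hom C b c. \<forall>g'\<in>hom C b c.
        hdist C a c (cmp C a b c g f) (cmp C a b c g' f') \<le> max (hdist C b c g g') (hdist C a b f f'))"

definition enriched_functor ::
  "('o, 'a) ecat \<Rightarrow> ('p, 'b) ecat \<Rightarrow> ('o, 'a, 'p, 'b) fctr \<Rightarrow> bool" where
  "enriched_functor C D F \<longleftrightarrow> is_functor C D F \<and>
     (\<forall>a\<in>obj C. \<forall>b\<in>obj C.
        farr F a b \<in> nonexpanding_maps (hom_space C a b) (hom_space D (fobj F a) (fobj F b)))"

definition inclusion_functor :: "('o, 'a) ecat \<Rightarrow> 'o set \<Rightarrow> ('o, 'a, 'o, 'a) fctr" where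
  "inclusion_functor C S = id_functor (full_subcat C S)"

text \<open>
  For \<open>K : A \<rightarrow> C\<close> and \<open>F : A \<rightarrow> D\<close>, the space of enriched natural transformations
  \<open>C(K-, X) \<rightarrow> D(F-, Y)\<close> of contravariant space-valued functors on \<open>A\<close>, i.e. the hom-object
  \<open>[A^op, V](C(K-, X), D(F-, Y))\<close>.
\<close>

definition weighted_cocones ::
  "('n, 'e) ecat \<Rightarrow> ('o, 'a) ecat \<Rightarrow> ('p, 'b) ecat \<Rightarrow> ('n, 'e, 'o, 'a) fctr \<Rightarrow> ('n, 'e, 'p, 'b) fctr \<Rightarrow>
   'o \<Rightarrow> 'p \<Rightarrow> ('n \<Rightarrow> 'a \<Rightarrow> 'b) space" where
  "weighted_cocones A C D K F X Y =
     (let H = {\<theta> \<in> (\<Pi>\<^sub>E n\<in>obj A.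
                  nonexpanding_maps (hom_space C (fobj K n) X) (hom_space D (fobj F n) Y)).
               \<forall>m\<in>obj A. \<forall>n\<in>obj A. \<forall>h\<in>hom A m n. \<forall>g\<in>hom C (fobj K n) X.
                 \<theta> m (cmp C (fobj K m) (fobj K n) X g (farr K m n h)) =
                 cmp D (fobj F m) (fobj F n) Y (\<theta> n g) (farr F m n h)}
      in \<lparr>pts = H,
          dst = (\<lambda>\<theta> \<theta>'. if \<theta> \<in> H \<and> \<theta>' \<in> H
            then (SUP n\<in>obj A. SUP g\<in>hom C (fobj K n) X. hdist D (fobj F n) Y (\<theta> n g) (\<theta>' n g))
            else 0)\<rparr>)"

text \<open>
  \<open>L\<close> is the (pointwise) enriched left Kan extension of \<open>F\<close> along \<open>K\<close> with unit
  \<open>\<phi> : F \<rightarrow> L \<circ> K\<close>: every \<open>L X\<close> is the colimit of \<open>F\<close> weighted by \<open>C(K-, X)\<close>, i.e. the map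
  \<open>D(L X, Y) \<rightarrow> [A^op, V](C(K-, X), D(F-, Y))\<close> induced by \<open>\<phi>\<close> is an isomorphism of spaces.
\<close>

definition is_left_Kan_extension ::
  "('n, 'e) ecat \<Rightarrow> ('o, 'a) ecat \<Rightarrow> ('p, 'b) ecat \<Rightarrow> ('n, 'e, 'o, 'a) fctr \<Rightarrow> ('n, 'e, 'p, 'b) fctr \<Rightarrow>
   ('o, 'a, 'p, 'b) fctr \<Rightarrow> ('n \<Rightarrow> 'b) \<Rightarrow> bool" where
  "is_left_Kan_extension A C D K F L \<phi> \<longleftrightarrow>
     enriched_functor A C K \<and> enriched_functor A D F \<and> enriched_functor C D L \<and>
     nat_trans A D F (comp_functor A L K) \<phi> \<and>
     (\<forall>X\<in>obj C. \<forall>Y\<in>obj D.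
        isometric_iso (hom_space D (fobj L X) Y) (weighted_cocones A C D K F X Y)
          (\<lambda>f. \<lambda>n\<in>obj A. \<lambda>g\<in>hom C (fobj K n) X.
             cmp D (fobj F n) (fobj L X) Y f
               (cmp D (fobj F n) (fobj L (fobj K n)) (fobj L X) (farr L (fobj K n) X g) (\<phi> n))))"

section \<open>Enriched monads\<close>

record ('o, 'a) monad =
  mfun :: "('o, 'a, 'o, 'a) fctr"
  munit :: "'o \<Rightarrow> 'a"
  mmult :: "'o \<Rightarrow> 'a"

definition enriched_monad :: "('o, 'a) ecat \<Rightarrow> ('o, 'a) monad \<Rightarrow> bool" where
  "enriched_monad C M \<longleftrightarrow> (let T = fobj (mfun M) in
     enriched_functor C C (mfun M) \<and>
     nat_trans C C (id_functor C) (mfun M) (munit M) \<and>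
     nat_trans C C (comp_functor C (mfun M) (mfun M)) (mfun M) (mmult M) \<and>
     (\<forall>X\<in>obj C.
        cmp C (T X) (T (T X)) (T X) (mmult M X) (munit M (T X)) = idn C (T X) \<and>
        cmp C (T X) (T (T X)) (T X) (mmult M X) (farr (mfun M) X (T X) (munit M X)) = idn C (T X) \<and>
        cmp C (T (T (T X))) (T (T X)) (T X) (mmult M X) (mmult M (T X)) =
        cmp C (T (T (T X))) (T (T X)) (T X) (mmult M X)
          (farr (mfun M) (T (T X)) (T X) (mmult M X))))"

definition monad_morphism ::
  "('o, 'a) ecat \<Rightarrow> ('o, 'a) monad \<Rightarrow> ('o, 'a) monad \<Rightarrow> ('o \<Rightarrow> 'a) \<Rightarrow> bool" where
  "monad_morphism C M N \<alpha> \<longleftrightarrow> (let S = fobj (mfun M); T = fobj (mfun N) in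
     nat_trans C C (mfun M) (mfun N) \<alpha> \<and>
     (\<forall>X\<in>obj C.
        cmp C X (S X) (T X) (\<alpha> X) (munit M X) = munit N X \<and>
        cmp C (S (S X)) (S X) (T X) (\<alpha> X) (mmult M X) =
        cmp C (S (S X)) (T (T X)) (T X) (mmult N X)
          (cmp C (S (S X)) (T (S X)) (T (T X)) (farr (mfun N) (S X) (T X) (\<alpha> X)) (\<alpha> (S X)))))"

definition monad_category :: "('o, 'a) ecat \<Rightarrow> ('o, 'a) monad set \<Rightarrow> (('o, 'a) monad, 'o \<Rightarrow> 'a) cat" where
  "monad_category C \<M> =
     \<lparr>obj = \<M>,
      hom = (\<lambda>M N. {\<alpha>. monad_morphism C M N \<alpha>}),
      idn = (\<lambda>M. \<lambda>X\<in>obj C. idn C (fobj (mfun M) X)),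
      cmp = (\<lambda>M N P \<beta> \<alpha>. \<lambda>X\<in>obj C.
        cmp C (fobj (mfun M) X) (fobj (mfun N) X) (fobj (mfun P) X) (\<beta> X) (\<alpha> X))\<rparr>"

section \<open>The category of ultrametric spaces\<close>

text \<open>
  Everything lives in a universe: sets are subsets of a type \<open>'u\<close>, and a set is small if its
  cardinality is less than a cardinal \<open>\<mu>\<close>. The arity bound (usually called lambda) is the cardinal
  \<open>\<kappa>\<close> on the same type. Every strongly inaccessible \<open>\<mu>\<close> above \<open>\<kappa>\<close>, i.e. the size of a Grothendieck
  universe, satisfies the conditions below (\<open>inaccessible_is_universe\<close>); this is the usual reading
  of ``all ultrametric spaces''. HOL does not prove that uncountable inaccessible cardinals exist,
  so \<open>\<mu>\<close> is only required to be regular and closed under the powers with exponent less than \<open>\<kappa>\<close>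
  that bound the sizes of free algebras. Such \<open>\<mu>\<close> exist above every infinite cardinal
  (\<open>universe_exists\<close>).
\<close>

definition universe :: "'u rel \<Rightarrow> 'u rel \<Rightarrow> bool" where
  "universe \<kappa> \<mu> \<longleftrightarrow> Card_order \<mu> \<and> regularCard \<mu> \<and> \<kappa> <o \<mu> \<and>
     (\<forall>(A :: 'u set) (n :: 'u set). |A| <o \<mu> \<and> |n| <o \<kappa> \<longrightarrow> |A| ^c |n| <o \<mu>)"

lemma inaccessible_is_universe:
  fixes \<kappa> \<mu> :: "'u rel"
  assumes "Cinfinite \<kappa>" "Card_order \<mu>" "regularCard \<mu>" "\<kappa> <o \<mu>"
    and strong_limit: "\<And>A :: 'u set. |A| <o \<mu> \<Longrightarrow> |Pow A| <o \<mu>"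
  shows "universe \<kappa> \<mu>"
  unfolding universe_def
proof (intro conjI allI impI)
  fix A n :: "'u set"
  assume An: "|A| <o \<mu> \<and> |n| <o \<kappa>"
  have inf: "Cinfinite \<mu>"
    using assms cinfinite_mono ordLess_imp_ordLeq by blast
  have n: "|n| <o \<mu>" using An assms(4) ordLess_transitive by blast
  have "|Pair i ` A| <o \<mu>" for i :: 'u
    using An card_of_image ordLeq_ordLess_trans by blast
  then have "|\<Union>i\<in>n. Pair i ` A| <o \<mu>"
    by (intro card_of_UNION_ordLess_infinite_Field_regularCard[OF assms(3) inf n]) simp
  moreover have "(\<Union>i\<in>n. Pair i ` A) = n \<times> A" by auto
  ultimately have "|n \<times> A| <o \<mu>" by simp
  then obtain B :: "'u set" where B: "|n \<times> A| =o |B|" "|B| <o \<mu>"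
    using internalize_card_of_ordLess[of "n \<times> A" \<mu>] ordIso_ordLess_trans ordIso_symmetric
    by (metis Card_order_iff_ordIso_card_of card_of_Field_ordIso card_of_unique)
  obtain e where e: "inj_on e (n \<times> A)" "e ` (n \<times> A) \<subseteq> B"
    using B(1) card_of_ordIso bij_betw_def by (metis order_refl)
  have "|Func n A| \<le>o |Pow B|"
  proof (rule card_of_ordLeqI)
    show "inj_on (\<lambda>f. (\<lambda>i. e (i, f i)) ` n) (Func n A)"
    proof (rule inj_onI)
      fix f g assume f: "f \<in> Func n A" and g: "g \<in> Func n A"
        and eq: "(\<lambda>i. e (i, f i)) ` n = (\<lambda>i. e (i, g i)) ` n"
      show "f = g"
      proof
        fix i show "f i = g i"
        proof (cases "i \<in> n")
          case True
          then have "e (i, f i) \<in> (\<lambda>i. e (i, g i)) ` n" using eq by blast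
          then obtain j where j: "j \<in> n" "e (i, f i) = e (j, g j)" by auto
          have "(i, f i) \<in> n \<times> A" "(j, g j) \<in> n \<times> A"
            using True j f g by (auto simp: Func_def)
          then have "(i, f i) = (j, g j)" using e(1) j(2) inj_onD by metis
          then show ?thesis by auto
        next
          case False then show ?thesis using f g by (auto simp: Func_def)
        qed
      qed
    qed
    show "(\<lambda>i. e (i, f i)) ` n \<in> Pow B" if "f \<in> Func n A" for f
      using that e(2) by (auto simp: Func_def)
  qed
  then show "|A| ^c |n| <o \<mu>"
    unfolding cexp_def Field_card_of using strong_limit[OF B(2)] ordLeq_ordLess_trans by blast
qed (use assms in auto)

lemma universe_exists:
  fixes r :: "'k rel"
  assumes "Cinfinite r"
  shows "\<exists>\<kappa> \<mu> :: 'k set set rel. \<kappa> =o r \<and> Cinfinite \<kappa> \<and> universe \<kappa> \<mu>"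
proof -
  define \<theta> where "\<theta> = |Pow (Field r)|"
  define \<mu> where "\<mu> = cardSuc \<theta>"
  define \<kappa> where "\<kappa> = |(\<lambda>x. {{x}}) ` Field r|"
  have "bij_betw (\<lambda>x. {{x}}) (Field r) ((\<lambda>x. {{x}}) ` Field r)"
    by (auto simp: bij_betw_def inj_on_def)
  then have "|Field r| =o \<kappa>" unfolding \<kappa>_def using card_of_ordIso by blast
  moreover have "|Field r| =o r" using assms card_of_Field_ordIso by blast
  ultimately have \<kappa>r: "\<kappa> =o r" using ordIso_symmetric ordIso_transitive by blast
  have \<kappa>: "Cinfinite \<kappa>" using Cinfinite_cong[OF ordIso_symmetric[OF \<kappa>r]] assms by blast
  have r\<theta>: "r <o \<theta>" unfolding \<theta>_def using assms Card_order_Pow by blast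
  have \<theta>: "Cinfinite \<theta>"
    using r\<theta> assms cinfinite_mono ordLess_imp_ordLeq card_of_Card_order unfolding \<theta>_def by blast
  have ctwo: "\<theta> =o ctwo ^c r"
    unfolding \<theta>_def ctwo_def cexp_def Field_card_of by (rule card_of_Pow_Func)
  have "\<kappa> <o \<mu>" unfolding \<mu>_def
    using \<kappa>r r\<theta> \<theta> cardSuc_greater ordIso_ordLess_trans ordLess_transitive by metis
  moreover have "regularCard \<mu>" "Card_order \<mu>"
    unfolding \<mu>_def using \<theta> regularCard_cardSuc cardSuc_Card_order by auto
  moreover have "|A| ^c |n| <o \<mu>" if A: "|A| <o \<mu>" and n: "|n| <o \<kappa>" for A :: "'k set set set" and n :: "'k set set set"
  proof -
    have A': "|A| \<le>o \<theta>"
      using iffD1[OF cardSuc_ordLeq_ordLess[OF conjunct2[OF \<theta>] card_of_Card_order] A[unfolded \<mu>_def]] .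
    have n': "|n| \<le>o r" using n \<kappa>r ordLess_ordIso_trans ordLess_imp_ordLeq by blast
    have "|A| ^c |n| \<le>o \<theta>"
    proof (cases "n = {}")
      case True
      then have "|A| ^c |n| \<le>o |{{}::'k set}|"
        unfolding cexp_def Field_card_of by (auto simp: Func_empty intro: card_of_singl_ordLeq)
      also have "|{{}::'k set}| \<le>o \<theta>"
        unfolding \<theta>_def by (rule card_of_mono1) auto
      finally show ?thesis .
    next
      case False
      then have cn: "Cnotzero |n|"
        by (metis card_of_Card_order card_of_ordIso_czero_iff_empty)
      have "|A| ^c |n| \<le>o \<theta> ^c |n|" using A' card_of_Card_order cexp_mono1 by blast
      also have "\<theta> ^c |n| \<le>o (ctwo ^c r) ^c |n|"
        using ctwo card_of_Card_order cexp_mono1 ordIso_imp_ordLeq by blast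
      also have "(ctwo ^c r) ^c |n| =o ctwo ^c r"
        using cexp_cprod_ordLeq[OF _ assms cn n'] Card_order_ctwo by blast
      also have "ctwo ^c r =o \<theta>" using ctwo ordIso_symmetric by blast
      finally show ?thesis .
    qed
    then show ?thesis
      unfolding \<mu>_def using \<theta> cardSuc_greater ordLeq_ordLess_trans by blast
  qed
  ultimately have "universe \<kappa> \<mu>" unfolding universe_def by blast
  then show ?thesis using \<kappa>r \<kappa> by blast
qed

definition UMet :: "'u rel \<Rightarrow> ('u space, 'u \<Rightarrow> 'u) ecat" where
  "UMet \<mu> =
     \<lparr>obj = {X. ultrametric_space X \<and> |pts X| <o \<mu>},
      hom = nonexpanding_maps,
      idn = (\<lambda>X. \<lambda>x\<in>pts X. x),
      cmp = (\<lambda>X Y Z g f. compose (pts X) g f),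
      hdist = (\<lambda>X Y. dst (mapping_space X Y))\<rparr>"

lemma ultrametric_sup_space:
  assumes Y: "ultrametric_space Y" and H: "H \<subseteq> I \<rightarrow>\<^sub>E pts Y"
  shows "ultrametric_space (sup_space H I Y)"
proof -
  have in_Y: "f i \<in> pts Y" if "f \<in> H" "i \<in> I" for f i using that H by auto
  have eq: "(SUP i\<in>I. dst Y (f i) (g i)) = 0 \<longleftrightarrow> f = g" if f: "f \<in> H" and g: "g \<in> H" for f g
  proof
    assume "(SUP i\<in>I. dst Y (f i) (g i)) = 0"
    then have "dst Y (f i) (g i) = 0" if "i \<in> I" for i
      using that by (metis SUP_upper le_zero_eq)
    then have "f i = g i" if "i \<in> I" for i
      using Y in_Y f g that unfolding ultrametric_space_def by blast
    then show "f = g" using f g H by (meson PiE_ext subsetD)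
  next
    assume "f = g"
    then have "dst Y (f i) (g i) = 0" if "i \<in> I" for i
      using Y in_Y f that unfolding ultrametric_space_def by blast
    then show "(SUP i\<in>I. dst Y (f i) (g i)) = 0"
      by (metis (no_types, lifting) SUP_least le_zero_eq order_refl)
  qed
  have tri: "(SUP i\<in>I. dst Y (f i) (h i)) \<le>
      max (SUP i\<in>I. dst Y (f i) (g i)) (SUP i\<in>I. dst Y (g i) (h i))"
    if "f \<in> H" "g \<in> H" "h \<in> H" for f g h
  proof (rule SUP_least)
    fix i assume i: "i \<in> I"
    have "dst Y (f i) (h i) \<le> max (dst Y (f i) (g i)) (dst Y (g i) (h i))"
      using Y in_Y that i unfolding ultrametric_space_def by blast
    also have "\<dots> \<le> max (SUP i\<in>I. dst Y (f i) (g i)) (SUP i\<in>I. dst Y (g i) (h i))"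
      using i by (intro max.mono SUP_upper)
    finally show "dst Y (f i) (h i) \<le> \<dots>" .
  qed
  have sym: "(SUP i\<in>I. dst Y (f i) (g i)) = (SUP i\<in>I. dst Y (g i) (f i))"
    if "f \<in> H" "g \<in> H" for f g
    using Y in_Y that unfolding ultrametric_space_def by (intro SUP_cong) blast+
  show ?thesis
    unfolding ultrametric_space_def[of "sup_space H I Y"]
    using eq tri sym by (auto simp: sup_space_def)
qed

lemma compose_nonexpanding:
  assumes "f \<in> nonexpanding_maps X Y" "g \<in> nonexpanding_maps Y Z"
  shows "compose (pts X) g f \<in> nonexpanding_maps X Z"
proof -
  have f: "f x \<in> pts Y" if "x \<in> pts X" for x
    using assms that by (auto simp: nonexpanding_maps_def)
  have "dst Z (g (f x)) (g (f y)) \<le> dst X x y" if "x \<in> pts X" "y \<in> pts X" for x y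
  proof -
    have "dst Z (g (f x)) (g (f y)) \<le> dst Y (f x) (f y)"
      using assms f that by (auto simp: nonexpanding_maps_def)
    also have "\<dots> \<le> dst X x y" using assms that by (auto simp: nonexpanding_maps_def)
    finally show ?thesis .
  qed
  then show ?thesis
    using assms f by (auto simp: nonexpanding_maps_def compose_def)
qed

lemma compose_sup_distance:
  assumes Z: "ultrametric_space Z"
    and f: "f \<in> nonexpanding_maps X Y" "f' \<in> nonexpanding_maps X Y"
    and g: "g \<in> nonexpanding_maps Y Z" "g' \<in> nonexpanding_maps Y Z"
  shows "(SUP x\<in>pts X. dst Z (compose (pts X) g f x) (compose (pts X) g' f' x)) \<le>
    max (SUP y\<in>pts Y. dst Z (g y) (g' y)) (SUP x\<in>pts X. dst Y (f x) (f' x))"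
proof (rule SUP_least)
  fix x assume x: "x \<in> pts X"
  have fx: "f x \<in> pts Y" "f' x \<in> pts Y" using f x by (auto simp: nonexpanding_maps_def)
  then have gfx: "g (f x) \<in> pts Z" "g' (f x) \<in> pts Z" "g' (f' x) \<in> pts Z"
    using g by (auto simp: nonexpanding_maps_def)
  have "dst Z (g (f x)) (g' (f' x)) \<le> max (dst Z (g (f x)) (g' (f x))) (dst Z (g' (f x)) (g' (f' x)))"
    using Z gfx unfolding ultrametric_space_def by blast
  also have "\<dots> \<le> max (dst Z (g (f x)) (g' (f x))) (dst Y (f x) (f' x))"
    using g fx by (intro max.mono) (auto simp: nonexpanding_maps_def)
  also have "\<dots> \<le> max (SUP y\<in>pts Y. dst Z (g y) (g' y)) (SUP x\<in>pts X. dst Y (f x) (f' x))"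
    using x fx by (intro max.mono SUP_upper)
  finally show "dst Z (compose (pts X) g f x) (compose (pts X) g' f' x) \<le> \<dots>"
    using x by (simp add: compose_def)
qed

lemma nonexpanding_ext: "nonexpanding_maps X Y \<subseteq> pts X \<rightarrow>\<^sub>E pts Y"
  by (auto simp: nonexpanding_maps_def)

lemma compose_units:
  assumes "f \<in> pts X \<rightarrow>\<^sub>E pts Y"
  shows "compose (pts X) f (\<lambda>x\<in>pts X. x) = f" "compose (pts X) (\<lambda>y\<in>pts Y. y) f = f"
  using assms by (auto simp: compose_def fun_eq_iff PiE_def Pi_def extensional_def)

lemma compose_assoc':
  assumes "f \<in> pts X \<rightarrow>\<^sub>E pts Y"
  shows "compose (pts X) h (compose (pts X) g f) = compose (pts X) (compose (pts Y) h g) f"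
  using assms by (auto simp: compose_def fun_eq_iff PiE_def Pi_def)

lemma id_nonexpanding: "(\<lambda>x\<in>pts X. x) \<in> nonexpanding_maps X X"
  by (auto simp: nonexpanding_maps_def)

lemma enriched_category_UMet: "enriched_category (UMet \<mu>)"
  unfolding enriched_category_def
proof (intro conjI ballI)
  show "category (UMet \<mu>)"
    unfolding category_def
    by (intro conjI ballI)
      (simp_all add: UMet_def compose_nonexpanding id_nonexpanding
        compose_units[OF nonexpanding_ext[THEN subsetD]]
        compose_assoc'[OF nonexpanding_ext[THEN subsetD]])
next
  fix X Y assume "X \<in> obj (UMet \<mu>)" "Y \<in> obj (UMet \<mu>)"
  then show "ultrametric_space (hom_space (UMet \<mu>) X Y)"
    using ultrametric_sup_space[OF _ nonexpanding_ext, of Y X]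
    by (simp add: hom_space_def UMet_def mapping_space_def sup_space_def)
next
  fix X Y Z f f' g g'
  assume "Z \<in> obj (UMet \<mu>)" "f \<in> hom (UMet \<mu>) X Y" "f' \<in> hom (UMet \<mu>) X Y"
    "g \<in> hom (UMet \<mu>) Y Z" "g' \<in> hom (UMet \<mu>) Y Z"
  then show "hdist (UMet \<mu>) X Z (cmp (UMet \<mu>) X Y Z g f) (cmp (UMet \<mu>) X Y Z g' f')
      \<le> max (hdist (UMet \<mu>) Y Z g g') (hdist (UMet \<mu>) X Y f f')"
    using compose_sup_distance[of Z f X Y f' g g'] compose_nonexpanding[of _ X Y _ Z]
    by (simp add: UMet_def mapping_space_def sup_space_def)
qed

text \<open>
  The cardinals \<open>n < \<kappa>\<close>, as initial segments of \<open>\<kappa>\<close>: the sets of predecessors of those elements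
  that are initial ordinals.
\<close>

definition cardinals_below :: "'u rel \<Rightarrow> 'u set set" where
  "cardinals_below \<kappa> = {underS \<kappa> a |a. a \<in> Field \<kappa> \<and>
     (\<forall>b\<in>underS \<kappa> a. |underS \<kappa> b| <o |underS \<kappa> a| )}"

definition Set_below :: "'u rel \<Rightarrow> 'u space set" where
  "Set_below \<kappa> = discrete_space ` cardinals_below \<kappa>"

definition strongly_accessible_functor ::
  "'u rel \<Rightarrow> 'u rel \<Rightarrow> ('u space, 'u \<Rightarrow> 'u, 'u space, 'u \<Rightarrow> 'u) fctr \<Rightarrow> bool" where
  "strongly_accessible_functor \<kappa> \<mu> T \<longleftrightarrow>
     (let A = full_subcat (UMet \<mu>) (Set_below \<kappa>);
          K = inclusion_functor (UMet \<mu>) (Set_below \<kappa>);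
          TK = comp_functor A T K
      in is_left_Kan_extension A (UMet \<mu>) (UMet \<mu>) K TK T
           (\<lambda>n\<in>obj A. idn (UMet \<mu>) (fobj TK n)))"

definition strongly_accessible_monads :: "'u rel \<Rightarrow> 'u rel \<Rightarrow> ('u space, 'u \<Rightarrow> 'u) monad set" where
  "strongly_accessible_monads \<kappa> \<mu> =
     {M. enriched_monad (UMet \<mu>) M \<and> strongly_accessible_functor \<kappa> \<mu> (mfun M)}"

definition Monads_cat :: "'u rel \<Rightarrow> 'u rel \<Rightarrow> (('u space, 'u \<Rightarrow> 'u) monad, 'u space \<Rightarrow> 'u \<Rightarrow> 'u) cat" where
  "Monads_cat \<kappa> \<mu> = monad_category (UMet \<mu>) (strongly_accessible_monads \<kappa> \<mu>)"

section \<open>Varieties of ultra-quantitative algebras\<close>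

record 'u signature =
  syms :: "'u set"
  arity :: "'u \<Rightarrow> 'u set"

definition is_signature :: "'u rel \<Rightarrow> 'u rel \<Rightarrow> 'u signature \<Rightarrow> bool" where
  "is_signature \<kappa> \<mu> \<Sigma> \<longleftrightarrow> |syms \<Sigma>| <o \<mu> \<and> arity \<Sigma> \<in> syms \<Sigma> \<rightarrow>\<^sub>E cardinals_below \<kappa>"

record 'u algebra =
  und :: "'u space"
  opn :: "'u \<Rightarrow> ('u \<Rightarrow> 'u) \<Rightarrow> 'u"

definition algebras :: "'u rel \<Rightarrow> 'u signature \<Rightarrow> 'u algebra set" where
  "algebras \<mu> \<Sigma> = {A. und A \<in> obj (UMet \<mu>) \<and>
     opn A \<in> (\<Pi>\<^sub>E \<sigma>\<in>syms \<Sigma>. nonexpanding_maps (power_space (und A) (arity \<Sigma> \<sigma>)) (und A))}"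

definition homomorphisms :: "'u signature \<Rightarrow> 'u algebra \<Rightarrow> 'u algebra \<Rightarrow> ('u \<Rightarrow> 'u) set" where
  "homomorphisms \<Sigma> A B = {h \<in> nonexpanding_maps (und A) (und B).
     \<forall>\<sigma>\<in>syms \<Sigma>. \<forall>x\<in>arity \<Sigma> \<sigma> \<rightarrow>\<^sub>E pts (und A).
       h (opn A \<sigma> x) = opn B \<sigma> (\<lambda>i\<in>arity \<Sigma> \<sigma>. h (x i))}"

definition Alg_cat :: "'u rel \<Rightarrow> 'u signature \<Rightarrow> ('u algebra, 'u \<Rightarrow> 'u) ecat" where
  "Alg_cat \<mu> \<Sigma> =
     \<lparr>obj = algebras \<mu> \<Sigma>,
      hom = homomorphisms \<Sigma>,
      idn = (\<lambda>A. \<lambda>x\<in>pts (und A). x),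
      cmp = (\<lambda>A B C g f. compose (pts (und A)) g f),
      hdist = (\<lambda>A B. dst (sup_space (homomorphisms \<Sigma> A B) (pts (und A)) (und B)))\<rparr>"

lemma compose_homomorphisms:
  assumes f: "f \<in> homomorphisms \<Sigma> A B" and g: "g \<in> homomorphisms \<Sigma> B C"
    and A: "A \<in> algebras \<mu> \<Sigma>"
  shows "compose (pts (und A)) g f \<in> homomorphisms \<Sigma> A C"
proof -
  have "compose (pts (und A)) g f (opn A \<sigma> x) = opn C \<sigma> (\<lambda>i\<in>arity \<Sigma> \<sigma>. compose (pts (und A)) g f (x i))"
    if \<sigma>: "\<sigma> \<in> syms \<Sigma>" and x: "x \<in> arity \<Sigma> \<sigma> \<rightarrow>\<^sub>E pts (und A)" for \<sigma> x
  proof -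
    have "opn A \<sigma> \<in> nonexpanding_maps (power_space (und A) (arity \<Sigma> \<sigma>)) (und A)"
      using A \<sigma> by (auto simp: algebras_def)
    then have "opn A \<sigma> x \<in> pts (und A)"
      using x by (auto simp: nonexpanding_maps_def power_space_def sup_space_def)
    then have "compose (pts (und A)) g f (opn A \<sigma> x) = g (opn B \<sigma> (\<lambda>i\<in>arity \<Sigma> \<sigma>. f (x i)))"
      using f \<sigma> x by (simp add: compose_def homomorphisms_def)
    also have "(\<lambda>i\<in>arity \<Sigma> \<sigma>. f (x i)) \<in> arity \<Sigma> \<sigma> \<rightarrow>\<^sub>E pts (und B)"
      using f x by (auto simp: homomorphisms_def nonexpanding_maps_def)
    then have "g (opn B \<sigma> (\<lambda>i\<in>arity \<Sigma> \<sigma>. f (x i))) =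
        opn C \<sigma> (\<lambda>i\<in>arity \<Sigma> \<sigma>. g ((\<lambda>i\<in>arity \<Sigma> \<sigma>. f (x i)) i))"
      using g \<sigma> by (simp add: homomorphisms_def)
    also have "(\<lambda>i\<in>arity \<Sigma> \<sigma>. g ((\<lambda>i\<in>arity \<Sigma> \<sigma>. f (x i)) i)) =
        (\<lambda>i\<in>arity \<Sigma> \<sigma>. compose (pts (und A)) g f (x i))"
      using x by (intro restrict_ext) (auto simp: compose_def)
    finally show ?thesis .
  qed
  then show ?thesis
    using f g compose_nonexpanding by (auto simp: homomorphisms_def)
qed

lemma id_homomorphism:
  assumes A: "A \<in> algebras \<mu> \<Sigma>"
  shows "(\<lambda>x\<in>pts (und A). x) \<in> homomorphisms \<Sigma> A A"
proof -
  have "(\<lambda>x\<in>pts (und A). x) (opn A \<sigma> x) = opn A \<sigma> (\<lambda>i\<in>arity \<Sigma> \<sigma>. (\<lambda>x\<in>pts (und A). x) (x i))"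
    if \<sigma>: "\<sigma> \<in> syms \<Sigma>" and x: "x \<in> arity \<Sigma> \<sigma> \<rightarrow>\<^sub>E pts (und A)" for \<sigma> x
  proof -
    have "opn A \<sigma> \<in> nonexpanding_maps (power_space (und A) (arity \<Sigma> \<sigma>)) (und A)"
      using A \<sigma> by (auto simp: algebras_def)
    then have "opn A \<sigma> x \<in> pts (und A)"
      using x by (auto simp: nonexpanding_maps_def power_space_def sup_space_def)
    moreover have "(\<lambda>i\<in>arity \<Sigma> \<sigma>. (\<lambda>x\<in>pts (und A). x) (x i)) = x"
      using x by (auto simp: fun_eq_iff PiE_def Pi_def extensional_def)
    ultimately show ?thesis by simp
  qed
  then show ?thesis using id_nonexpanding by (simp add: homomorphisms_def)
qed

lemma enriched_category_Alg: "enriched_category (Alg_cat \<mu> \<Sigma>)"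
proof -
  have sub: "homomorphisms \<Sigma> A B \<subseteq> nonexpanding_maps (und A) (und B)" for A B
    by (auto simp: homomorphisms_def)
  note ext = subset_trans[OF sub nonexpanding_ext]
  show ?thesis
    unfolding enriched_category_def
  proof (intro conjI ballI)
    show "category (Alg_cat \<mu> \<Sigma>)"
      unfolding category_def
      by (intro conjI ballI)
        (simp_all add: Alg_cat_def compose_homomorphisms id_homomorphism
          compose_units[OF ext[THEN subsetD]] compose_assoc'[OF ext[THEN subsetD]])
  next
    fix A B assume "A \<in> obj (Alg_cat \<mu> \<Sigma>)" "B \<in> obj (Alg_cat \<mu> \<Sigma>)"
    then show "ultrametric_space (hom_space (Alg_cat \<mu> \<Sigma>) A B)"
      using ultrametric_sup_space[OF _ ext, of B A]
      by (simp add: hom_space_def Alg_cat_def UMet_def algebras_def sup_space_def)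
  next
    fix A B C f f' g g'
    assume "A \<in> obj (Alg_cat \<mu> \<Sigma>)" "C \<in> obj (Alg_cat \<mu> \<Sigma>)"
      "f \<in> hom (Alg_cat \<mu> \<Sigma>) A B" "f' \<in> hom (Alg_cat \<mu> \<Sigma>) A B"
      "g \<in> hom (Alg_cat \<mu> \<Sigma>) B C" "g' \<in> hom (Alg_cat \<mu> \<Sigma>) B C"
    then have h: "A \<in> algebras \<mu> \<Sigma>" "ultrametric_space (und C)"
      "f \<in> homomorphisms \<Sigma> A B" "f' \<in> homomorphisms \<Sigma> A B"
      "g \<in> homomorphisms \<Sigma> B C" "g' \<in> homomorphisms \<Sigma> B C"
      by (auto simp: Alg_cat_def algebras_def UMet_def)
    show "hdist (Alg_cat \<mu> \<Sigma>) A C (cmp (Alg_cat \<mu> \<Sigma>) A B C g f) (cmp (Alg_cat \<mu> \<Sigma>) A B C g' f')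
        \<le> max (hdist (Alg_cat \<mu> \<Sigma>) B C g g') (hdist (Alg_cat \<mu> \<Sigma>) A B f f')"
      using compose_sup_distance[OF h(2) sub[THEN subsetD, OF h(3)] sub[THEN subsetD, OF h(4)]
          sub[THEN subsetD, OF h(5)] sub[THEN subsetD, OF h(6)]]
        compose_homomorphisms[OF h(3) h(5) h(1)] compose_homomorphisms[OF h(4) h(6) h(1)] h
      by (simp add: Alg_cat_def sup_space_def)
  qed
qed

datatype 'u trm = Var 'u | App 'u "'u \<Rightarrow> 'u trm"

inductive_set "terms" :: "'u signature \<Rightarrow> 'u set \<Rightarrow> 'u trm set"
  for \<Sigma> :: "'u signature" and V :: "'u set" where
  Var: "x \<in> V \<Longrightarrow> Var x \<in> terms \<Sigma> V"
| App: "\<sigma> \<in> syms \<Sigma> \<Longrightarrow> ts \<in> extensional (arity \<Sigma> \<sigma>) \<Longrightarrow>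
    (\<And>i. i \<in> arity \<Sigma> \<sigma> \<Longrightarrow> ts i \<in> terms \<Sigma> V) \<Longrightarrow> App \<sigma> ts \<in> terms \<Sigma> V"

text \<open>\<open>eval \<Sigma> A f\<close> is the homomorphic extension of \<open>f : V \<rightarrow> |A|\<close> to terms.\<close>

primrec eval :: "'u signature \<Rightarrow> 'u algebra \<Rightarrow> ('u \<Rightarrow> 'u) \<Rightarrow> 'u trm \<Rightarrow> 'u" where
  "eval \<Sigma> A f (Var x) = f x"
| "eval \<Sigma> A f (App \<sigma> ts) = opn A \<sigma> (\<lambda>i\<in>arity \<Sigma> \<sigma>. eval \<Sigma> A f (ts i))"

text \<open>\<open>(l, \<epsilon>, r)\<close> is the quantitative equation \<open>l =\<^sub>\<epsilon> r\<close>. The set of variables is \<open>\<kappa>\<close> itself.\<close>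

definition quantitative_equations :: "'u rel \<Rightarrow> 'u signature \<Rightarrow> ('u trm \<times> rat \<times> 'u trm) set" where
  "quantitative_equations \<kappa> \<Sigma> =
     {(l, \<epsilon>, r). l \<in> terms \<Sigma> (Field \<kappa>) \<and> r \<in> terms \<Sigma> (Field \<kappa>) \<and> 0 \<le> \<epsilon>}"

definition satisfies ::
  "'u rel \<Rightarrow> 'u signature \<Rightarrow> 'u algebra \<Rightarrow> 'u trm \<times> rat \<times> 'u trm \<Rightarrow> bool" where
  "satisfies \<kappa> \<Sigma> A = (\<lambda>(l, \<epsilon>, r).
     \<forall>f \<in> Field \<kappa> \<rightarrow> pts (und A). dst (und A) (eval \<Sigma> A f l) (eval \<Sigma> A f r) \<le> ennreal (of_rat \<epsilon>))"

text \<open>A variety is represented by its signature together with its class of algebras.\<close>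

type_synonym 'u variety = "'u signature \<times> 'u algebra set"

definition varieties :: "'u rel \<Rightarrow> 'u rel \<Rightarrow> 'u variety set" where
  "varieties \<kappa> \<mu> = {(\<Sigma>, \<V>). is_signature \<kappa> \<mu> \<Sigma> \<and>
     (\<exists>E \<subseteq> quantitative_equations \<kappa> \<Sigma>.
        \<V> = {A \<in> algebras \<mu> \<Sigma>. \<forall>e\<in>E. satisfies \<kappa> \<Sigma> A e})}"

definition variety_cat :: "'u rel \<Rightarrow> 'u variety \<Rightarrow> ('u algebra, 'u \<Rightarrow> 'u) ecat" where
  "variety_cat \<mu> V = full_subcat (Alg_cat \<mu> (fst V)) (snd V)"

definition forgetful_functor ::
  "'u rel \<Rightarrow> 'u variety \<Rightarrow> ('u algebra, 'u \<Rightarrow> 'u, 'u space, 'u \<Rightarrow> 'u) fctr" where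
  "forgetful_functor \<mu> V = (let C = variety_cat \<mu> V in
     \<lparr>fobj = (\<lambda>A\<in>obj C. und A), farr = (\<lambda>A\<in>obj C. \<lambda>B\<in>obj C. \<lambda>h\<in>hom C A B. h)\<rparr>)"

definition concrete_functor ::
  "'u rel \<Rightarrow> 'u variety \<Rightarrow> 'u variety \<Rightarrow> ('u algebra, 'u \<Rightarrow> 'u, 'u algebra, 'u \<Rightarrow> 'u) fctr \<Rightarrow> bool" where
  "concrete_functor \<mu> V W F \<longleftrightarrow>
     enriched_functor (variety_cat \<mu> V) (variety_cat \<mu> W) F \<and>
     comp_functor (variety_cat \<mu> V) (forgetful_functor \<mu> W) F = forgetful_functor \<mu> V"

definition Varieties_cat ::
  "'u rel \<Rightarrow> 'u rel \<Rightarrow> ('u variety, ('u algebra, 'u \<Rightarrow> 'u, 'u algebra, 'u \<Rightarrow> 'u) fctr) cat" where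
  "Varieties_cat \<kappa> \<mu> =
     \<lparr>obj = varieties \<kappa> \<mu>,
      hom = (\<lambda>V W. {F. concrete_functor \<mu> V W F}),
      idn = (\<lambda>V. id_functor (variety_cat \<mu> V)),
      cmp = (\<lambda>V W X G F. comp_functor (variety_cat \<mu> V) G F)\<rparr>"

end

theory Submission
  imports Defs
begin

text \<open>
  The equivalence sends a strongly accessible monad \<open>M\<close> to the variety with an \<open>n\<close>-ary operation for
  every element of \<open>M n\<close>, \<open>n < \<kappa>\<close>, whose equations say that the operation of a variable is a projection,
  that operations compose as prescribed by the multiplication, and that operations are as close to each
  other as the elements of \<open>M n\<close>. Strong accessibility extends the operations \<open>A\<^sup>n \<rightarrow> [M n, A]\<close> of such
  an algebra to a structure map \<open>M A \<rightarrow> A\<close>, so its algebras are the Eilenberg-Moore algebras of \<open>M\<close>.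
  A concrete functor, applied to the free algebras \<open>N X\<close>, gives structure maps \<open>M (N X) \<rightarrow> N X\<close> and
  hence a monad morphism \<open>M X \<rightarrow> M (N X) \<rightarrow> N X\<close>; this yields full faithfulness.

  Conversely, the free algebra of a variety on \<open>X\<close> consists of the terms over \<open>X\<close> with the distance that
  is the supremum over all evaluations in algebras of the variety. That its monad is strongly
  accessible rests on the ultrametric inequality: \<open>d \<le> \<delta>\<close> is an equivalence relation on \<open>X\<close>, and the
  distance of two terms is determined by the distances, in the free algebra on the discrete set \<open>X\<close>, of
  the terms in which each variable is replaced by a representative of its class.
\<close>

section \<open>Equivalences of categories\<close>

text \<open>Sizes shape the proof. Points of spaces and operation symbols are elements of
  \<open>'u\<close>, fewer than \<mu> of them, so the elements of all \<open>M n\<close> and the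
  classes of terms must be coded and terms must be counted. Regularity of \<kappa> keeps heights and
  supports of terms below \<kappa>. The Kan extension is never built: strong accessibility enters as
  existence and uniqueness of maps out of \<open>M X\<close> for cocones, and uniqueness already
  forces the maps \<open>M g\<close> to cover \<open>M X\<close>. Discrete arities suffice for
  algebras because a cocone consists of bounds in the element of \<open>M n\<close>, bounds in the
  tuple and naturality in \<open>n\<close>; these are the distance equations, the nonexpanding
  operations, and the projection and substitution laws. In the converse direction the obstacle is
  that evaluations of terms over \<open>X\<close> must be nonexpanding, whereas a cocone only sees
  discrete arities. Collapsing \<open>X\<close> at radius \<delta> removes this constraint at the
  cost of an error \<delta>, and the ultrametric inequality absorbs the error instead of adding it
  up. The radius is taken strictly below the distance to be contradicted, because an optimal radius
  need not be attained.\<close>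

lemma category_idn: "category C \<Longrightarrow> a \<in> obj C \<Longrightarrow> idn C a \<in> hom C a a"
  by (simp add: category_def)

lemma category_cmp:
  "category C \<Longrightarrow> a \<in> obj C \<Longrightarrow> b \<in> obj C \<Longrightarrow> c \<in> obj C \<Longrightarrow> f \<in> hom C a b \<Longrightarrow> g \<in> hom C b c \<Longrightarrow>
    cmp C a b c g f \<in> hom C a c"
  by (simp add: category_def)

lemma category_idn_right:
  "category C \<Longrightarrow> a \<in> obj C \<Longrightarrow> b \<in> obj C \<Longrightarrow> f \<in> hom C a b \<Longrightarrow> cmp C a a b f (idn C a) = f"
  by (simp add: category_def)

lemma category_idn_left:
  "category C \<Longrightarrow> a \<in> obj C \<Longrightarrow> b \<in> obj C \<Longrightarrow> f \<in> hom C a b \<Longrightarrow> cmp C a b b (idn C b) f = f"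
  by (simp add: category_def)

lemma category_assoc:
  "category C \<Longrightarrow> a \<in> obj C \<Longrightarrow> b \<in> obj C \<Longrightarrow> c \<in> obj C \<Longrightarrow> d \<in> obj C \<Longrightarrow>
    f \<in> hom C a b \<Longrightarrow> g \<in> hom C b c \<Longrightarrow> h \<in> hom C c d \<Longrightarrow>
    cmp C a b d (cmp C b c d h g) f = cmp C a c d h (cmp C a b c g f)"
  by (simp add: category_def)

lemmas category_rules = category_idn category_cmp category_idn_right category_idn_left category_assoc

lemma category_op_cat: "category C \<Longrightarrow> category (op_cat C)"
  unfolding category_def op_cat_def by simp

text \<open>A fully faithful, essentially surjective functor has a quasi-inverse: choose a preimage
  up to isomorphism of every object, lift the conjugated maps by fullness, and check every equation
  in \<open>D\<close> after applying \<open>P\<close>. The functor runs from \<open>D\<close> to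
  \<open>C\<close> because the construction from monads to varieties is the explicit one.\<close>

lemma equivalent_categoriesI:
  assumes C: "category C" and D: "category D" and P: "is_functor D C P"
    and full: "\<And>a b h. a \<in> obj D \<Longrightarrow> b \<in> obj D \<Longrightarrow> h \<in> hom C (fobj P a) (fobj P b) \<Longrightarrow>
      \<exists>f\<in>hom D a b. farr P a b f = h"
    and faithful: "\<And>a b. a \<in> obj D \<Longrightarrow> b \<in> obj D \<Longrightarrow> inj_on (farr P a b) (hom D a b)"
    and ess_surj: "\<And>c. c \<in> obj C \<Longrightarrow> \<exists>d\<in>obj D. \<exists>h. is_iso C c (fobj P d) h"
  shows "equivalent_categories C D"
proof -
  have Pobj: "fobj P a \<in> obj C" if "a \<in> obj D" for a
    using P that by (auto simp: is_functor_def)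
  have Parr: "farr P a b f \<in> hom C (fobj P a) (fobj P b)"
    if "a \<in> obj D" "b \<in> obj D" "f \<in> hom D a b" for a b f
    using P that unfolding is_functor_def by blast
  have Pid: "farr P a a (idn D a) = idn C (fobj P a)" if "a \<in> obj D" for a
    using P that unfolding is_functor_def by blast
  have Pcmp: "farr P a c (cmp D a b c g f) =
      cmp C (fobj P a) (fobj P b) (fobj P c) (farr P b c g) (farr P a b f)"
    if "a \<in> obj D" "b \<in> obj D" "c \<in> obj D" "f \<in> hom D a b" "g \<in> hom D b c" for a b c f g
    using P that unfolding is_functor_def by blast
  have "\<forall>c\<in>obj C. \<exists>d h k. d \<in> obj D \<and> h \<in> hom C c (fobj P d) \<and> k \<in> hom C (fobj P d) c \<and>
      cmp C c (fobj P d) c k h = idn C c \<and> cmp C (fobj P d) c (fobj P d) h k = idn C (fobj P d)"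
    using ess_surj unfolding is_iso_def by meson
  then obtain q i j where q: "\<And>c. c \<in> obj C \<Longrightarrow> q c \<in> obj D"
    and i: "\<And>c. c \<in> obj C \<Longrightarrow> i c \<in> hom C c (fobj P (q c))"
    and j: "\<And>c. c \<in> obj C \<Longrightarrow> j c \<in> hom C (fobj P (q c)) c"
    and ji: "\<And>c. c \<in> obj C \<Longrightarrow> cmp C c (fobj P (q c)) c (j c) (i c) = idn C c"
    and ij: "\<And>c. c \<in> obj C \<Longrightarrow> cmp C (fobj P (q c)) c (fobj P (q c)) (i c) (j c) = idn C (fobj P (q c))"
    by metis
  define lift where "lift a b h = (SOME f. f \<in> hom D a b \<and> farr P a b f = h)" for a b h
  have lift: "lift a b h \<in> hom D a b" "farr P a b (lift a b h) = h"
    if "a \<in> obj D" "b \<in> obj D" "h \<in> hom C (fobj P a) (fobj P b)" for a b h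
    using someI_ex[OF full[OF that, unfolded Bex_def]] unfolding lift_def by auto
  have eqI: "f = g" if "a \<in> obj D" "b \<in> obj D" "f \<in> hom D a b" "g \<in> hom D a b"
    "farr P a b f = farr P a b g" for a b f g
    using faithful that by (auto dest: inj_onD)
  \<comment> \<open>The conjugate of \<open>h\<close> by the chosen isomorphisms runs between
    objects in the image of \<open>P\<close>, so fullness lifts it to \<open>D\<close>.\<close>
  define t where "t a b h = cmp C (fobj P (q a)) b (fobj P (q b)) (i b) (cmp C (fobj P (q a)) a b h (j a))" for a b h
  have t: "t a b h \<in> hom C (fobj P (q a)) (fobj P (q b))"
    if "a \<in> obj C" "b \<in> obj C" "h \<in> hom C a b" for a b h
    unfolding t_def using that by (intro category_cmp[OF C]) (auto simp: q i j Pobj)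
  define Q where "Q = \<lparr>fobj = (\<lambda>c\<in>obj C. q c),
    farr = (\<lambda>a\<in>obj C. \<lambda>b\<in>obj C. \<lambda>h\<in>hom C a b. lift (q a) (q b) (t a b h))\<rparr>"
  have Q: "fobj Q a = q a" if "a \<in> obj C" for a using that by (simp add: Q_def)
  have Qh: "farr Q a b h = lift (q a) (q b) (t a b h)"
    if "a \<in> obj C" "b \<in> obj C" "h \<in> hom C a b" for a b h using that by (simp add: Q_def)
  note rules = q i j Pobj Parr Pid Pcmp ji ij lift t category_rules[OF C] category_rules[OF D] Q Qh
  have tid: "t a a (idn C a) = idn C (fobj P (q a))" if "a \<in> obj C" for a
    using that by (simp add: t_def rules)
  have tcmp: "t a c (cmp C a b c g f) = cmp C (fobj P (q a)) (fobj P (q b)) (fobj P (q c)) (t b c g) (t a b f)"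
    if "a \<in> obj C" "b \<in> obj C" "c \<in> obj C" "f \<in> hom C a b" "g \<in> hom C b c" for a b c f g
  proof -
    \<comment> \<open>Rebracketing brings \<open>j b\<close> and \<open>i b\<close> together in the
      middle, where \<open>ji\<close> cancels them.\<close>
    have "cmp C (fobj P (q a)) (fobj P (q b)) (fobj P (q c)) (t b c g) (t a b f) =
      cmp C (fobj P (q a)) c (fobj P (q c)) (i c) (cmp C (fobj P (q a)) b c g
        (cmp C (fobj P (q a)) b b (cmp C b (fobj P (q b)) b (j b) (i b)) (cmp C (fobj P (q a)) a b f (j a))))"
      unfolding t_def using that
      by (simp add: category_assoc[OF C] category_cmp[OF C] q i j Pobj)
    also have "\<dots> = t a c (cmp C a b c g f)"
      using that by (simp add: t_def rules)
    finally show ?thesis by simp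
  qed
  have QF: "is_functor C D Q"
    unfolding is_functor_def
  proof (intro conjI ballI)
    fix a b c f g assume *: "a \<in> obj C" "b \<in> obj C" "c \<in> obj C" "f \<in> hom C a b" "g \<in> hom C b c"
    show "farr Q a c (cmp C a b c g f) = cmp D (fobj Q a) (fobj Q b) (fobj Q c) (farr Q b c g) (farr Q a b f)"
      by (rule eqI[of "q a" "q c"]) (use * in \<open>simp_all add: rules tcmp\<close>)
  next
    fix a assume "a \<in> obj C"
    then show "farr Q a a (idn C a) = idn D (fobj Q a)"
      by (intro eqI[of "q a" "q a"]) (simp_all add: rules tid)
  qed (auto simp: Q_def q lift t)
  have \<eta>: "nat_iso C C (id_functor C) (comp_functor C P Q) (\<lambda>c\<in>obj C. i c)"
    unfolding nat_iso_def nat_trans_def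
  proof (intro conjI ballI)
    fix a b f assume *: "a \<in> obj C" "b \<in> obj C" "f \<in> hom C a b"
    have "cmp C a (fobj P (q a)) (fobj P (q b)) (t a b f) (i a) =
       cmp C a b (fobj P (q b)) (i b) (cmp C a a b f (cmp C a (fobj P (q a)) a (j a) (i a)))"
      unfolding t_def using *
      by (simp add: category_assoc[OF C] category_cmp[OF C] q i j Pobj)
    then show "cmp C (fobj (id_functor C) a) (fobj (id_functor C) b) (fobj (comp_functor C P Q) b)
        ((\<lambda>c\<in>obj C. i c) b) (farr (id_functor C) a b f) =
      cmp C (fobj (id_functor C) a) (fobj (comp_functor C P Q) a) (fobj (comp_functor C P Q) b)
        (farr (comp_functor C P Q) a b f) ((\<lambda>c\<in>obj C. i c) a)"
      using * by (simp add: id_functor_def comp_functor_def rules)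
  qed (auto simp: id_functor_def comp_functor_def is_iso_def rules intro!: bexI[OF _ j])
  \<comment> \<open>By fullness, \<open>j\<close> at an object \<open>fobj P a\<close> is the image
    of a map of \<open>D\<close>; faithfulness then reflects its inverse and its naturality.\<close>
  define e where "e a = lift (q (fobj P a)) a (j (fobj P a))" for a
  have e: "e a \<in> hom D (q (fobj P a)) a" "farr P (q (fobj P a)) a (e a) = j (fobj P a)"
    if "a \<in> obj D" for a using that by (simp_all add: e_def lift q j Pobj)
  have e_iso: "is_iso D (q (fobj P a)) a (e a)" if a: "a \<in> obj D" for a
    unfolding is_iso_def
  proof (intro conjI bexI)
    let ?k = "lift a (q (fobj P a)) (i (fobj P a))"
    show k: "?k \<in> hom D a (q (fobj P a))" using a by (simp add: rules)
    show "cmp D (q (fobj P a)) a (q (fobj P a)) ?k (e a) = idn D (q (fobj P a))"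
      by (rule eqI[of "q (fobj P a)" "q (fobj P a)"]) (use a in \<open>simp_all add: rules e\<close>)
    show "cmp D a (q (fobj P a)) a (e a) ?k = idn D a"
      by (rule eqI[of a a]) (use a in \<open>simp_all add: rules e\<close>)
  qed (use a e in auto)
  have \<epsilon>: "nat_iso D D (comp_functor D Q P) (id_functor D) (\<lambda>a\<in>obj D. e a)"
    unfolding nat_iso_def nat_trans_def
  proof (intro conjI ballI)
    fix a b f assume *: "a \<in> obj D" "b \<in> obj D" "f \<in> hom D a b"
    let ?a = "fobj P a" and ?b = "fobj P b"
    have "cmp C (fobj P (q ?a)) (fobj P (q ?b)) ?b (j ?b) (t ?a ?b (farr P a b f)) =
       cmp C (fobj P (q ?a)) ?b ?b (cmp C ?b (fobj P (q ?b)) ?b (j ?b) (i ?b))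
         (cmp C (fobj P (q ?a)) ?a ?b (farr P a b f) (j ?a))"
      unfolding t_def using *
      by (simp add: category_assoc[OF C] category_cmp[OF C] q i j Pobj Parr)
    also have "\<dots> = cmp C (fobj P (q ?a)) ?a ?b (farr P a b f) (j ?a)"
      using * by (simp add: rules)
    finally have "cmp D (q ?a) (q ?b) b (e b) (lift (q ?a) (q ?b) (t ?a ?b (farr P a b f))) =
        cmp D (q ?a) a b f (e a)"
      by (intro eqI[of "q ?a" b]) (use * in \<open>simp_all add: rules e\<close>)
    then show "cmp D (fobj (comp_functor D Q P) a) (fobj (comp_functor D Q P) b) (fobj (id_functor D) b)
        ((\<lambda>a\<in>obj D. e a) b) (farr (comp_functor D Q P) a b f) =
      cmp D (fobj (comp_functor D Q P) a) (fobj (id_functor D) a) (fobj (id_functor D) b)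
        (farr (id_functor D) a b f) ((\<lambda>a\<in>obj D. e a) a)"
      using * by (simp add: id_functor_def comp_functor_def rules)
  qed (auto simp: id_functor_def comp_functor_def rules e_iso e)
  show ?thesis
    unfolding equivalent_categories_def using C D QF P \<eta> \<epsilon> by blast
qed

section \<open>Small sets\<close>

locale arity_universe =
  fixes \<kappa> \<mu> :: "'u rel"
  assumes Cinfinite_arity: "Cinfinite \<kappa>" and regular_arity: "regularCard \<kappa>"
    and universe: "universe \<kappa> \<mu>"
begin

abbreviation small :: "'b set \<Rightarrow> bool" where
  "small A \<equiv> |A| <o \<mu>"

lemma Cinfinite_universe: "Cinfinite \<mu>"
  using universe Cinfinite_arity cinfinite_mono ordLess_imp_ordLeq unfolding universe_def by blast

lemma small_ordLeq: "|A| \<le>o |B| \<Longrightarrow> small B \<Longrightarrow> small A"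
  using ordLeq_ordLess_trans by blast

lemma small_subset: "A \<subseteq> B \<Longrightarrow> small B \<Longrightarrow> small A"
  using card_of_mono1 small_ordLeq by blast

lemma small_image: "small A \<Longrightarrow> small (f ` A)"
  using card_of_image small_ordLeq by blast

lemma small_UN: "small I \<Longrightarrow> (\<And>i. i \<in> I \<Longrightarrow> small (A i)) \<Longrightarrow> small (\<Union>i\<in>I. A i)"
  using card_of_UNION_ordLess_infinite_Field_regularCard[OF _ Cinfinite_universe] universe
  unfolding universe_def by blast

lemma small_finite: "finite A \<Longrightarrow> small A"
  using Cinfinite_universe unfolding cinfinite_def
  by (metis card_of_Well_order card_of_Field_ordIso finite_ordLess_infinite Field_card_of card_order_on_well_order_on)

lemma small_Un: "small A \<Longrightarrow> small B \<Longrightarrow> small (A \<union> B)"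
proof -
  assume "small A" "small B"
  then have "small (\<Union>b\<in>{True, False}. if b then A else B)"
    using small_UN[OF small_finite, of "{True, False}" "\<lambda>b. if b then A else B"] by simp
  then show "small (A \<union> B)" by (simp add: Un_commute)
qed

lemma small_Sigma: 
  assumes "small A" "\<And>a. a \<in> A \<Longrightarrow> small (B a)"
  shows "small (Sigma A B)"
proof -
  have "Sigma A B = (\<Union>a\<in>A. Pair a ` B a)" by auto
  then show ?thesis using assms by (simp add: small_UN small_image)
qed

lemma below_arity_small: "|n| <o \<kappa> \<Longrightarrow> small n"
  using universe ordLess_transitive unfolding universe_def by blast

text \<open>Smallness is measured by a cardinal on \<open>'u\<close>, so a small set of any type can
  be renamed by elements of \<open>'u\<close>. This supplies names for operation symbols and for
  classes of terms.\<close>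

lemma small_encoding: 
  assumes "small (A :: 'b set)" 
  obtains B :: "'u set" and e where "bij_betw e A B" "small B"
proof -
  obtain B where "B \<subset> Field \<mu>" "|A| =o |B|" "|B| <o \<mu>"
    using internalize_card_of_ordLess assms by metis
  then show thesis using card_of_ordIso that by blast
qed

text \<open>The closure of \<mu> under powers is assumed for subsets of \<open>'u\<close>; an
  encoding of \<open>A\<close> carries it to every type. Terms are counted with it.\<close>

lemma small_PiE:
  assumes n: "|n :: 'u set| <o \<kappa>" and A: "small A"
  shows "small (n \<rightarrow>\<^sub>E A)"
proof -
  obtain B :: "'u set" and e where e: "bij_betw e A B" and B: "small B"
    using small_encoding[OF A] .
  have "|n \<rightarrow>\<^sub>E A| \<le>o |Func n B|"
  proof (rule card_of_ordLeqI)
    show "inj_on (\<lambda>f i. if i \<in> n then e (f i) else undefined) (n \<rightarrow>\<^sub>E A)"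
    proof (rule inj_onI)
      fix f g assume f: "f \<in> n \<rightarrow>\<^sub>E A" and g: "g \<in> n \<rightarrow>\<^sub>E A"
        and eq: "(\<lambda>i. if i \<in> n then e (f i) else undefined) = (\<lambda>i. if i \<in> n then e (g i) else undefined)"
      have "f i = g i" if i: "i \<in> n" for i
      proof -
        have "e (f i) = e (g i)" using fun_cong[OF eq, of i] i by simp
        then show ?thesis using e f g i by (auto simp: bij_betw_def inj_on_def PiE_iff)
      qed
      then show "f = g" using f g by (metis PiE_ext)
    qed
    show "(\<lambda>i. if i \<in> n then e (f i) else undefined) \<in> Func n B" if "f \<in> n \<rightarrow>\<^sub>E A" for f
      using that e by (auto simp: Func_def bij_betw_def)
  qed
  moreover have "small (Func n B)"
    using universe n B unfolding universe_def cexp_def Field_card_of by blast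
  ultimately show ?thesis by (rule small_ordLeq)
qed

lemma cardinals_belowD:
  assumes "n \<in> cardinals_below \<kappa>"
  shows "|n| <o \<kappa>" "n \<subseteq> Field \<kappa>" "small n"
proof -
  obtain a where a: "a \<in> Field \<kappa>" "n = underS \<kappa> a" using assms by (auto simp: cardinals_below_def)
  show "|n| <o \<kappa>" using a card_of_underS[of \<kappa> a] Cinfinite_arity by simp
  then show "small n" by (rule below_arity_small)
  show "n \<subseteq> Field \<kappa>" unfolding a(2) by (auto simp: underS_def Field_def)
qed

lemma small_Field: "small (Field \<kappa>)"
  using universe Cinfinite_arity card_of_Field_ordIso ordIso_ordLess_trans
  unfolding universe_def by blast

lemma small_cardinals_below: "small (cardinals_below \<kappa>)"
proof (rule small_subset)
  show "cardinals_below \<kappa> \<subseteq> underS \<kappa> ` Field \<kappa>" by (auto simp: cardinals_below_def)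
qed (simp add: small_image small_Field)

text \<open>A set smaller than \<kappa> has the size of some initial segment of \<kappa>, and the
  shortest such segment is an initial ordinal.\<close>

lemma exists_cardinal_below:
  assumes S: "|S| <o \<kappa>"
  obtains n f where "n \<in> cardinals_below \<kappa>" "bij_betw f n S"
proof -
  have wo: "Well_order \<kappa>" using Cinfinite_arity card_order_on_well_order_on by blast
  have "\<exists>a\<in>Field \<kappa>. |S| =o Restr \<kappa> (underS \<kappa> a)"
    using ordLess_iff_ordIso_Restr[OF wo card_of_Well_order] S by blast
  then obtain a where a: "a \<in> Field \<kappa>" "|S| =o Restr \<kappa> (underS \<kappa> a)" by blast
  have fieldR: "Field (Restr \<kappa> (underS \<kappa> a)) = underS \<kappa> a"
    using wo Field_Restr_ofilter wo_rel.underS_ofilter wo_rel_def by metis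
  have "|underS \<kappa> a| =o |S|"
    using card_of_cong[OF a(2)] unfolding fieldR Field_card_of by (rule ordIso_symmetric)
  then have a: "a \<in> {a \<in> Field \<kappa>. |underS \<kappa> a| =o |S|}" (is "_ \<in> ?P") using a(1) by blast
  have wf: "wf (\<kappa> - Id)" using wo by (simp add: well_order_on_def)
  \<comment> \<open>Minimality of \<open>m\<close> excludes a shorter segment of the same size,
    which is the condition in \<open>cardinals_below\<close>.\<close>
  obtain m where m: "m \<in> ?P" "\<And>b. (b, m) \<in> \<kappa> - Id \<Longrightarrow> b \<notin> ?P"
    using wfE_min[OF wf a] by blast
  have "underS \<kappa> m \<in> cardinals_below \<kappa>"
    unfolding cardinals_below_def
  proof (rule CollectI, intro exI conjI ballI)
    fix b assume b: "b \<in> underS \<kappa> m"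
    then have bF: "b \<in> Field \<kappa>" and bm: "(b, m) \<in> \<kappa> - Id" by (auto simp: underS_def Field_def)
    have "underS \<kappa> b \<subseteq> underS \<kappa> m"
      using wo b underS_incr[of \<kappa> b m] bm
      by (auto simp: well_order_on_def linear_order_on_def partial_order_on_def preorder_on_def)
    then have "|underS \<kappa> b| \<le>o |underS \<kappa> m|" by (rule card_of_mono1)
    moreover have "\<not> |underS \<kappa> b| =o |underS \<kappa> m|"
      using m bF bm ordIso_transitive by blast
    ultimately show "|underS \<kappa> b| <o |underS \<kappa> m|"
      using ordLeq_iff_ordLess_or_ordIso by blast
  qed (use m in auto)
  moreover obtain f where "bij_betw f (underS \<kappa> m) S"
    using m(1) card_of_ordIso by blast
  ultimately show thesis using that by blast
qed

section \<open>Closure properties of sets smaller than the regular cardinal\<close>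

lemma below_arity_finite: "finite S \<Longrightarrow> |S| <o \<kappa>"
  using Cinfinite_arity unfolding cinfinite_def
  by (metis card_of_Well_order finite_ordLess_infinite Field_card_of card_order_on_well_order_on)

lemma below_arity_UN:
  "|I| <o \<kappa> \<Longrightarrow> (\<And>i. i \<in> I \<Longrightarrow> |A i| <o \<kappa>) \<Longrightarrow> |\<Union>i\<in>I. A i| <o \<kappa>"
  using card_of_UNION_ordLess_infinite_Field_regularCard[OF regular_arity Cinfinite_arity] by blast

lemma below_arity_image: "|A| <o \<kappa> \<Longrightarrow> |f ` A| <o \<kappa>"
  using card_of_image ordLeq_ordLess_trans by blast

text \<open>By regularity a subset with fewer than \<kappa> elements is not cofinal. This bounds the
  ranks of the arguments of an operation.\<close>

lemma below_arity_bounded: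
  assumes K: "K \<subseteq> Field \<kappa>" "|K| <o \<kappa>"
  obtains b where "b \<in> Field \<kappa>" "\<And>a. a \<in> K \<Longrightarrow> (a, b) \<in> \<kappa> \<and> a \<noteq> b"
proof -
  have "\<not> |K| =o \<kappa>" using K(2) not_ordLess_ordIso by blast
  then have "\<not> cofinal K \<kappa>" using regular_arity K(1) unfolding regularCard_def by blast
  then obtain b where b: "b \<in> Field \<kappa>" "\<And>a. a \<in> K \<Longrightarrow> \<not> (b \<noteq> a \<and> (b, a) \<in> \<kappa>)"
    unfolding cofinal_def by blast
  have wo: "Well_order \<kappa>" using Cinfinite_arity card_order_on_well_order_on by blast
  have le: "(a, b) \<in> \<kappa>" if "a \<in> K" for a
    using b that K(1) wo unfolding well_order_on_def linear_order_on_def total_on_def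
      partial_order_on_def preorder_on_def refl_on_def by (metis subsetD)
  have "\<not> finite (Field \<kappa>)" using Cinfinite_arity by (simp add: cinfinite_def)
  \<comment> \<open>So far \<open>b\<close> is only a weak upper bound; an infinite cardinal has no
    last element, so some \<open>c\<close> lies strictly above.\<close>
  then obtain c where c: "c \<in> Field \<kappa>" "b \<noteq> c" "(b, c) \<in> \<kappa>"
    using infinite_Card_order_limit Cinfinite_arity b(1) by metis
  have "(a, c) \<in> \<kappa> \<and> a \<noteq> c" if "a \<in> K" for a
    using le[OF that] c wo unfolding well_order_on_def linear_order_on_def
      partial_order_on_def preorder_on_def antisym_def trans_def by metis
  then show thesis using that c(1) by blast
qed

end

text \<open>The pair \<open>(a, t)\<close> says that the height of \<open>t\<close> is at most the
  ordinal \<open>a\<close>. The heights are elements of \<kappa>, so that there are few layers to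
  count.\<close>

inductive_set ranked_terms :: "'u rel \<Rightarrow> 'u signature \<Rightarrow> 'u set \<Rightarrow> ('u \<times> 'u trm) set"
  for \<kappa> :: "'u rel" and \<Sigma> :: "'u signature" and V :: "'u set" where
  "x \<in> V \<Longrightarrow> (a, Var x) \<in> ranked_terms \<kappa> \<Sigma> V"
| "\<sigma> \<in> syms \<Sigma> \<Longrightarrow> ts \<in> extensional (arity \<Sigma> \<sigma>) \<Longrightarrow>
    (\<And>i. i \<in> arity \<Sigma> \<sigma> \<Longrightarrow> b i \<in> underS \<kappa> a \<and> (b i, ts i) \<in> ranked_terms \<kappa> \<Sigma> V) \<Longrightarrow>
    (a, App \<sigma> ts) \<in> ranked_terms \<kappa> \<Sigma> V"

context arity_universe
begin

text \<open>Terms of height at most \<open>a\<close> are variables or tuples of terms of smaller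
  height, indexed by an arity below \<kappa>. Each layer is therefore small by well-founded
  induction, and \<kappa> many layers exhaust the terms.\<close>

lemma small_terms:
  assumes \<Sigma>: "is_signature \<kappa> \<mu> \<Sigma>" and V: "small V"
  shows "small (terms \<Sigma> V)"
proof -
  define R where "R a = {t. (a, t) \<in> ranked_terms \<kappa> \<Sigma> V}" for a
  have ar: "arity \<Sigma> \<sigma> \<in> cardinals_below \<kappa>" if "\<sigma> \<in> syms \<Sigma>" for \<sigma>
    using that \<Sigma> by (auto simp: is_signature_def)
  have step: "R a \<subseteq> Var ` V \<union> (\<Union>\<sigma>\<in>syms \<Sigma>. App \<sigma> ` (arity \<Sigma> \<sigma> \<rightarrow>\<^sub>E (\<Union>b\<in>underS \<kappa> a. R b)))" for a
  proof
    fix t assume "t \<in> R a"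
    then have "(a, t) \<in> ranked_terms \<kappa> \<Sigma> V" by (simp add: R_def)
    then show "t \<in> Var ` V \<union> (\<Union>\<sigma>\<in>syms \<Sigma>. App \<sigma> ` (arity \<Sigma> \<sigma> \<rightarrow>\<^sub>E (\<Union>b\<in>underS \<kappa> a. R b)))"
    proof cases
      case (2 \<sigma> ts b)
      then have "ts \<in> arity \<Sigma> \<sigma> \<rightarrow>\<^sub>E (\<Union>b\<in>underS \<kappa> a. R b)" unfolding R_def by (auto simp: PiE_iff)
      with 2 show ?thesis by blast
    qed auto
  qed
  have wf: "wf (\<kappa> - Id)"
    using Cinfinite_arity by (simp add: card_order_on_def well_order_on_def)
  have R: "small (R a)" for a
    using wf
  proof (induction a)
    case (less a)
    have "underS \<kappa> a \<subseteq> Field \<kappa>" by (auto simp: underS_def Field_def)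
    then have "small (underS \<kappa> a)" using small_Field by (rule small_subset)
    then have "small (\<Union>b\<in>underS \<kappa> a. R b)"
    proof (rule small_UN)
      fix b assume "b \<in> underS \<kappa> a"
      then show "small (R b)" by (intro less) (auto simp: underS_def)
    qed
    then have "small (App \<sigma> ` (arity \<Sigma> \<sigma> \<rightarrow>\<^sub>E (\<Union>b\<in>underS \<kappa> a. R b)))" if "\<sigma> \<in> syms \<Sigma>" for \<sigma>
      by (rule small_image[OF small_PiE[OF cardinals_belowD(1)[OF ar[OF that]]]])
    then have "small (\<Union>\<sigma>\<in>syms \<Sigma>. App \<sigma> ` (arity \<Sigma> \<sigma> \<rightarrow>\<^sub>E (\<Union>b\<in>underS \<kappa> a. R b)))"
      using \<Sigma> by (intro small_UN) (simp_all add: is_signature_def)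
    then show ?case
      by (rule small_subset[OF step small_Un[OF small_image[OF V]]])
  qed
  have "\<exists>a\<in>Field \<kappa>. (a, t) \<in> ranked_terms \<kappa> \<Sigma> V" if "t \<in> terms \<Sigma> V" for t
    using that
  proof induction
    case (Var x)
    have "Field \<kappa> \<noteq> {}" using Cinfinite_arity by (auto simp: cinfinite_def)
    then show ?case using Var by (auto intro: ranked_terms.intros)
  next
    case (App \<sigma> ts)
    then obtain b where b: "\<And>i. i \<in> arity \<Sigma> \<sigma> \<Longrightarrow> b i \<in> Field \<kappa> \<and> (b i, ts i) \<in> ranked_terms \<kappa> \<Sigma> V"
      by metis
    \<comment> \<open>The fewer than \<kappa> ranks of the arguments have a strict upper bound in
      \<kappa>, which serves as rank of the whole term.\<close>
    obtain c where "c \<in> Field \<kappa>" "\<And>a. a \<in> b ` arity \<Sigma> \<sigma> \<Longrightarrow> (a, c) \<in> \<kappa> \<and> a \<noteq> c"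
      using below_arity_bounded[of "b ` arity \<Sigma> \<sigma>"] b
        below_arity_image[OF cardinals_belowD(1)[OF ar[OF App(1)]]] by blast
    then show ?case using App b
      by (intro bexI[of _ c] ranked_terms.intros(2)[of \<sigma> \<Sigma> ts b]) (simp_all add: underS_def)
  qed
  then have "terms \<Sigma> V \<subseteq> (\<Union>a\<in>Field \<kappa>. R a)" by (auto simp: R_def)
  then show ?thesis by (rule small_subset) (rule small_UN[OF small_Field R])
qed

end

section \<open>Nonexpanding maps and enriched monads, elementwise\<close>

abbreviation "NE \<equiv> nonexpanding_maps"
abbreviation "TO M \<equiv> fobj (mfun M)"
abbreviation "TA M \<equiv> farr (mfun M)"

lemma NE_app: "f \<in> NE X Y \<Longrightarrow> x \<in> pts X \<Longrightarrow> f x \<in> pts Y"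
  by (auto simp: nonexpanding_maps_def)

lemma NE_le: "f \<in> NE X Y \<Longrightarrow> x \<in> pts X \<Longrightarrow> y \<in> pts X \<Longrightarrow> dst Y (f x) (f y) \<le> dst X x y"
  by (auto simp: nonexpanding_maps_def)

lemma NE_eqI: "f \<in> NE X Y \<Longrightarrow> g \<in> NE X Z \<Longrightarrow> (\<And>x. x \<in> pts X \<Longrightarrow> f x = g x) \<Longrightarrow> f = g"
  by (auto simp: nonexpanding_maps_def PiE_iff intro: extensionalityI)

lemma restrict_NE:
  "(\<And>x. x \<in> pts X \<Longrightarrow> f x \<in> pts Y) \<Longrightarrow>
   (\<And>x y. x \<in> pts X \<Longrightarrow> y \<in> pts X \<Longrightarrow> dst Y (f x) (f y) \<le> dst X x y) \<Longrightarrow>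
   restrict f (pts X) \<in> NE X Y"
  by (auto simp: nonexpanding_maps_def)

lemma ultrametric_zero: "ultrametric_space X \<Longrightarrow> x \<in> pts X \<Longrightarrow> y \<in> pts X \<Longrightarrow> dst X x y = 0 \<longleftrightarrow> x = y"
  by (simp add: ultrametric_space_def)

lemma ultrametric_refl: "ultrametric_space X \<Longrightarrow> dst X x x = 0"
  unfolding ultrametric_space_def by blast

lemma ultrametric_sym: "ultrametric_space X \<Longrightarrow> dst X x y = dst X y x"
  unfolding ultrametric_space_def by metis

lemma ultrametric_trans:
  "ultrametric_space X \<Longrightarrow> x \<in> pts X \<Longrightarrow> y \<in> pts X \<Longrightarrow> z \<in> pts X \<Longrightarrow>
    dst X x y \<le> e \<Longrightarrow> dst X y z \<le> e \<Longrightarrow> dst X x z \<le> e"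
  unfolding ultrametric_space_def by (meson max.boundedI order_trans)

lemma ultrametric_discrete: "ultrametric_space (discrete_space A)"
  by (auto simp: ultrametric_space_def discrete_space_def)

lemma pts_discrete [simp]: "pts (discrete_space A) = A"
  by (simp add: discrete_space_def)

lemma NE_discrete: "ultrametric_space X \<Longrightarrow> NE (discrete_space n) X = n \<rightarrow>\<^sub>E pts X"
  by (auto simp: nonexpanding_maps_def discrete_space_def ultrametric_refl)

lemma compose_eq_iff: "compose A g f = compose A g' f' \<longleftrightarrow> (\<forall>x\<in>A. g (f x) = g' (f' x))"
  by (auto simp: compose_def fun_eq_iff)

lemma compose_eq_id_iff: "compose A g f = (\<lambda>x\<in>A. x) \<longleftrightarrow> (\<forall>x\<in>A. g (f x) = x)"
  by (auto simp: compose_def fun_eq_iff)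

lemma compose_eq_NE_iff: "h \<in> NE X Y \<Longrightarrow> compose (pts X) g f = h \<longleftrightarrow> (\<forall>x\<in>pts X. g (f x) = h x)"
  by (auto simp: compose_def fun_eq_iff nonexpanding_maps_def PiE_iff extensional_def)

lemma UMet_simps [simp]:
  "hom (UMet \<mu>) = NE"
  "idn (UMet \<mu>) X = (\<lambda>x\<in>pts X. x)"
  "cmp (UMet \<mu>) X Y Z g f = compose (pts X) g f"
  by (simp_all add: UMet_def)

lemma obj_UMet: "X \<in> obj (UMet \<mu>) \<longleftrightarrow> ultrametric_space X \<and> |pts X| <o \<mu>"
  by (simp add: UMet_def)

lemma UMet_ultra: "X \<in> obj (UMet \<mu>) \<Longrightarrow> ultrametric_space X"
  by (simp add: obj_UMet)

lemma hdist_UMet_le_iff: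
  assumes "f \<in> NE X Y" "g \<in> NE X Y"
  shows "hdist (UMet \<mu>) X Y f g \<le> e \<longleftrightarrow> (\<forall>x\<in>pts X. dst Y (f x) (g x) \<le> e)"
  using assms by (simp add: UMet_def mapping_space_def sup_space_def SUP_le_iff)

lemma le_iff_all_upper: "(a :: 'a :: order) \<le> b \<longleftrightarrow> (\<forall>e. b \<le> e \<longrightarrow> a \<le> e)"
  by (meson order_refl order_trans)

text \<open>A supremum is determined by its upper bounds \<open>e\<close>. Quantifying over them
  replaces distances of maps by distances of values, and no supremum has to be computed
  later.\<close>

lemma hom_space_UMet_NE_iff:
  "\<phi> \<in> NE (hom_space (UMet \<mu>) X Y) (hom_space (UMet \<mu>) X' Y') \<longleftrightarrow>
    \<phi> \<in> extensional (NE X Y) \<and> (\<forall>f\<in>NE X Y. \<phi> f \<in> NE X' Y') \<and>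
    (\<forall>f\<in>NE X Y. \<forall>g\<in>NE X Y. \<forall>e. (\<forall>x\<in>pts X. dst Y (f x) (g x) \<le> e) \<longrightarrow>
      (\<forall>x\<in>pts X'. dst Y' (\<phi> f x) (\<phi> g x) \<le> e))" (is "?l \<longleftrightarrow> ?r")
proof -
  have "(hdist (UMet \<mu>) X' Y' (\<phi> f) (\<phi> g) \<le> hdist (UMet \<mu>) X Y f g) \<longleftrightarrow>
      (\<forall>e. (\<forall>x\<in>pts X. dst Y (f x) (g x) \<le> e) \<longrightarrow> (\<forall>x\<in>pts X'. dst Y' (\<phi> f x) (\<phi> g x) \<le> e))"
    if "f \<in> NE X Y" "g \<in> NE X Y" "\<phi> f \<in> NE X' Y'" "\<phi> g \<in> NE X' Y'" for f g
    using that by (subst le_iff_all_upper) (simp add: hdist_UMet_le_iff)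
  then show ?thesis
    unfolding nonexpanding_maps_def[of "hom_space _ _ _"] by (auto simp: hom_space_def PiE_iff)
qed

text \<open>Maps of spaces are extensional, so the functor laws may be read at points. The last
  clause is the enrichment, freed from suprema by \<open>hom_space_UMet_NE_iff\<close>.\<close>

lemma enriched_endofunctor_iff:
  "enriched_functor (UMet \<mu>) (UMet \<mu>) F \<longleftrightarrow>
    fobj F \<in> obj (UMet \<mu>) \<rightarrow>\<^sub>E obj (UMet \<mu>) \<and>
    farr F \<in> extensional (obj (UMet \<mu>)) \<and>
    (\<forall>X\<in>obj (UMet \<mu>). farr F X \<in> extensional (obj (UMet \<mu>))) \<and>
    (\<forall>X\<in>obj (UMet \<mu>). \<forall>Y\<in>obj (UMet \<mu>). farr F X Y \<in> extensional (NE X Y)) \<and>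
    (\<forall>X\<in>obj (UMet \<mu>). \<forall>Y\<in>obj (UMet \<mu>). \<forall>f\<in>NE X Y. farr F X Y f \<in> NE (fobj F X) (fobj F Y)) \<and>
    (\<forall>X\<in>obj (UMet \<mu>). \<forall>z\<in>pts (fobj F X). farr F X X (\<lambda>x\<in>pts X. x) z = z) \<and>
    (\<forall>X\<in>obj (UMet \<mu>). \<forall>Y\<in>obj (UMet \<mu>). \<forall>Z\<in>obj (UMet \<mu>). \<forall>f\<in>NE X Y. \<forall>g\<in>NE Y Z.
      \<forall>z\<in>pts (fobj F X). farr F X Z (compose (pts X) g f) z = farr F Y Z g (farr F X Y f z)) \<and>
    (\<forall>X\<in>obj (UMet \<mu>). \<forall>Y\<in>obj (UMet \<mu>). \<forall>f\<in>NE X Y. \<forall>g\<in>NE X Y. \<forall>e.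
      (\<forall>x\<in>pts X. dst Y (f x) (g x) \<le> e) \<longrightarrow>
      (\<forall>z\<in>pts (fobj F X). dst (fobj F Y) (farr F X Y f z) (farr F X Y g z) \<le> e))"
    (is "?l \<longleftrightarrow> ?r")
proof -
  have eq: "(farr F X X (\<lambda>x\<in>pts X. x) = (\<lambda>x\<in>pts (fobj F X). x)) \<longleftrightarrow>
      (\<forall>z\<in>pts (fobj F X). farr F X X (\<lambda>x\<in>pts X. x) z = z)"
    if "farr F X X (\<lambda>x\<in>pts X. x) \<in> NE (fobj F X) (fobj F X)" for X
    using NE_eqI[OF that id_nonexpanding] by auto
  have "farr F X Z (compose (pts X) g f) = compose (pts (fobj F X)) (farr F Y Z g) (farr F X Y f) \<longleftrightarrow>
      (\<forall>z\<in>pts (fobj F X). farr F X Z (compose (pts X) g f) z = farr F Y Z g (farr F X Y f z))"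
    if "farr F X Z (compose (pts X) g f) \<in> NE (fobj F X) (fobj F Z)" for X Y Z f g
    using compose_eq_NE_iff[OF that, of "farr F Y Z g" "farr F X Y f"] by auto
  note eqs = eq this
  show ?thesis
  proof
    assume ?l
    then show ?r
      unfolding enriched_functor_def is_functor_def hom_space_UMet_NE_iff
      by (auto simp: NE_app compose_eq)
  next
    assume r: ?r
    then have "farr F X Y f \<in> NE (fobj F X) (fobj F Y)"
      if "X \<in> obj (UMet \<mu>)" "Y \<in> obj (UMet \<mu>)" "f \<in> NE X Y" for X Y f
      using that by blast
    note arr = this
    show ?l
      unfolding enriched_functor_def is_functor_def hom_space_UMet_NE_iff
      using r by (simp add: PiE_iff eqs arr id_nonexpanding compose_nonexpanding)
  qed
qed

lemma nat_trans_UMet_iff: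
  "nat_trans (UMet \<mu>) (UMet \<mu>) F G \<alpha> \<longleftrightarrow>
    \<alpha> \<in> (\<Pi>\<^sub>E X\<in>obj (UMet \<mu>). NE (fobj F X) (fobj G X)) \<and>
    (\<forall>X\<in>obj (UMet \<mu>). \<forall>Y\<in>obj (UMet \<mu>). \<forall>f\<in>NE X Y. \<forall>z\<in>pts (fobj F X).
      \<alpha> Y (farr F X Y f z) = farr G X Y f (\<alpha> X z))"
  by (simp add: nat_trans_def compose_eq_iff)

lemma enriched_monad_iff:
  "enriched_monad (UMet \<mu>) M \<longleftrightarrow>
    enriched_functor (UMet \<mu>) (UMet \<mu>) (mfun M) \<and>
    munit M \<in> (\<Pi>\<^sub>E X\<in>obj (UMet \<mu>). NE X (TO M X)) \<and>
    mmult M \<in> (\<Pi>\<^sub>E X\<in>obj (UMet \<mu>). NE (TO M (TO M X)) (TO M X)) \<and>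
    (\<forall>X\<in>obj (UMet \<mu>). \<forall>Y\<in>obj (UMet \<mu>). \<forall>f\<in>NE X Y.
      (\<forall>x\<in>pts X. munit M Y (f x) = TA M X Y f (munit M X x)) \<and>
      (\<forall>z\<in>pts (TO M (TO M X)).
        mmult M Y (TA M (TO M X) (TO M Y) (TA M X Y f) z) =
        TA M X Y f (mmult M X z))) \<and>
    (\<forall>X\<in>obj (UMet \<mu>).
      (\<forall>z\<in>pts (TO M X).
        mmult M X (munit M (TO M X) z) = z \<and>
        mmult M X (TA M X (TO M X) (munit M X) z) = z) \<and>
      (\<forall>z\<in>pts (TO M (TO M (TO M X))).
        mmult M X (mmult M (TO M X) z) =
        mmult M X (TA M (TO M (TO M X)) (TO M X) (mmult M X) z)))"
  (is "?l \<longleftrightarrow> ?r")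
proof (cases "enriched_functor (UMet \<mu>) (UMet \<mu>) (mfun M)")
  case True
  then have T: "TO M \<in> obj (UMet \<mu>) \<rightarrow>\<^sub>E obj (UMet \<mu>)"
    by (simp add: enriched_endofunctor_iff)
  then have "\<And>X. X \<in> obj (UMet \<mu>) \<Longrightarrow> TO M X \<in> obj (UMet \<mu>)" by auto
  moreover have "\<And>X Y f. X \<in> obj (UMet \<mu>) \<Longrightarrow> Y \<in> obj (UMet \<mu>) \<Longrightarrow> f \<in> NE X Y \<Longrightarrow>
      TA M X Y f \<in> NE (TO M X) (TO M Y)"
    using True by (simp add: enriched_endofunctor_iff)
  ultimately show ?thesis
    unfolding enriched_monad_def Let_def
    by (simp add: True nat_trans_UMet_iff compose_eq_iff compose_eq_id_iff id_functor_def
        comp_functor_def PiE_iff ball_conj_distrib conj_ac cong: conj_cong)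
qed (simp add: enriched_monad_def)

lemma monad_morphism_iff:
  "monad_morphism (UMet \<mu>) M N \<alpha> \<longleftrightarrow>
    \<alpha> \<in> (\<Pi>\<^sub>E X\<in>obj (UMet \<mu>). NE (TO M X) (fobj (mfun N) X)) \<and>
    (\<forall>X\<in>obj (UMet \<mu>). \<forall>Y\<in>obj (UMet \<mu>). \<forall>f\<in>NE X Y. \<forall>z\<in>pts (TO M X).
      \<alpha> Y (TA M X Y f z) = farr (mfun N) X Y f (\<alpha> X z)) \<and>
    (\<forall>X\<in>obj (UMet \<mu>). compose (pts X) (\<alpha> X) (munit M X) = munit N X) \<and>
    (\<forall>X\<in>obj (UMet \<mu>). \<forall>z\<in>pts (TO M (TO M X)).
      \<alpha> X (mmult M X z) = mmult N X (farr (mfun N) (TO M X) (fobj (mfun N) X) (\<alpha> X)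
        (\<alpha> (TO M X) z)))"
  unfolding monad_morphism_def Let_def nat_trans_UMet_iff
  by (auto simp: compose_eq_iff) (auto simp: compose_def)

lemma enriched_endofunctorD:
  assumes "enriched_functor (UMet \<mu>) (UMet \<mu>) F"
  shows enriched_endofunctor_obj: "X \<in> obj (UMet \<mu>) \<Longrightarrow> fobj F X \<in> obj (UMet \<mu>)"
    and enriched_endofunctor_arr: "X \<in> obj (UMet \<mu>) \<Longrightarrow> Y \<in> obj (UMet \<mu>) \<Longrightarrow> f \<in> NE X Y \<Longrightarrow>
      farr F X Y f \<in> NE (fobj F X) (fobj F Y)"
    and enriched_endofunctor_id: "X \<in> obj (UMet \<mu>) \<Longrightarrow> z \<in> pts (fobj F X) \<Longrightarrow>
      farr F X X (\<lambda>x\<in>pts X. x) z = z"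
    and enriched_endofunctor_cmp: "X \<in> obj (UMet \<mu>) \<Longrightarrow> Y \<in> obj (UMet \<mu>) \<Longrightarrow> Z \<in> obj (UMet \<mu>) \<Longrightarrow>
      f \<in> NE X Y \<Longrightarrow> g \<in> NE Y Z \<Longrightarrow> z \<in> pts (fobj F X) \<Longrightarrow>
      farr F X Z (compose (pts X) g f) z = farr F Y Z g (farr F X Y f z)"
    and enriched_endofunctor_dst: "X \<in> obj (UMet \<mu>) \<Longrightarrow> Y \<in> obj (UMet \<mu>) \<Longrightarrow> f \<in> NE X Y \<Longrightarrow>
      g \<in> NE X Y \<Longrightarrow> (\<And>x. x \<in> pts X \<Longrightarrow> dst Y (f x) (g x) \<le> e) \<Longrightarrow> z \<in> pts (fobj F X) \<Longrightarrow>
      dst (fobj F Y) (farr F X Y f z) (farr F X Y g z) \<le> e"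
  using assms unfolding enriched_endofunctor_iff by (auto simp: PiE_iff)

lemma enriched_monadD:
  assumes "enriched_monad (UMet \<mu>) M"
  shows monad_functor: "enriched_functor (UMet \<mu>) (UMet \<mu>) (mfun M)"
    and monad_unit: "X \<in> obj (UMet \<mu>) \<Longrightarrow> munit M X \<in> NE X (TO M X)"
    and monad_mult: "X \<in> obj (UMet \<mu>) \<Longrightarrow>
      mmult M X \<in> NE (TO M (TO M X)) (TO M X)"
    and monad_unit_nat: "X \<in> obj (UMet \<mu>) \<Longrightarrow> Y \<in> obj (UMet \<mu>) \<Longrightarrow> f \<in> NE X Y \<Longrightarrow> x \<in> pts X \<Longrightarrow>
      munit M Y (f x) = TA M X Y f (munit M X x)"
    and monad_mult_nat: "X \<in> obj (UMet \<mu>) \<Longrightarrow> Y \<in> obj (UMet \<mu>) \<Longrightarrow> f \<in> NE X Y \<Longrightarrow>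
      z \<in> pts (TO M (TO M X)) \<Longrightarrow>
      mmult M Y (TA M (TO M X) (TO M Y) (TA M X Y f) z) =
      TA M X Y f (mmult M X z)"
    and monad_unit_left: "X \<in> obj (UMet \<mu>) \<Longrightarrow> z \<in> pts (TO M X) \<Longrightarrow>
      mmult M X (munit M (TO M X) z) = z"
    and monad_unit_right: "X \<in> obj (UMet \<mu>) \<Longrightarrow> z \<in> pts (TO M X) \<Longrightarrow>
      mmult M X (TA M X (TO M X) (munit M X) z) = z"
    and monad_assoc: "X \<in> obj (UMet \<mu>) \<Longrightarrow>
      z \<in> pts (TO M (TO M (TO M X))) \<Longrightarrow>
      mmult M X (mmult M (TO M X) z) =
      mmult M X (TA M (TO M (TO M X)) (TO M X) (mmult M X) z)"
  using assms unfolding enriched_monad_iff by (auto simp: PiE_iff)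

lemmas monad_obj = enriched_endofunctor_obj[OF monad_functor]
lemmas monad_arr = enriched_endofunctor_arr[OF monad_functor]
lemmas monad_id = enriched_endofunctor_id[OF monad_functor]
lemmas monad_cmp = enriched_endofunctor_cmp[OF monad_functor]
lemmas monad_dst = enriched_endofunctor_dst[OF monad_functor]

lemma monad_morphismD:
  assumes "monad_morphism (UMet \<mu>) M N \<alpha>"
  shows monad_morphism_PiE: "\<alpha> \<in> (\<Pi>\<^sub>E X\<in>obj (UMet \<mu>). NE (TO M X) (TO N X))"
    and monad_morphism_NE: "X \<in> obj (UMet \<mu>) \<Longrightarrow> \<alpha> X \<in> NE (TO M X) (TO N X)"
    and monad_morphism_nat: "X \<in> obj (UMet \<mu>) \<Longrightarrow> Y \<in> obj (UMet \<mu>) \<Longrightarrow> f \<in> NE X Y \<Longrightarrow>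
      z \<in> pts (TO M X) \<Longrightarrow> \<alpha> Y (TA M X Y f z) = TA N X Y f (\<alpha> X z)"
    and monad_morphism_unit: "X \<in> obj (UMet \<mu>) \<Longrightarrow> x \<in> pts X \<Longrightarrow> \<alpha> X (munit M X x) = munit N X x"
    and monad_morphism_mult: "X \<in> obj (UMet \<mu>) \<Longrightarrow> z \<in> pts (TO M (TO M X)) \<Longrightarrow>
      \<alpha> X (mmult M X z) = mmult N X (TA N (TO M X) (TO N X) (\<alpha> X)
        (\<alpha> (TO M X) z))"
proof -
  show "\<alpha> X (munit M X x) = munit N X x" if "X \<in> obj (UMet \<mu>)" "x \<in> pts X"
  proof -
    have "compose (pts X) (\<alpha> X) (munit M X) = munit N X"
      using assms that(1) unfolding monad_morphism_iff by blast
    then show ?thesis using that(2) by (metis compose_eq)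
  qed
qed (use assms in \<open>auto simp: monad_morphism_iff PiE_iff\<close>)

lemma monad_morphismI:
  assumes "enriched_monad (UMet \<mu>) M" "enriched_monad (UMet \<mu>) N"
    and "\<alpha> \<in> (\<Pi>\<^sub>E X\<in>obj (UMet \<mu>). NE (TO M X) (TO N X))"
    and "\<And>X Y f z. X \<in> obj (UMet \<mu>) \<Longrightarrow> Y \<in> obj (UMet \<mu>) \<Longrightarrow> f \<in> NE X Y \<Longrightarrow>
      z \<in> pts (TO M X) \<Longrightarrow> \<alpha> Y (TA M X Y f z) = TA N X Y f (\<alpha> X z)"
    and "\<And>X x. X \<in> obj (UMet \<mu>) \<Longrightarrow> x \<in> pts X \<Longrightarrow> \<alpha> X (munit M X x) = munit N X x"
    and "\<And>X z. X \<in> obj (UMet \<mu>) \<Longrightarrow> z \<in> pts (TO M (TO M X)) \<Longrightarrow>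
      \<alpha> X (mmult M X z) = mmult N X (TA N (TO M X) (TO N X) (\<alpha> X)
        (\<alpha> (TO M X) z))"
  shows "monad_morphism (UMet \<mu>) M N \<alpha>"
proof -
  have "compose (pts X) (\<alpha> X) (munit M X) = munit N X" if "X \<in> obj (UMet \<mu>)" for X
    using compose_eq_NE_iff[OF monad_unit[OF assms(2) that]] assms(5) that by blast
  then show ?thesis
    unfolding monad_morphism_iff using assms by blast
qed

lemma monad_morphism_id:
  assumes M: "enriched_monad (UMet \<mu>) M"
  shows "monad_morphism (UMet \<mu>) M M (\<lambda>X\<in>obj (UMet \<mu>). \<lambda>x\<in>pts (TO M X). x)"
  by (rule monad_morphismI[OF M M])
    (simp_all add: id_nonexpanding NE_app[OF monad_arr[OF M]] NE_app[OF monad_unit[OF M]]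
      NE_app[OF monad_mult[OF M]] monad_obj[OF M] monad_id[OF M])

lemma monad_morphism_compose:
  assumes M: "enriched_monad (UMet \<mu>) M" and N: "enriched_monad (UMet \<mu>) N" and P: "enriched_monad (UMet \<mu>) P"
    and \<alpha>: "monad_morphism (UMet \<mu>) M N \<alpha>" and \<beta>: "monad_morphism (UMet \<mu>) N P \<beta>"
  shows "monad_morphism (UMet \<mu>) M P (\<lambda>X\<in>obj (UMet \<mu>). compose (pts (TO M X)) (\<beta> X) (\<alpha> X))"
proof (rule monad_morphismI[OF M P])
  fix X z assume X: "X \<in> obj (UMet \<mu>)" and z: "z \<in> pts (TO M (TO M X))"
  note a = monad_morphism_NE[OF \<alpha>] and b = monad_morphism_NE[OF \<beta>]
  note [simp] = X z monad_obj[OF M] monad_obj[OF N] monad_obj[OF P] a b NE_app[OF a] NE_app[OF b]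
    NE_app[OF monad_mult[OF M]] NE_app[OF monad_mult[OF N]] compose_nonexpanding monad_arr[OF N]
    NE_app[OF monad_arr[OF N]]
  have "\<beta> X (\<alpha> X (mmult M X z)) = mmult P X (TA P (TO N X) (TO P X) (\<beta> X)
    (TA P (TO M X) (TO N X) (\<alpha> X) (\<beta> (TO M X) (\<alpha> (TO M X) z))))"
    by (simp add: monad_morphism_mult[OF \<alpha>] monad_morphism_mult[OF \<beta>] monad_morphism_nat[OF \<beta>, symmetric])
  then show "(\<lambda>X\<in>obj (UMet \<mu>). compose (pts (TO M X)) (\<beta> X) (\<alpha> X)) X (mmult M X z) =
    mmult P X (TA P (TO M X) (TO P X)
      ((\<lambda>X\<in>obj (UMet \<mu>). compose (pts (TO M X)) (\<beta> X) (\<alpha> X)) X)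
      ((\<lambda>X\<in>obj (UMet \<mu>). compose (pts (TO M X)) (\<beta> X) (\<alpha> X)) (TO M X) z))"
    by (simp add: compose_eq monad_cmp[OF P, of _ "TO N X"])
next
  fix X Y f z assume "X \<in> obj (UMet \<mu>)" "Y \<in> obj (UMet \<mu>)" "f \<in> NE X Y" "z \<in> pts (TO M X)"
  then show "(\<lambda>X\<in>obj (UMet \<mu>). compose (pts (TO M X)) (\<beta> X) (\<alpha> X)) Y (TA M X Y f z) =
      TA P X Y f ((\<lambda>X\<in>obj (UMet \<mu>). compose (pts (TO M X)) (\<beta> X) (\<alpha> X)) X z)"
    by (simp add: compose_eq NE_app[OF monad_arr[OF M]] NE_app[OF monad_morphism_NE[OF \<alpha>]]
      monad_morphism_nat[OF \<alpha>] monad_morphism_nat[OF \<beta>])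
qed (simp_all add: compose_eq NE_app[OF monad_unit[OF M]] monad_morphism_unit[OF \<alpha>] monad_morphism_unit[OF \<beta>]
   compose_nonexpanding[OF monad_morphism_NE[OF \<alpha>] monad_morphism_NE[OF \<beta>]])

section \<open>The category of strongly accessible monads\<close>

lemma Monads_cat_simps:
  "obj (Monads_cat \<kappa> \<mu>) = strongly_accessible_monads \<kappa> \<mu>"
  "hom (Monads_cat \<kappa> \<mu>) M N = {\<alpha>. monad_morphism (UMet \<mu>) M N \<alpha>}"
  "idn (Monads_cat \<kappa> \<mu>) M = (\<lambda>X\<in>obj (UMet \<mu>). \<lambda>x\<in>pts (TO M X). x)"
  "cmp (Monads_cat \<kappa> \<mu>) M N P \<beta> \<alpha> = (\<lambda>X\<in>obj (UMet \<mu>). compose (pts (TO M X)) (\<beta> X) (\<alpha> X))"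
  by (simp_all add: Monads_cat_def monad_category_def)

lemma category_Monads_cat: "category (Monads_cat \<kappa> \<mu>)"
proof -
  have M: "enriched_monad (UMet \<mu>) M" if "M \<in> strongly_accessible_monads \<kappa> \<mu>" for M
    using that by (simp add: strongly_accessible_monads_def)
  have ext: "\<alpha> X \<in> pts (TO M X) \<rightarrow>\<^sub>E pts (TO N X)"
    if "monad_morphism (UMet \<mu>) M N \<alpha>" "X \<in> obj (UMet \<mu>)" for M N \<alpha> X
    using monad_morphism_NE[OF that] nonexpanding_ext by blast
  show ?thesis
    unfolding category_def Monads_cat_simps
  proof (intro conjI ballI)
    fix M N \<alpha> assume "\<alpha> \<in> {\<alpha>. monad_morphism (UMet \<mu>) M N \<alpha>}"
    then have \<alpha>: "monad_morphism (UMet \<mu>) M N \<alpha>" by simp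
    show "(\<lambda>X\<in>obj (UMet \<mu>). compose (pts (TO M X)) (\<alpha> X)
        ((\<lambda>X\<in>obj (UMet \<mu>). \<lambda>x\<in>pts (TO M X). x) X)) = \<alpha>"
      and "(\<lambda>X\<in>obj (UMet \<mu>). compose (pts (TO M X))
        ((\<lambda>X\<in>obj (UMet \<mu>). \<lambda>x\<in>pts (TO N X). x) X) (\<alpha> X)) = \<alpha>"
      using monad_morphism_PiE[OF \<alpha>] compose_units[OF ext[OF \<alpha>]]
      by (auto simp: fun_eq_iff restrict_def PiE_iff extensional_def)
  next
    fix M N P Q \<alpha> \<beta> \<gamma>
    assume \<alpha>: "\<alpha> \<in> {\<alpha>. monad_morphism (UMet \<mu>) M N \<alpha>}"
    show "(\<lambda>X\<in>obj (UMet \<mu>). compose (pts (TO M X)) (\<gamma> X)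
        ((\<lambda>X\<in>obj (UMet \<mu>). compose (pts (TO M X)) (\<beta> X) (\<alpha> X)) X)) =
      (\<lambda>X\<in>obj (UMet \<mu>). compose (pts (TO M X))
        ((\<lambda>X\<in>obj (UMet \<mu>). compose (pts (TO N X)) (\<gamma> X) (\<beta> X)) X) (\<alpha> X))"
      using \<alpha> by (intro restrict_ext) (simp add: compose_assoc'[OF ext])
  qed (simp_all add: M monad_morphism_id monad_morphism_compose[OF M M M])
qed

section \<open>Strong accessibility\<close>

text \<open>This is \<open>weighted_cocones\<close> for the inclusion of \<open>Set_below\<close>
  and the restriction of \<open>T\<close> along it, freed from the two functor records.\<close>

definition cocones ::
  "'u rel \<Rightarrow> 'u rel \<Rightarrow> ('u space, 'u \<Rightarrow> 'u, 'u space, 'u \<Rightarrow> 'u) fctr \<Rightarrow> 'u space \<Rightarrow> 'u space \<Rightarrow>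
   ('u space \<Rightarrow> ('u \<Rightarrow> 'u) \<Rightarrow> 'u \<Rightarrow> 'u) set" where
  "cocones \<kappa> \<mu> T X Y =
    {\<Theta> \<in> (\<Pi>\<^sub>E N\<in>Set_below \<kappa>. NE (hom_space (UMet \<mu>) N X) (hom_space (UMet \<mu>) (fobj T N) Y)).
      \<forall>m\<in>Set_below \<kappa>. \<forall>n\<in>Set_below \<kappa>. \<forall>h\<in>NE m n. \<forall>g\<in>NE n X.
        \<Theta> m (compose (pts m) g h) = compose (pts (fobj T m)) (\<Theta> n g) (farr T m n h)}"

definition cocone_space ::
  "'u rel \<Rightarrow> 'u rel \<Rightarrow> ('u space, 'u \<Rightarrow> 'u, 'u space, 'u \<Rightarrow> 'u) fctr \<Rightarrow> 'u space \<Rightarrow> 'u space \<Rightarrow>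
   ('u space \<Rightarrow> ('u \<Rightarrow> 'u) \<Rightarrow> 'u \<Rightarrow> 'u) space" where
  "cocone_space \<kappa> \<mu> T X Y = \<lparr>pts = cocones \<kappa> \<mu> T X Y,
    dst = (\<lambda>\<theta> \<theta>'. if \<theta> \<in> cocones \<kappa> \<mu> T X Y \<and> \<theta>' \<in> cocones \<kappa> \<mu> T X Y
      then (SUP n\<in>Set_below \<kappa>. SUP g\<in>NE n X. hdist (UMet \<mu>) (fobj T n) Y (\<theta> n g) (\<theta>' n g)) else 0)\<rparr>"

text \<open>The comparison map in the definition of a left Kan extension, in the case where the unit
  is an identity.\<close>

definition kan_map ::
  "'u rel \<Rightarrow> ('u space, 'u \<Rightarrow> 'u, 'u space, 'u \<Rightarrow> 'u) fctr \<Rightarrow> 'u space \<Rightarrow> ('u \<Rightarrow> 'u) \<Rightarrow>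
    'u space \<Rightarrow> ('u \<Rightarrow> 'u) \<Rightarrow> 'u \<Rightarrow> 'u" where
  "kan_map \<kappa> T X f = (\<lambda>N\<in>Set_below \<kappa>. \<lambda>g\<in>NE N X. compose (pts (fobj T N)) f (farr T N X g))"

context arity_universe
begin

abbreviation "UM \<equiv> obj (UMet \<mu>)"
abbreviation "D \<equiv> discrete_space"

lemma discrete_obj: "n \<in> cardinals_below \<kappa> \<Longrightarrow> D n \<in> UM"
  by (simp add: obj_UMet ultrametric_discrete cardinals_belowD(3))

lemma Set_below_obj: "N \<in> Set_below \<kappa> \<Longrightarrow> N \<in> UM"
  by (auto simp: Set_below_def discrete_obj)

text \<open>Functoriality of the inclusion and of the restricted functor, and naturality of the
  identity unit, hold for every enriched \<open>T\<close>. What remains of the Kan condition is the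
  isomorphism of hom-spaces.\<close>

lemma strongly_accessible_iff:
  "strongly_accessible_functor \<kappa> \<mu> T \<longleftrightarrow> enriched_functor (UMet \<mu>) (UMet \<mu>) T \<and>
    (\<forall>X\<in>UM. \<forall>Y\<in>UM. isometric_iso (hom_space (UMet \<mu>) (fobj T X) Y) (cocone_space \<kappa> \<mu> T X Y)
      (kan_map \<kappa> T X))"
proof (cases "enriched_functor (UMet \<mu>) (UMet \<mu>) T")
  case T: True
  define A where "A = full_subcat (UMet \<mu>) (Set_below \<kappa>)"
  define K where "K = inclusion_functor (UMet \<mu>) (Set_below \<kappa>)"
  define TK where "TK = comp_functor A T K"
  have A [simp]: "obj A = Set_below \<kappa>" "hom A = NE" "\<And>X. idn A X = (\<lambda>x\<in>pts X. x)"
    "\<And>X Y Z g f. cmp A X Y Z g f = compose (pts X) g f" "hom_space A = hom_space (UMet \<mu>)"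
    by (auto simp: A_def full_subcat_def UMet_def hom_space_def fun_eq_iff)
  have K [simp]: "N \<in> Set_below \<kappa> \<Longrightarrow> fobj K N = N"
    "m \<in> Set_below \<kappa> \<Longrightarrow> n \<in> Set_below \<kappa> \<Longrightarrow> h \<in> NE m n \<Longrightarrow> farr K m n h = h" for N m n h
    unfolding K_def inclusion_functor_def id_functor_def A_def[symmetric] by auto
  have TK [simp]: "N \<in> Set_below \<kappa> \<Longrightarrow> fobj TK N = fobj T N"
    "m \<in> Set_below \<kappa> \<Longrightarrow> n \<in> Set_below \<kappa> \<Longrightarrow> h \<in> NE m n \<Longrightarrow> farr TK m n h = farr T m n h" for N m n h
    unfolding TK_def comp_functor_def by auto
  have "enriched_functor A (UMet \<mu>) K"
    unfolding enriched_functor_def is_functor_def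
    by (auto simp: K_def inclusion_functor_def id_functor_def A_def[symmetric] Set_below_obj
        compose_nonexpanding id_nonexpanding)
      (auto simp: hom_space_UMet_NE_iff)
  moreover have "enriched_functor A (UMet \<mu>) TK"
    unfolding enriched_functor_def is_functor_def
  proof (intro conjI ballI)
    fix m n assume *: "m \<in> obj A" "n \<in> obj A"
    then have "farr T m n \<in> NE (hom_space (UMet \<mu>) m n) (hom_space (UMet \<mu>) (fobj T m) (fobj T n))"
      using T Set_below_obj by (simp add: enriched_functor_def)
    moreover have "farr TK m n = farr T m n"
      using calculation * unfolding nonexpanding_maps_def[of "hom_space _ _ _"]
      by (auto simp: hom_space_def PiE_iff TK_def comp_functor_def fun_eq_iff extensional_def)
    ultimately show "farr TK m n \<in> NE (hom_space A m n) (hom_space (UMet \<mu>) (fobj TK m) (fobj TK n))"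
      and "farr TK m n \<in> hom A m n \<rightarrow>\<^sub>E hom (UMet \<mu>) (fobj TK m) (fobj TK n)"
      using * by (auto simp: hom_space_UMet_NE_iff PiE_iff)
  next
    fix a b c f g assume "a \<in> obj A" "b \<in> obj A" "c \<in> obj A" "f \<in> hom A a b" "g \<in> hom A b c"
    then show "farr TK a c (cmp A a b c g f) =
        cmp (UMet \<mu>) (fobj TK a) (fobj TK b) (fobj TK c) (farr TK b c g) (farr TK a b f)"
      using T Set_below_obj compose_nonexpanding[of f a b g c]
      unfolding enriched_functor_def is_functor_def by simp
  next
    fix a assume "a \<in> obj A"
    then show "farr TK a a (idn A a) = idn (UMet \<mu>) (fobj TK a)"
      using T Set_below_obj TK(2)[OF _ _ id_nonexpanding, of a] unfolding enriched_functor_def is_functor_def by simp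
  next
    show "fobj TK \<in> obj A \<rightarrow>\<^sub>E obj (UMet \<mu>)"
      using enriched_endofunctor_obj[OF T] Set_below_obj
      by (auto simp: TK_def comp_functor_def)
  qed (auto simp: TK_def comp_functor_def)
  moreover have "nat_trans A (UMet \<mu>) TK TK (\<lambda>n\<in>Set_below \<kappa>. \<lambda>x\<in>pts (fobj TK n). x)"
    using NE_app[OF enriched_endofunctor_arr[OF T]] Set_below_obj
    by (auto simp: nat_trans_def compose_eq_iff id_nonexpanding)
  moreover have "weighted_cocones A (UMet \<mu>) (UMet \<mu>) K TK X Y = cocone_space \<kappa> \<mu> T X Y" for X Y
  proof -
    let ?H = "{\<theta> \<in> (\<Pi>\<^sub>E n\<in>Set_below \<kappa>.
         NE (hom_space (UMet \<mu>) (fobj K n) X) (hom_space (UMet \<mu>) (fobj TK n) Y)).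
       \<forall>m\<in>Set_below \<kappa>. \<forall>n\<in>Set_below \<kappa>. \<forall>h\<in>NE m n. \<forall>g\<in>NE (fobj K n) X.
          \<theta> m (compose (pts (fobj K m)) g (farr K m n h)) =
          compose (pts (fobj TK m)) (\<theta> n g) (farr TK m n h)}"
    have H: "?H = cocones \<kappa> \<mu> T X Y"
      unfolding cocones_def by (intro Collect_cong conj_cong PiE_cong arg_cong2[of _ _ _ _ "(\<in>)"]) simp_all
    have sup: "(SUP n\<in>Set_below \<kappa>. SUP g\<in>NE (fobj K n) X. hdist (UMet \<mu>) (fobj TK n) Y (\<theta> n g) (\<theta>' n g)) =
      (SUP n\<in>Set_below \<kappa>. SUP g\<in>NE n X. hdist (UMet \<mu>) (fobj T n) Y (\<theta> n g) (\<theta>' n g))" for \<theta> \<theta>'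
      by (intro SUP_cong) simp_all
    show ?thesis
      unfolding weighted_cocones_def Let_def cocone_space_def A(1,2) UMet_simps H sup ..
  qed
  moreover have "(\<lambda>n\<in>obj A. \<lambda>g\<in>hom (UMet \<mu>) (fobj K n) X.
             cmp (UMet \<mu>) (fobj TK n) (fobj T X) Y f
               (cmp (UMet \<mu>) (fobj TK n) (fobj T (fobj K n)) (fobj T X) (farr T (fobj K n) X g)
                 ((\<lambda>n\<in>obj A. idn (UMet \<mu>) (fobj TK n)) n))) = kan_map \<kappa> T X f"
    if "X \<in> UM" for X Y f
    unfolding kan_map_def A(1)
  proof (rule restrict_ext)
    fix n assume n: "n \<in> Set_below \<kappa>"
    have "compose (pts (fobj T n)) (farr T n X g) (\<lambda>x\<in>pts (fobj T n). x) = farr T n X g"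
      if "g \<in> NE n X" for g
      using enriched_endofunctor_arr[OF T Set_below_obj[OF n] \<open>X \<in> UM\<close> that]
      by (intro compose_units(1)[of _ _ "fobj T X"]) (rule subsetD[OF nonexpanding_ext])
    then show "(\<lambda>g\<in>hom (UMet \<mu>) (fobj K n) X.
             cmp (UMet \<mu>) (fobj TK n) (fobj T X) Y f
               (cmp (UMet \<mu>) (fobj TK n) (fobj T (fobj K n)) (fobj T X) (farr T (fobj K n) X g)
                 ((\<lambda>n\<in>Set_below \<kappa>. idn (UMet \<mu>) (fobj TK n)) n))) =
       (\<lambda>g\<in>NE n X. compose (pts (fobj T n)) f (farr T n X g))"
      using n by auto
  qed
  ultimately show ?thesis
    unfolding strongly_accessible_functor_def is_left_Kan_extension_def Let_def
      A_def[symmetric] K_def[symmetric] TK_def[symmetric]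
    using T by simp
qed (simp add: strongly_accessible_functor_def is_left_Kan_extension_def Let_def)

text \<open>Cocones in terms of the cardinals below \<open>\<kappa>\<close> instead of the discrete spaces on them.\<close>

definition cocone where
  "cocone T X Y \<theta> \<longleftrightarrow>
    (\<forall>n\<in>cardinals_below \<kappa>. \<forall>g\<in>n \<rightarrow>\<^sub>E pts X. \<theta> n g \<in> NE (fobj T (D n)) Y) \<and>
    (\<forall>n\<in>cardinals_below \<kappa>. \<forall>g\<in>n \<rightarrow>\<^sub>E pts X. \<forall>g'\<in>n \<rightarrow>\<^sub>E pts X. \<forall>e. (\<forall>i\<in>n. dst X (g i) (g' i) \<le> e) \<longrightarrow>
      (\<forall>x\<in>pts (fobj T (D n)). dst Y (\<theta> n g x) (\<theta> n g' x) \<le> e)) \<and>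
    (\<forall>m\<in>cardinals_below \<kappa>. \<forall>n\<in>cardinals_below \<kappa>. \<forall>h\<in>m \<rightarrow>\<^sub>E n. \<forall>g\<in>n \<rightarrow>\<^sub>E pts X.
      \<forall>x\<in>pts (fobj T (D m)).
        \<theta> m (compose m g h) x = \<theta> n g (farr T (D m) (D n) h x))"

lemma cocone_NE:
  "cocone T X Y \<theta> \<Longrightarrow> n \<in> cardinals_below \<kappa> \<Longrightarrow> g \<in> n \<rightarrow>\<^sub>E pts X \<Longrightarrow>
    \<theta> n g \<in> NE (fobj T (D n)) Y"
  by (simp add: cocone_def)

lemma cocone_dst:
  "cocone T X Y \<theta> \<Longrightarrow> n \<in> cardinals_below \<kappa> \<Longrightarrow> g \<in> n \<rightarrow>\<^sub>E pts X \<Longrightarrow> g' \<in> n \<rightarrow>\<^sub>E pts X \<Longrightarrow>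
    (\<And>i. i \<in> n \<Longrightarrow> dst X (g i) (g' i) \<le> e) \<Longrightarrow> x \<in> pts (fobj T (D n)) \<Longrightarrow>
    dst Y (\<theta> n g x) (\<theta> n g' x) \<le> e"
  by (simp add: cocone_def)

lemma cocone_natural:
  "cocone T X Y \<theta> \<Longrightarrow> m \<in> cardinals_below \<kappa> \<Longrightarrow> n \<in> cardinals_below \<kappa> \<Longrightarrow> h \<in> m \<rightarrow>\<^sub>E n \<Longrightarrow>
    g \<in> n \<rightarrow>\<^sub>E pts X \<Longrightarrow> x \<in> pts (fobj T (D m)) \<Longrightarrow>
    \<theta> m (compose m g h) x = \<theta> n g (farr T (D m) (D n) h x)"
  by (simp add: cocone_def)

text \<open>Every object of \<open>Set_below\<close> is discrete on a cardinal, and maps out of a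
  discrete space are arbitrary tuples, so hom-spaces turn into powers of \<open>X\<close>.\<close>

lemma cocones_iff:
  assumes T: "enriched_functor (UMet \<mu>) (UMet \<mu>) T" and X: "X \<in> UM"
  shows "\<Theta> \<in> cocones \<kappa> \<mu> T X Y \<longleftrightarrow> \<Theta> \<in> extensional (Set_below \<kappa>) \<and>
    (\<forall>n\<in>Set_below \<kappa>. \<Theta> n \<in> extensional (NE n X)) \<and> cocone T X Y (\<lambda>n. \<Theta> (D n))"
    (is "?l \<longleftrightarrow> ?r")
proof -
  have compose_eq_NE: "f = compose A g h \<longleftrightarrow> (\<forall>x\<in>A. f x = g (h x))" if "f \<in> extensional A" for f g h A
    using that by (auto simp: compose_def fun_eq_iff extensional_def)
  have ext: "\<phi> \<in> extensional (pts Z)" if "\<phi> \<in> NE Z Y" for \<phi> Z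
    using that nonexpanding_ext[of Z Y] by (auto simp: PiE_iff)
  have [simp]: "NE (D n) X = n \<rightarrow>\<^sub>E pts X" for n
    by (simp add: NE_discrete[OF UMet_ultra[OF X]])
  have [simp]: "NE (D m) (D n) = m \<rightarrow>\<^sub>E n" for m n :: "'u set"
    by (simp add: NE_discrete[OF ultrametric_discrete])
  have comp: "compose m g h \<in> m \<rightarrow>\<^sub>E pts X" if "h \<in> m \<rightarrow>\<^sub>E n" "g \<in> n \<rightarrow>\<^sub>E pts X" for m n g h
    using that by (auto simp: compose_def)
  have "(\<forall>m\<in>cardinals_below \<kappa>. \<forall>n\<in>cardinals_below \<kappa>. \<forall>h\<in>m \<rightarrow>\<^sub>E n. \<forall>g\<in>n \<rightarrow>\<^sub>E pts X.
      \<Theta> (D m) (compose m g h) = compose (pts (fobj T (D m)))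
        (\<Theta> (D n) g) (farr T (D m) (D n) h)) \<longleftrightarrow>
    (\<forall>m\<in>cardinals_below \<kappa>. \<forall>n\<in>cardinals_below \<kappa>. \<forall>h\<in>m \<rightarrow>\<^sub>E n. \<forall>g\<in>n \<rightarrow>\<^sub>E pts X.
      \<forall>x\<in>pts (fobj T (D m)). \<Theta> (D m) (compose m g h) x =
         \<Theta> (D n) g (farr T (D m) (D n) h x))"
    if "\<forall>n\<in>cardinals_below \<kappa>. \<forall>g\<in>n \<rightarrow>\<^sub>E pts X. \<Theta> (D n) g \<in> NE (fobj T (D n)) Y"
    using that comp by (intro ball_cong refl compose_eq_NE ext) blast
  then show ?thesis
    unfolding cocones_def cocone_def PiE_iff hom_space_UMet_NE_iff
    by (auto simp: Set_below_def)
qed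

text \<open>The surjectivity half of the Kan isomorphism, in the form in which the operations of an
  algebra \<open>A\<close> are extended to \<open>M A\<close>.\<close>

lemma accessible_extension:
  assumes T: "strongly_accessible_functor \<kappa> \<mu> T" and X: "X \<in> UM" and Y: "Y \<in> UM"
    and \<theta>: "cocone T X Y \<theta>"
  obtains f where "f \<in> NE (fobj T X) Y"
    "\<And>n g x. n \<in> cardinals_below \<kappa> \<Longrightarrow> g \<in> n \<rightarrow>\<^sub>E pts X \<Longrightarrow> x \<in> pts (fobj T (D n)) \<Longrightarrow>
      f (farr T (D n) X g x) = \<theta> n g x"
proof -
  define \<Theta> where "\<Theta> = (\<lambda>N\<in>Set_below \<kappa>. \<lambda>g\<in>NE N X. \<theta> (pts N) g)"
  have TF: "enriched_functor (UMet \<mu>) (UMet \<mu>) T" using T by (simp add: strongly_accessible_iff)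
  have [simp]: "NE (D n) X = n \<rightarrow>\<^sub>E pts X" for n
    by (simp add: NE_discrete[OF UMet_ultra[OF X]])
  have \<Theta>_eq: "\<Theta> (D n) g = \<theta> n g" if "n \<in> cardinals_below \<kappa>" "g \<in> n \<rightarrow>\<^sub>E pts X" for n g
    using that by (simp add: \<Theta>_def Set_below_def)
  have comp: "compose m g h \<in> m \<rightarrow>\<^sub>E pts X" if "h \<in> m \<rightarrow>\<^sub>E n" "g \<in> n \<rightarrow>\<^sub>E pts X" for m n g h
    using that by (auto simp: compose_def)
  have "cocone T X Y (\<lambda>n. \<Theta> (D n))"
    using \<theta> unfolding cocone_def by (simp add: \<Theta>_eq comp)
  then have "\<Theta> \<in> cocones \<kappa> \<mu> T X Y"
    unfolding cocones_iff[OF TF X] by (simp add: \<Theta>_def)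
  moreover have "bij_betw (kan_map \<kappa> T X) (NE (fobj T X) Y) (cocones \<kappa> \<mu> T X Y)"
    using T X Y unfolding strongly_accessible_iff isometric_iso_def
    by (auto simp: hom_space_def cocone_space_def)
  ultimately obtain f where f: "f \<in> NE (fobj T X) Y" "\<Theta> = kan_map \<kappa> T X f"
    unfolding bij_betw_def by blast
  show thesis
  proof (rule that[OF f(1)])
    fix n g x assume *: "n \<in> cardinals_below \<kappa>" "g \<in> n \<rightarrow>\<^sub>E pts X" "x \<in> pts (fobj T (D n))"
    then have "\<theta> n g = compose (pts (fobj T (D n))) f (farr T (D n) X g)"
      using \<Theta>_eq[OF *(1,2)] unfolding f(2) by (simp add: kan_map_def Set_below_def)
    then show "f (farr T (D n) X g x) = \<theta> n g x"
      using * by (simp add: compose_eq)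
  qed
qed

text \<open>The injectivity half of the Kan isomorphism.\<close>

lemma accessible_unique:
  assumes T: "strongly_accessible_functor \<kappa> \<mu> T" and X: "X \<in> UM" and Y: "Y \<in> UM"
    and f: "f \<in> NE (fobj T X) Y" and f': "f' \<in> NE (fobj T X) Y"
    and eq: "\<And>n g x. n \<in> cardinals_below \<kappa> \<Longrightarrow> g \<in> n \<rightarrow>\<^sub>E pts X \<Longrightarrow>
      x \<in> pts (fobj T (D n)) \<Longrightarrow>
      f (farr T (D n) X g x) = f' (farr T (D n) X g x)"
  shows "f = f'"
proof -
  have [simp]: "NE (D n) X = n \<rightarrow>\<^sub>E pts X" for n
    by (simp add: NE_discrete[OF UMet_ultra[OF X]])
  have "kan_map \<kappa> T X f = kan_map \<kappa> T X f'"
    unfolding kan_map_def by (intro restrict_ext) (auto simp: compose_eq_iff Set_below_def eq)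
  moreover have "inj_on (kan_map \<kappa> T X) (NE (fobj T X) Y)"
    using T X Y unfolding strongly_accessible_iff isometric_iso_def bij_betw_def
    by (auto simp: hom_space_def)
  ultimately show ?thesis using f f' by (auto dest: inj_onD)
qed

text \<open>The image of all \<open>T g\<close> already has the universal property of \<open>T X\<close>.\<close>

lemma accessible_cover:
  assumes T: "strongly_accessible_functor \<kappa> \<mu> T" and X: "X \<in> UM" and y: "y \<in> pts (fobj T X)"
  obtains n g x where "n \<in> cardinals_below \<kappa>" "g \<in> n \<rightarrow>\<^sub>E pts X" "x \<in> pts (fobj T (D n))"
    "y = farr T (D n) X g x"
proof -
  have TF: "enriched_functor (UMet \<mu>) (UMet \<mu>) T" using T by (simp add: strongly_accessible_iff)
  have d [simp]: "NE (D n) X = n \<rightarrow>\<^sub>E pts X" for n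
    by (simp add: NE_discrete[OF UMet_ultra[OF X]])
  have d' [simp]: "NE (D m) (D n) = m \<rightarrow>\<^sub>E n" for m n :: "'u set"
    by (simp add: NE_discrete[OF ultrametric_discrete])
  define S where "S = {y. \<exists>n\<in>cardinals_below \<kappa>. \<exists>g\<in>n \<rightarrow>\<^sub>E pts X. \<exists>x\<in>pts (fobj T (D n)).
    y = farr T (D n) X g x}"
  have arr: "farr T (D n) X g \<in> NE (fobj T (D n)) (fobj T X)"
    if "n \<in> cardinals_below \<kappa>" "g \<in> n \<rightarrow>\<^sub>E pts X" for n g
    using enriched_endofunctor_arr[OF TF discrete_obj[OF that(1)] X] that by simp
  have S: "S \<subseteq> pts (fobj T X)"
    unfolding S_def using NE_app[OF arr] by auto
  \<comment> \<open>The covered points as a subspace; distances off \<open>S\<close> are reset to 0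
    as the normalisation of spaces demands.\<close>
  define Y where "Y = \<lparr>pts = S, dst = (\<lambda>x y. if x \<in> S \<and> y \<in> S then dst (fobj T X) x y else 0)\<rparr>"
  have "ultrametric_space (fobj T X)" "small (pts (fobj T X))"
    using enriched_endofunctor_obj[OF TF X] by (auto simp: obj_UMet)
  then have Y: "Y \<in> UM"
    using S small_subset[OF S] unfolding obj_UMet ultrametric_space_def Y_def
    by (simp add: subset_iff)
  define \<theta> where "\<theta> n g = farr T (D n) X g" for n g
  have "cocone T X Y \<theta>"
    unfolding cocone_def
  proof (intro conjI ballI allI impI)
    fix n g assume *: "n \<in> cardinals_below \<kappa>" "g \<in> n \<rightarrow>\<^sub>E pts X"
    then have "\<theta> n g x \<in> S" if "x \<in> pts (fobj T (D n))" for x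
      using that unfolding \<theta>_def S_def by blast
    then show "\<theta> n g \<in> NE (fobj T (D n)) Y"
      using arr[OF *] unfolding \<theta>_def nonexpanding_maps_def by (auto simp: Y_def PiE_iff)
  next
    fix n g g' e x assume *: "n \<in> cardinals_below \<kappa>" "g \<in> n \<rightarrow>\<^sub>E pts X" "g' \<in> n \<rightarrow>\<^sub>E pts X"
      "\<forall>i\<in>n. dst X (g i) (g' i) \<le> e" "x \<in> pts (fobj T (D n))"
    then have "dst (fobj T X) (\<theta> n g x) (\<theta> n g' x) \<le> e"
      using enriched_endofunctor_dst[OF TF discrete_obj[OF *(1)] X, of g g'] unfolding \<theta>_def by simp
    then show "dst Y (\<theta> n g x) (\<theta> n g' x) \<le> e"
      by (simp add: Y_def)
  next
    fix m n h g x assume *: "m \<in> cardinals_below \<kappa>" "n \<in> cardinals_below \<kappa>" "h \<in> m \<rightarrow>\<^sub>E n"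
      "g \<in> n \<rightarrow>\<^sub>E pts X" "x \<in> pts (fobj T (D m))"
    then show "\<theta> m (compose m g h) x = \<theta> n g (farr T (D m) (D n) h x)"
      using enriched_endofunctor_cmp[OF TF discrete_obj[OF *(1)] discrete_obj[OF *(2)] X]
      unfolding \<theta>_def by simp
  qed
  then obtain f where f: "f \<in> NE (fobj T X) Y" "\<And>n g x. n \<in> cardinals_below \<kappa> \<Longrightarrow> g \<in> n \<rightarrow>\<^sub>E pts X \<Longrightarrow>
     x \<in> pts (fobj T (D n)) \<Longrightarrow> f (farr T (D n) X g x) = \<theta> n g x"
    using accessible_extension[OF T X Y] by blast
  \<comment> \<open>Followed by the inclusion of \<open>S\<close>, the extension agrees with the
    identity on every \<open>T g\<close>. By uniqueness it is the identity, so every point lies in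
    \<open>S\<close>.\<close>
  have "f \<in> NE (fobj T X) (fobj T X)"
    using f(1) S unfolding nonexpanding_maps_def Y_def by (auto simp: PiE_iff split: if_splits)
  then have "f = (\<lambda>x\<in>pts (fobj T X). x)"
  proof (rule accessible_unique[OF T X enriched_endofunctor_obj[OF TF X]])
    fix n g x assume *: "n \<in> cardinals_below \<kappa>" "g \<in> n \<rightarrow>\<^sub>E pts X" "x \<in> pts (fobj T (D n))"
    then show "f (farr T (D n) X g x) =
        (\<lambda>x\<in>pts (fobj T X). x) (farr T (D n) X g x)"
      using NE_app[OF arr[OF *(1,2)] *(3)] by (simp add: f(2) \<theta>_def)
  qed (rule id_nonexpanding)
  then have "y \<in> S" using NE_app[OF f(1) y] y by (simp add: Y_def)
  then show thesis using that unfolding S_def by blast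
qed

text \<open>If the maps \<open>T g\<close> cover \<open>T X\<close>, a map out of \<open>T X\<close>
  and its distances are read off a cover. The inequality makes every cocone descend: at distance 0
  it gives well-definedness, in general nonexpansion.\<close>

lemma strongly_accessibleI:
  assumes T: "enriched_functor (UMet \<mu>) (UMet \<mu>) T"
    and cover: "\<And>X y. X \<in> UM \<Longrightarrow> y \<in> pts (fobj T X) \<Longrightarrow> \<exists>n\<in>cardinals_below \<kappa>. \<exists>g\<in>n \<rightarrow>\<^sub>E pts X.
      \<exists>x\<in>pts (fobj T (D n)). y = farr T (D n) X g x"
    and ineq: "\<And>X Y \<theta> n g x m h y. X \<in> UM \<Longrightarrow> Y \<in> UM \<Longrightarrow> cocone T X Y \<theta> \<Longrightarrow>
      n \<in> cardinals_below \<kappa> \<Longrightarrow> g \<in> n \<rightarrow>\<^sub>E pts X \<Longrightarrow> x \<in> pts (fobj T (D n)) \<Longrightarrow>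
      m \<in> cardinals_below \<kappa> \<Longrightarrow> h \<in> m \<rightarrow>\<^sub>E pts X \<Longrightarrow> y \<in> pts (fobj T (D m)) \<Longrightarrow>
      dst Y (\<theta> n g x) (\<theta> m h y) \<le>
        dst (fobj T X) (farr T (D n) X g x) (farr T (D m) X h y)"
  shows "strongly_accessible_functor \<kappa> \<mu> T"
  unfolding strongly_accessible_iff
proof (intro conjI ballI T)
  fix X Y assume X: "X \<in> UM" and Y: "Y \<in> UM"
  note TX = enriched_endofunctor_obj[OF T X]
  have d [simp]: "NE (D n) X = n \<rightarrow>\<^sub>E pts X" for n
    by (simp add: NE_discrete[OF UMet_ultra[OF X]])
  have d' [simp]: "NE (D m) (D n) = m \<rightarrow>\<^sub>E n" for m n :: "'u set"
    by (simp add: NE_discrete[OF ultrametric_discrete])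
  have arr: "farr T (D n) X g \<in> NE (fobj T (D n)) (fobj T X)"
    if "n \<in> cardinals_below \<kappa>" "g \<in> n \<rightarrow>\<^sub>E pts X" for n g
    using enriched_endofunctor_arr[OF T discrete_obj[OF that(1)] X] that by simp
  have kan: "kan_map \<kappa> T X f (D n) g =
      compose (pts (fobj T (D n))) f (farr T (D n) X g)"
    if "n \<in> cardinals_below \<kappa>" "g \<in> n \<rightarrow>\<^sub>E pts X" for f n g
    using that by (simp add: kan_map_def Set_below_def)
  have comp: "compose m g h \<in> m \<rightarrow>\<^sub>E pts X" if "h \<in> m \<rightarrow>\<^sub>E n" "g \<in> n \<rightarrow>\<^sub>E pts X" for m n g h
    using that by (auto simp: compose_def)
  have kan_in: "kan_map \<kappa> T X f \<in> cocones \<kappa> \<mu> T X Y" if f: "f \<in> NE (fobj T X) Y" for f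
  proof -
    have "cocone T X Y (\<lambda>n. kan_map \<kappa> T X f (D n))"
      unfolding cocone_def
    proof (intro conjI ballI allI impI)
      fix n g g' e x assume *: "n \<in> cardinals_below \<kappa>" "g \<in> n \<rightarrow>\<^sub>E pts X" "g' \<in> n \<rightarrow>\<^sub>E pts X"
        "\<forall>i\<in>n. dst X (g i) (g' i) \<le> e" "x \<in> pts (fobj T (D n))"
      have "dst Y (f (farr T (D n) X g x)) (f (farr T (D n) X g' x)) \<le>
         dst (fobj T X) (farr T (D n) X g x) (farr T (D n) X g' x)"
        using * by (intro NE_le[OF f] NE_app[OF arr])
      also have "\<dots> \<le> e"
        using enriched_endofunctor_dst[OF T discrete_obj[OF *(1)] X, of g g'] * by simp
      finally show "dst Y (kan_map \<kappa> T X f (D n) g x) (kan_map \<kappa> T X f (D n) g' x) \<le> e"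
        using * by (simp add: kan compose_eq)
    next
      fix m n h g x assume *: "m \<in> cardinals_below \<kappa>" "n \<in> cardinals_below \<kappa>" "h \<in> m \<rightarrow>\<^sub>E n"
        "g \<in> n \<rightarrow>\<^sub>E pts X" "x \<in> pts (fobj T (D m))"
      have "farr T (D m) (D n) h x \<in> pts (fobj T (D n))"
        using * by (intro NE_app[OF enriched_endofunctor_arr[OF T discrete_obj discrete_obj]]) simp_all
      moreover have "farr T (D m) X (compose m g h) x =
          farr T (D n) X g (farr T (D m) (D n) h x)"
        using enriched_endofunctor_cmp[OF T discrete_obj[OF *(1)] discrete_obj[OF *(2)] X] * by simp
      ultimately show "kan_map \<kappa> T X f (D m) (compose m g h) x =
          kan_map \<kappa> T X f (D n) g (farr T (D m) (D n) h x)"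
        using * by (simp add: kan comp compose_eq)
    qed (simp add: kan compose_nonexpanding[OF arr f])
    then show ?thesis
      unfolding cocones_iff[OF T X] by (simp add: kan_map_def)
  qed
  have cov: "\<exists>n\<in>cardinals_below \<kappa>. \<exists>g\<in>n \<rightarrow>\<^sub>E pts X. \<exists>x\<in>pts (fobj T (D n)).
      z = farr T (D n) X g x" if "z \<in> pts (fobj T X)" for z
    using cover[OF X that] .
  have dist: "dst (cocone_space \<kappa> \<mu> T X Y) (kan_map \<kappa> T X f) (kan_map \<kappa> T X f') = hdist (UMet \<mu>) (fobj T X) Y f f'"
    if f: "f \<in> NE (fobj T X) Y" "f' \<in> NE (fobj T X) Y" for f f'
  proof -
    \<comment> \<open>The two distances are compared through their upper bounds; by the cover, a
      bound over all \<open>T g\<close> is a bound over all points of \<open>T X\<close>.\<close>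
    have "(SUP n\<in>Set_below \<kappa>. SUP g\<in>NE n X. hdist (UMet \<mu>) (fobj T n) Y (kan_map \<kappa> T X f n g) (kan_map \<kappa> T X f' n g)) \<le> e
        \<longleftrightarrow> hdist (UMet \<mu>) (fobj T X) Y f f' \<le> e" for e
    proof -
      have "hdist (UMet \<mu>) (fobj T (D n)) Y
          (kan_map \<kappa> T X f (D n) g) (kan_map \<kappa> T X f' (D n) g) \<le> e \<longleftrightarrow>
          (\<forall>x\<in>pts (fobj T (D n)). dst Y (f (farr T (D n) X g x))
            (f' (farr T (D n) X g x)) \<le> e)"
        if "n \<in> cardinals_below \<kappa>" "g \<in> n \<rightarrow>\<^sub>E pts X" for n g
        using compose_nonexpanding[OF arr[OF that] f(1)] compose_nonexpanding[OF arr[OF that] f(2)] that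
        by (simp add: kan hdist_UMet_le_iff compose_eq)
      then have "(SUP n\<in>Set_below \<kappa>. SUP g\<in>NE n X. hdist (UMet \<mu>) (fobj T n) Y (kan_map \<kappa> T X f n g) (kan_map \<kappa> T X f' n g)) \<le> e
        \<longleftrightarrow> (\<forall>n\<in>cardinals_below \<kappa>. \<forall>g\<in>n \<rightarrow>\<^sub>E pts X. \<forall>x\<in>pts (fobj T (D n)).
          dst Y (f (farr T (D n) X g x)) (f' (farr T (D n) X g x)) \<le> e)"
        by (simp add: SUP_le_iff Set_below_def)
      also have "\<dots> \<longleftrightarrow> (\<forall>z\<in>pts (fobj T X). dst Y (f z) (f' z) \<le> e)"
      proof
        assume a: "\<forall>n\<in>cardinals_below \<kappa>. \<forall>g\<in>n \<rightarrow>\<^sub>E pts X. \<forall>x\<in>pts (fobj T (D n)).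
          dst Y (f (farr T (D n) X g x)) (f' (farr T (D n) X g x)) \<le> e"
        show "\<forall>z\<in>pts (fobj T X). dst Y (f z) (f' z) \<le> e"
        proof
          fix z assume "z \<in> pts (fobj T X)"
          from cov[OF this] show "dst Y (f z) (f' z) \<le> e" using a by blast
        qed
      qed (auto simp: NE_app[OF arr])
      also have "\<dots> \<longleftrightarrow> hdist (UMet \<mu>) (fobj T X) Y f f' \<le> e"
        using f by (simp add: hdist_UMet_le_iff)
      finally show ?thesis .
    qed
    then show ?thesis
      using kan_in[OF f(1)] kan_in[OF f(2)] by (simp add: cocone_space_def) (meson order_antisym order_refl)
  qed
  have ext: "\<Theta> = kan_map \<kappa> T X f" if \<Theta>: "\<Theta> \<in> cocones \<kappa> \<mu> T X Y" and
    eq: "\<And>n g x. n \<in> cardinals_below \<kappa> \<Longrightarrow> g \<in> n \<rightarrow>\<^sub>E pts X \<Longrightarrow> x \<in> pts (fobj T (D n)) \<Longrightarrow>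
      \<Theta> (D n) g x = f (farr T (D n) X g x)" for \<Theta> f
  proof -
    have c: "\<Theta> \<in> extensional (Set_below \<kappa>)" "\<forall>n\<in>Set_below \<kappa>. \<Theta> n \<in> extensional (NE n X)"
      "cocone T X Y (\<lambda>n. \<Theta> (D n))"
      using \<Theta> unfolding cocones_iff[OF T X] by auto
    have eq': "\<Theta> (D n) g = kan_map \<kappa> T X f (D n) g"
      if "n \<in> cardinals_below \<kappa>" "g \<in> n \<rightarrow>\<^sub>E pts X" for n g
    proof -
      have "\<Theta> (D n) g \<in> NE (fobj T (D n)) Y"
        using cocone_NE[OF c(3) that] .
      then show ?thesis
        using compose_eq_NE_iff[of "\<Theta> (D n) g"] eq[OF that] by (metis kan[OF that])
    qed
    show ?thesis
    proof (rule extensionalityI[OF c(1)])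
      fix N assume N: "N \<in> Set_below \<kappa>"
      then obtain n where n: "n \<in> cardinals_below \<kappa>" "N = D n" by (auto simp: Set_below_def)
      show "\<Theta> N = kan_map \<kappa> T X f N"
        by (rule extensionalityI[of _ "NE N X"]) (use N n c(2) eq' in \<open>auto simp: kan_map_def\<close>)
    qed (simp add: kan_map_def)
  qed
  have "bij_betw (kan_map \<kappa> T X) (NE (fobj T X) Y) (cocones \<kappa> \<mu> T X Y)"
    unfolding bij_betw_def
  proof (intro conjI subset_antisym subsetI)
    show "inj_on (kan_map \<kappa> T X) (NE (fobj T X) Y)"
    proof (rule inj_onI)
      fix f f' assume f: "f \<in> NE (fobj T X) Y" "f' \<in> NE (fobj T X) Y" and "kan_map \<kappa> T X f = kan_map \<kappa> T X f'"
      then have "compose (pts (fobj T (D n))) f (farr T (D n) X g) =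
          compose (pts (fobj T (D n))) f' (farr T (D n) X g)"
        if "n \<in> cardinals_below \<kappa>" "g \<in> n \<rightarrow>\<^sub>E pts X" for n g
        using kan[OF that] by metis
      then have "f z = f' z" if "z \<in> pts (fobj T X)" for z
        using cov[OF that] by (metis compose_eq)
      then show "f = f'" using NE_eqI[OF f] by blast
    qed
  next
    fix \<Theta> assume \<Theta>: "\<Theta> \<in> cocones \<kappa> \<mu> T X Y"
    then have c: "cocone T X Y (\<lambda>n. \<Theta> (D n))"
      unfolding cocones_iff[OF T X] by auto
    have c_in: "\<Theta> (D n) g x \<in> pts Y"
      if "n \<in> cardinals_below \<kappa>" "g \<in> n \<rightarrow>\<^sub>E pts X" "x \<in> pts (fobj T (D n))" for n g x
      using NE_app[OF cocone_NE[OF c that(1,2)] that(3)] .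
    \<comment> \<open>The value at \<open>z\<close> may be read off any presentation of
      \<open>z\<close>, since by \<open>ineq\<close> the values of two presentations are at distance
      0.\<close>
    have "\<exists>w. w \<in> pts Y \<and> (\<forall>n\<in>cardinals_below \<kappa>. \<forall>g\<in>n \<rightarrow>\<^sub>E pts X. \<forall>x\<in>pts (fobj T (D n)).
        z = farr T (D n) X g x \<longrightarrow> w = \<Theta> (D n) g x)" if z: "z \<in> pts (fobj T X)" for z
    proof -
      obtain n g x where n: "n \<in> cardinals_below \<kappa>" "g \<in> n \<rightarrow>\<^sub>E pts X" "x \<in> pts (fobj T (D n))"
        and z': "z = farr T (D n) X g x" using cov[OF z] by blast
      have "\<Theta> (D n) g x = \<Theta> (D m) h y"
        if m: "m \<in> cardinals_below \<kappa>" "h \<in> m \<rightarrow>\<^sub>E pts X" "y \<in> pts (fobj T (D m))"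
          "z = farr T (D m) X h y" for m h y
      proof -
        have "dst Y (\<Theta> (D n) g x) (\<Theta> (D m) h y) \<le> dst (fobj T X) z z"
          using ineq[OF X Y c n m(1-3)] z' m(4) by simp
        then show ?thesis
          using ultrametric_refl[OF UMet_ultra[OF TX]] ultrametric_zero[OF UMet_ultra[OF Y] c_in[OF n] c_in[OF m(1-3)]]
          by simp
      qed
      then show ?thesis using c_in[OF n] by blast
    qed
    then obtain w where w: "\<And>z. z \<in> pts (fobj T X) \<Longrightarrow> w z \<in> pts Y"
      "\<And>n g x. n \<in> cardinals_below \<kappa> \<Longrightarrow> g \<in> n \<rightarrow>\<^sub>E pts X \<Longrightarrow> x \<in> pts (fobj T (D n)) \<Longrightarrow>
        w (farr T (D n) X g x) = \<Theta> (D n) g x"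
      using NE_app[OF arr] by metis
    have "restrict w (pts (fobj T X)) \<in> NE (fobj T X) Y"
    proof (rule restrict_NE[OF w(1)])
      fix z z' assume z: "z \<in> pts (fobj T X)" "z' \<in> pts (fobj T X)"
      obtain n g x where n: "n \<in> cardinals_below \<kappa>" "g \<in> n \<rightarrow>\<^sub>E pts X" "x \<in> pts (fobj T (D n))"
        and n': "z = farr T (D n) X g x" using cov[OF z(1)] by blast
      obtain m h y where m: "m \<in> cardinals_below \<kappa>" "h \<in> m \<rightarrow>\<^sub>E pts X" "y \<in> pts (fobj T (D m))"
        and m': "z' = farr T (D m) X h y" using cov[OF z(2)] by blast
      show "dst Y (w z) (w z') \<le> dst (fobj T X) z z'"
        using ineq[OF X Y c n m] unfolding n' m' w(2)[OF n] w(2)[OF m] .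
    qed
    moreover have "\<Theta> = kan_map \<kappa> T X (restrict w (pts (fobj T X)))"
      using NE_app[OF arr] by (intro ext[OF \<Theta>]) (simp add: w(2))
    ultimately show "\<Theta> \<in> kan_map \<kappa> T X ` NE (fobj T X) Y" by blast
  qed (use kan_in in auto)
  then show "isometric_iso (hom_space (UMet \<mu>) (fobj T X) Y) (cocone_space \<kappa> \<mu> T X Y) (kan_map \<kappa> T X)"
    unfolding isometric_iso_def using dist by (simp add: hom_space_def cocone_space_def)
qed

end

section \<open>The variety of a monad\<close>

text \<open>Quantitative equations carry rational bounds, while distances are arbitrary. This
  recovers a comparison of distances from its rational instances.\<close>

lemma ennreal_le_rat_bounds:
  assumes "\<And>\<epsilon> :: rat. 0 \<le> \<epsilon> \<Longrightarrow> d \<le> ennreal (of_rat \<epsilon>) \<Longrightarrow> D \<le> ennreal (of_rat \<epsilon>)"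
  shows "D \<le> (d :: ennreal)"
proof (rule ccontr)
  assume "\<not> D \<le> d"
  \<comment> \<open>The intermediate \<open>z\<close> is finite even when \<open>D\<close> is
    infinite, so a rational fits between \<open>d\<close> and \<open>z\<close>.\<close>
  then obtain z where z: "d < z" "z < D" using dense by (metis not_le)
  then obtain r where r: "0 \<le> r" "z = ennreal r" by (cases z) auto
  obtain s where s: "0 \<le> s" "d = ennreal s" using z by (cases d) auto
  have "s < r" using z r s by (simp add: ennreal_less_iff)
  then obtain q where q: "s < of_rat q" "of_rat q < r" using of_rat_dense by blast
  then have "0 \<le> q" using s by (metis order_less_imp_le order_trans zero_le_of_rat_iff)
  then have "D \<le> ennreal (of_rat q)"
    using s q by (intro assms) (auto simp: ennreal_leI)
  also have "\<dots> < z" using q s unfolding r(2) by (intro ennreal_lessI) auto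
  finally show False using z by simp
qed

lemma power_space_NE_iff:
  "\<phi> \<in> NE (power_space X n) Y \<longleftrightarrow> \<phi> \<in> (n \<rightarrow>\<^sub>E pts X) \<rightarrow>\<^sub>E pts Y \<and>
    (\<forall>g\<in>n \<rightarrow>\<^sub>E pts X. \<forall>g'\<in>n \<rightarrow>\<^sub>E pts X. \<forall>e. (\<forall>i\<in>n. dst X (g i) (g' i) \<le> e) \<longrightarrow> dst Y (\<phi> g) (\<phi> g') \<le> e)"
  unfolding nonexpanding_maps_def power_space_def sup_space_def
  by (subst le_iff_all_upper) (simp add: SUP_le_iff)

lemma eval_cong:
  assumes "t \<in> terms \<Sigma> V" "\<And>x. x \<in> V \<Longrightarrow> f x = g x"
  shows "eval \<Sigma> A f t = eval \<Sigma> A g t"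
  using assms by (induction) (auto cong: restrict_cong)

context arity_universe
begin

lemma NE_D [simp]: "X \<in> UM \<Longrightarrow> NE (D n) X = n \<rightarrow>\<^sub>E pts X"
  by (simp add: NE_discrete UMet_ultra)

lemma NE_D_D: "NE (D m) (D n) = m \<rightarrow>\<^sub>E n"
  by (simp add: NE_discrete ultrametric_discrete)

definition op_index :: "('u space, 'u \<Rightarrow> 'u) monad \<Rightarrow> ('u set \<times> 'u) set" where
  "op_index M = (SIGMA n:cardinals_below \<kappa>. pts (TO M (D n)))"

text \<open>Symbols of a signature are elements of \<open>'u\<close>, whereas operations are
  naturally indexed by pairs of an arity \<open>n\<close> and an element of \<open>M n\<close>. Any
  injection of the pairs into \<open>'u\<close> serves.\<close>

definition encode_op :: "('u space, 'u \<Rightarrow> 'u) monad \<Rightarrow> 'u set \<times> 'u \<Rightarrow> 'u" where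
  "encode_op M = (SOME e. inj_on e (op_index M))"

definition decode_op :: "('u space, 'u \<Rightarrow> 'u) monad \<Rightarrow> 'u \<Rightarrow> 'u set \<times> 'u" where
  "decode_op M = inv_into (op_index M) (encode_op M)"

definition monad_signature :: "('u space, 'u \<Rightarrow> 'u) monad \<Rightarrow> 'u signature" where
  "monad_signature M = \<lparr>syms = encode_op M ` op_index M, arity = (\<lambda>\<sigma>\<in>encode_op M ` op_index M. fst (decode_op M \<sigma>))\<rparr>"

abbreviation "monad_op M A n x \<equiv> opn A (encode_op M (n, x))"

definition alg_of :: "('u space, 'u \<Rightarrow> 'u) monad \<Rightarrow> 'u space \<Rightarrow> ('u set \<Rightarrow> 'u \<Rightarrow> ('u \<Rightarrow> 'u) \<Rightarrow> 'u) \<Rightarrow> 'u algebra" where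
  "alg_of M X op = \<lparr>und = X, opn = (\<lambda>\<sigma>\<in>encode_op M ` op_index M. \<lambda>g\<in>fst (decode_op M \<sigma>) \<rightarrow>\<^sub>E pts X.
    op (fst (decode_op M \<sigma>)) (snd (decode_op M \<sigma>)) g)\<rparr>"

text \<open>The multiplication after \<open>TA M (D n) (TO M (D m)) y\<close> is the Kleisli
  extension of \<open>y\<close>, so the second clause is substitution in the abstract clone of
  \<open>M\<close>. The first is the law for projections, the third the enrichment in the
  operation.\<close>

definition monad_model :: "('u space, 'u \<Rightarrow> 'u) monad \<Rightarrow> 'u algebra \<Rightarrow> bool" where
  "monad_model M A \<longleftrightarrow> A \<in> algebras \<mu> (monad_signature M) \<and>
    (\<forall>n\<in>cardinals_below \<kappa>. \<forall>i\<in>n. \<forall>g\<in>n \<rightarrow>\<^sub>E pts (und A). monad_op M A n (munit M (D n) i) g = g i) \<and>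
    (\<forall>n\<in>cardinals_below \<kappa>. \<forall>m\<in>cardinals_below \<kappa>. \<forall>x\<in>pts (TO M (D n)). \<forall>y\<in>n \<rightarrow>\<^sub>E pts (TO M (D m)).
      \<forall>g\<in>m \<rightarrow>\<^sub>E pts (und A). monad_op M A n x (\<lambda>i\<in>n. monad_op M A m (y i) g) =
        monad_op M A m (mmult M (D m) (TA M (D n) (TO M (D m)) y x)) g) \<and>
    (\<forall>n\<in>cardinals_below \<kappa>. \<forall>x\<in>pts (TO M (D n)). \<forall>x'\<in>pts (TO M (D n)). \<forall>g\<in>n \<rightarrow>\<^sub>E pts (und A).
      dst (und A) (monad_op M A n x g) (monad_op M A n x' g) \<le> dst (TO M (D n)) x x')"

definition monad_variety :: "('u space, 'u \<Rightarrow> 'u) monad \<Rightarrow> 'u variety" where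
  "monad_variety M = (monad_signature M, {A. monad_model M A})"

text \<open>Cardinals below \<kappa> are initial segments of \<kappa>, so the elements of an arity
  are themselves variables.\<close>

definition op_term :: "('u space, 'u \<Rightarrow> 'u) monad \<Rightarrow> 'u set \<Rightarrow> 'u \<Rightarrow> 'u trm" where
  "op_term M n x = App (encode_op M (n, x)) (\<lambda>i\<in>n. Var i)"

end

section \<open>Signature, models and equations of a fixed monad\<close>

locale ultrametric_monad = arity_universe \<kappa> \<mu> for \<kappa> \<mu> :: "'u rel" +
  fixes M :: "('u space, 'u \<Rightarrow> 'u) monad"
  assumes monad: "enriched_monad (UMet \<mu>) M"
begin

lemmas TO_obj = monad_obj[OF monad]
lemmas TA_NE = monad_arr[OF monad]
lemmas unit_NE = monad_unit[OF monad]
lemmas mult_NE = monad_mult[OF monad]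
lemmas TA_id = monad_id[OF monad]
lemmas TA_cmp = monad_cmp[OF monad]
lemmas TA_dst = monad_dst[OF monad]
lemmas unit_nat = monad_unit_nat[OF monad]
lemmas mult_nat = monad_mult_nat[OF monad]
lemmas unit_left = monad_unit_left[OF monad]
lemmas unit_right = monad_unit_right[OF monad]
lemmas mult_assoc = monad_assoc[OF monad]

lemma small_op_index: "small (op_index M)"
  unfolding op_index_def
proof (rule small_Sigma[OF small_cardinals_below])
  fix n assume "n \<in> cardinals_below \<kappa>"
  then show "small (pts (TO M (D n)))" using TO_obj[OF discrete_obj] by (simp add: obj_UMet)
qed

lemma inj_encode: "inj_on (encode_op M) (op_index M)"
proof -
  obtain B :: "'u set" and e where "bij_betw e (op_index M) B"
    using small_encoding[OF small_op_index] by blast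
  then show ?thesis
    unfolding encode_op_def by (intro someI_ex[of "\<lambda>e. inj_on e (op_index M)"]) (auto simp: bij_betw_def)
qed

lemma decode_encode: "p \<in> op_index M \<Longrightarrow> decode_op M (encode_op M p) = p"
  using inj_encode by (simp add: decode_op_def)

lemma syms_monad_signature: "\<sigma> \<in> syms (monad_signature M) \<longleftrightarrow>
    (\<exists>n\<in>cardinals_below \<kappa>. \<exists>x\<in>pts (TO M (D n)). \<sigma> = encode_op M (n, x))"
  by (auto simp: monad_signature_def op_index_def)

lemma ball_syms: "(\<forall>\<sigma>\<in>syms (monad_signature M). P \<sigma>) \<longleftrightarrow>
    (\<forall>n\<in>cardinals_below \<kappa>. \<forall>x\<in>pts (TO M (D n)). P (encode_op M (n, x)))"
  unfolding Ball_def syms_monad_signature by blast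

lemma encode_in_syms: "n \<in> cardinals_below \<kappa> \<Longrightarrow> x \<in> pts (TO M (D n)) \<Longrightarrow> encode_op M (n, x) \<in> syms (monad_signature M)"
  by (auto simp: syms_monad_signature)

lemma arity_encode [simp]:
  "n \<in> cardinals_below \<kappa> \<Longrightarrow> x \<in> pts (TO M (D n)) \<Longrightarrow> arity (monad_signature M) (encode_op M (n, x)) = n"
  by (simp add: monad_signature_def op_index_def decode_encode)

lemma is_signature_monad: "is_signature \<kappa> \<mu> (monad_signature M)"
  unfolding is_signature_def
  using small_image[OF small_op_index]
  by (auto simp: monad_signature_def decode_encode) (auto simp: op_index_def)

lemma op_alg_of [simp]:
  "n \<in> cardinals_below \<kappa> \<Longrightarrow> x \<in> pts (TO M (D n)) \<Longrightarrow> g \<in> n \<rightarrow>\<^sub>E pts X \<Longrightarrow> monad_op M (alg_of M X op) n x g = op n x g"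
  by (simp add: alg_of_def decode_encode op_index_def)

lemma und_alg_of [simp]: "und (alg_of M X op) = X"
  by (simp add: alg_of_def)

lemma algebras_monad_iff:
  "A \<in> algebras \<mu> (monad_signature M) \<longleftrightarrow> und A \<in> UM \<and> opn A \<in> extensional (syms (monad_signature M)) \<and>
    (\<forall>n\<in>cardinals_below \<kappa>. \<forall>x\<in>pts (TO M (D n)). monad_op M A n x \<in> (n \<rightarrow>\<^sub>E pts (und A)) \<rightarrow>\<^sub>E pts (und A) \<and>
      (\<forall>g\<in>n \<rightarrow>\<^sub>E pts (und A). \<forall>g'\<in>n \<rightarrow>\<^sub>E pts (und A). \<forall>e.
        (\<forall>i\<in>n. dst (und A) (g i) (g' i) \<le> e) \<longrightarrow> dst (und A) (monad_op M A n x g) (monad_op M A n x g') \<le> e))"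
  unfolding algebras_def power_space_NE_iff PiE_iff[of _ "syms _"] mem_Collect_eq ball_syms
  by (simp add: conj_ac)

lemma alg_of_algebra:
  assumes "X \<in> UM"
    and "\<And>n x g. n \<in> cardinals_below \<kappa> \<Longrightarrow> x \<in> pts (TO M (D n)) \<Longrightarrow> g \<in> n \<rightarrow>\<^sub>E pts X \<Longrightarrow> op n x g \<in> pts X"
    and "\<And>n x g g' e. n \<in> cardinals_below \<kappa> \<Longrightarrow> x \<in> pts (TO M (D n)) \<Longrightarrow> g \<in> n \<rightarrow>\<^sub>E pts X \<Longrightarrow>
      g' \<in> n \<rightarrow>\<^sub>E pts X \<Longrightarrow> (\<And>i. i \<in> n \<Longrightarrow> dst X (g i) (g' i) \<le> e) \<Longrightarrow> dst X (op n x g) (op n x g') \<le> e"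
  shows "alg_of M X op \<in> algebras \<mu> (monad_signature M)"
proof -
  have "opn (alg_of M X op) \<in> extensional (syms (monad_signature M))"
    by (simp add: alg_of_def monad_signature_def)
  moreover have "monad_op M (alg_of M X op) n x \<in> extensional (n \<rightarrow>\<^sub>E pts X)"
    if "n \<in> cardinals_below \<kappa>" "x \<in> pts (TO M (D n))" for n x
    using that by (simp add: alg_of_def decode_encode op_index_def)
  ultimately show ?thesis
    unfolding algebras_monad_iff using assms by (simp add: PiE_iff[of _ "PiE _ _"])
qed

lemma algebras_monad_eqI:
  assumes A: "A \<in> algebras \<mu> (monad_signature M)" and B: "B \<in> algebras \<mu> (monad_signature M)" and und: "und A = und B"
    and monad_op: "\<And>n x g. n \<in> cardinals_below \<kappa> \<Longrightarrow> x \<in> pts (TO M (D n)) \<Longrightarrow> g \<in> n \<rightarrow>\<^sub>E pts (und A) \<Longrightarrow>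
      monad_op M A n x g = monad_op M B n x g"
  shows "A = B"
proof -
  have "opn A = opn B"
  proof (rule extensionalityI)
    fix \<sigma> assume "\<sigma> \<in> syms (monad_signature M)"
    then obtain n x where n: "n \<in> cardinals_below \<kappa>" "x \<in> pts (TO M (D n))" and \<sigma>: "\<sigma> = encode_op M (n, x)"
      by (auto simp: syms_monad_signature)
    show "opn A \<sigma> = opn B \<sigma>"
      unfolding \<sigma> using A B und monad_op[OF n] n
      by (intro extensionalityI[of _ "n \<rightarrow>\<^sub>E pts (und A)"]) (auto simp: algebras_monad_iff PiE_iff[of _ "PiE _ _"])
  qed (use A B in \<open>auto simp: algebras_monad_iff\<close>)
  then show ?thesis using und by (intro algebra.equality) auto
qed

lemma homomorphisms_monad_iff:
  "h \<in> homomorphisms (monad_signature M) A B \<longleftrightarrow> h \<in> NE (und A) (und B) \<and>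
    (\<forall>n\<in>cardinals_below \<kappa>. \<forall>x\<in>pts (TO M (D n)). \<forall>g\<in>n \<rightarrow>\<^sub>E pts (und A).
      h (monad_op M A n x g) = monad_op M B n x (\<lambda>i\<in>n. h (g i)))"
  unfolding homomorphisms_def mem_Collect_eq ball_syms by simp

lemma unit_D: "n \<in> cardinals_below \<kappa> \<Longrightarrow> i \<in> n \<Longrightarrow> munit M (D n) i \<in> pts (TO M (D n))"
  using NE_app[OF unit_NE[OF discrete_obj]] by simp

lemma subst_D:
  assumes "n \<in> cardinals_below \<kappa>" "m \<in> cardinals_below \<kappa>" "x \<in> pts (TO M (D n))" "y \<in> n \<rightarrow>\<^sub>E pts (TO M (D m))"
  shows "mmult M (D m) (TA M (D n) (TO M (D m)) y x) \<in> pts (TO M (D m))"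
  using assms by (intro NE_app[OF mult_NE] NE_app[OF TA_NE]) (auto simp: discrete_obj TO_obj)

lemma op_term_in_terms:
  assumes "n \<in> cardinals_below \<kappa>" "x \<in> pts (TO M (D n))"
  shows "op_term M n x \<in> terms (monad_signature M) (Field \<kappa>)"
  unfolding op_term_def using assms cardinals_belowD(2)[OF assms(1)]
  by (intro terms.App) (auto intro: terms.Var simp: encode_in_syms)

lemma eval_op_term:
  assumes "n \<in> cardinals_below \<kappa>" "x \<in> pts (TO M (D n))"
  shows "eval (monad_signature M) A f (op_term M n x) = monad_op M A n x (\<lambda>i\<in>n. f i)"
  using assms by (simp add: op_term_def cong: restrict_cong)

lemma monad_modelD:
  assumes "monad_model M A"
  shows model_algebra: "A \<in> algebras \<mu> (monad_signature M)"
    and model_und: "und A \<in> UM"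
    and model_op: "n \<in> cardinals_below \<kappa> \<Longrightarrow> x \<in> pts (TO M (D n)) \<Longrightarrow> g \<in> n \<rightarrow>\<^sub>E pts (und A) \<Longrightarrow>
      monad_op M A n x g \<in> pts (und A)"
    and model_op_dst: "n \<in> cardinals_below \<kappa> \<Longrightarrow> x \<in> pts (TO M (D n)) \<Longrightarrow> g \<in> n \<rightarrow>\<^sub>E pts (und A) \<Longrightarrow>
      g' \<in> n \<rightarrow>\<^sub>E pts (und A) \<Longrightarrow> (\<And>i. i \<in> n \<Longrightarrow> dst (und A) (g i) (g' i) \<le> e) \<Longrightarrow>
      dst (und A) (monad_op M A n x g) (monad_op M A n x g') \<le> e"
    and model_unit: "n \<in> cardinals_below \<kappa> \<Longrightarrow> i \<in> n \<Longrightarrow> g \<in> n \<rightarrow>\<^sub>E pts (und A) \<Longrightarrow>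
      monad_op M A n (munit M (D n) i) g = g i"
    and model_mult: "n \<in> cardinals_below \<kappa> \<Longrightarrow> m \<in> cardinals_below \<kappa> \<Longrightarrow> x \<in> pts (TO M (D n)) \<Longrightarrow>
      y \<in> n \<rightarrow>\<^sub>E pts (TO M (D m)) \<Longrightarrow> g \<in> m \<rightarrow>\<^sub>E pts (und A) \<Longrightarrow>
      monad_op M A n x (\<lambda>i\<in>n. monad_op M A m (y i) g) = monad_op M A m (mmult M (D m) (TA M (D n) (TO M (D m)) y x)) g"
    and model_dst: "n \<in> cardinals_below \<kappa> \<Longrightarrow> x \<in> pts (TO M (D n)) \<Longrightarrow> x' \<in> pts (TO M (D n)) \<Longrightarrow>
      g \<in> n \<rightarrow>\<^sub>E pts (und A) \<Longrightarrow> dst (und A) (monad_op M A n x g) (monad_op M A n x' g) \<le> dst (TO M (D n)) x x'"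
proof -
  show A: "A \<in> algebras \<mu> (monad_signature M)" using assms by (simp add: monad_model_def)
  then show "n \<in> cardinals_below \<kappa> \<Longrightarrow> x \<in> pts (TO M (D n)) \<Longrightarrow> g \<in> n \<rightarrow>\<^sub>E pts (und A) \<Longrightarrow>
      monad_op M A n x g \<in> pts (und A)"
    by (auto simp: algebras_monad_iff)
qed (use assms in \<open>simp_all add: monad_model_def algebras_monad_iff\<close>)

text \<open>Bound 0 expresses an identity. The distance of two operations need not be rational, so
  the third family takes every rational upper bound of it; operations at infinite distance
  contribute no equation.\<close>

definition monad_equations :: "('u trm \<times> rat \<times> 'u trm) set" where
  "monad_equations =
    (\<Union>n\<in>cardinals_below \<kappa>. \<Union>i\<in>n. {(op_term M n (munit M (D n) i), 0, Var i)}) \<union>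
    (\<Union>n\<in>cardinals_below \<kappa>. \<Union>m\<in>cardinals_below \<kappa>. \<Union>x\<in>pts (TO M (D n)). \<Union>y\<in>n \<rightarrow>\<^sub>E pts (TO M (D m)).
      {(App (encode_op M (n, x)) (\<lambda>i\<in>n. op_term M m (y i)), 0,
        op_term M m (mmult M (D m) (TA M (D n) (TO M (D m)) y x)))}) \<union>
    (\<Union>n\<in>cardinals_below \<kappa>. \<Union>x\<in>pts (TO M (D n)). \<Union>x'\<in>pts (TO M (D n)).
      \<Union>\<epsilon>\<in>{\<epsilon>. 0 \<le> \<epsilon> \<and> dst (TO M (D n)) x x' \<le> ennreal (of_rat \<epsilon>)}. {(op_term M n x, \<epsilon>, op_term M n x')})"

text \<open>Each clause of \<open>monad_model\<close> quantifies over tuples indexed by one arity,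
  each equation over assignments of all variables in \<kappa>. Assignments restrict to tuples;
  conversely a tuple is extended by a default point.\<close>

lemma monad_variety_in_varieties: "monad_variety M \<in> varieties \<kappa> \<mu>"
proof -
  have E: "monad_equations \<subseteq> quantitative_equations \<kappa> (monad_signature M)"
    unfolding monad_equations_def quantitative_equations_def
  proof (intro Un_least UN_least subsetI; clarsimp)
    fix n i assume n: "n \<in> cardinals_below \<kappa>" "i \<in> n"
    then show "op_term M n (munit M (D n) i) \<in> terms (monad_signature M) (Field \<kappa>) \<and>
        Var i \<in> terms (monad_signature M) (Field \<kappa>)"
      using cardinals_belowD(2) op_term_in_terms unit_D terms.Var by (metis subsetD)
  next
    fix n m x y assume *: "n \<in> cardinals_below \<kappa>" "m \<in> cardinals_below \<kappa>"
      "x \<in> pts (TO M (D n))" "y \<in> n \<rightarrow>\<^sub>E pts (TO M (D m))"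
    then show "App (encode_op M (n, x)) (\<lambda>i\<in>n. op_term M m (y i)) \<in> terms (monad_signature M) (Field \<kappa>) \<and>
      op_term M m (mmult M (D m) (TA M (D n) (TO M (D m)) y x)) \<in> terms (monad_signature M) (Field \<kappa>)"
      by (intro conjI terms.App op_term_in_terms subst_D)
        (auto intro: op_term_in_terms simp: encode_in_syms)
  qed (simp add: op_term_in_terms)
  have "monad_model M A \<longleftrightarrow> (\<forall>e\<in>monad_equations. satisfies \<kappa> (monad_signature M) A e)"
    if A: "A \<in> algebras \<mu> (monad_signature M)" for A
  proof
    assume "monad_model M A"
    note mod = this model_und[OF this] model_op[OF this] model_unit[OF this] model_mult[OF this] model_dst[OF this]
    have restr: "(\<lambda>i\<in>n. f i) \<in> n \<rightarrow>\<^sub>E pts (und A)" if "n \<in> cardinals_below \<kappa>" "f \<in> Field \<kappa> \<rightarrow> pts (und A)" for f n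
      using that cardinals_belowD(2)[OF that(1)] by auto
    note u = ultrametric_refl[OF UMet_ultra[OF mod(2)]]
    have 1: "satisfies \<kappa> (monad_signature M) A (op_term M n (munit M (D n) i), 0, Var i)"
      if n: "n \<in> cardinals_below \<kappa>" "i \<in> n" for n i
      unfolding satisfies_def
    proof clarify
      fix f assume f: "f \<in> Field \<kappa> \<rightarrow> pts (und A)"
      have "monad_op M A n (munit M (D n) i) (restrict f n) = restrict f n i"
        by (rule mod(4)[OF n restr[OF n(1) f]])
      with n f show "dst (und A) (eval (monad_signature M) A f (op_term M n (munit M (D n) i)))
          (eval (monad_signature M) A f (Var i)) \<le> ennreal (of_rat 0)"
        by (simp add: eval_op_term unit_D u)
    qed
    have 2: "satisfies \<kappa> (monad_signature M) A (App (encode_op M (n, x)) (\<lambda>i\<in>n. op_term M m (y i)), 0,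
        op_term M m (mmult M (D m) (TA M (D n) (TO M (D m)) y x)))"
      if *: "n \<in> cardinals_below \<kappa>" "m \<in> cardinals_below \<kappa>" "x \<in> pts (TO M (D n))"
        "y \<in> n \<rightarrow>\<^sub>E pts (TO M (D m))" for n m x y
      unfolding satisfies_def
    proof clarify
      fix f assume f: "f \<in> Field \<kappa> \<rightarrow> pts (und A)"
      have "monad_op M A n x (\<lambda>i\<in>n. eval (monad_signature M) A f (op_term M m (y i))) =
          monad_op M A n x (\<lambda>i\<in>n. monad_op M A m (y i) (restrict f m))"
        using * by (intro arg_cong[of _ _ "monad_op M A n x"] restrict_ext eval_op_term) auto
      also have "\<dots> = eval (monad_signature M) A f (op_term M m (mmult M (D m) (TA M (D n) (TO M (D m)) y x)))"
        unfolding mod(5)[OF * restr[OF *(2) f]] using * by (simp add: eval_op_term subst_D)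
      finally show "dst (und A)
          (eval (monad_signature M) A f (App (encode_op M (n, x)) (\<lambda>i\<in>n. op_term M m (y i))))
          (eval (monad_signature M) A f (op_term M m (mmult M (D m) (TA M (D n) (TO M (D m)) y x))))
          \<le> ennreal (of_rat 0)"
        using * by (simp add: u cong: restrict_cong)
    qed
    have 3: "satisfies \<kappa> (monad_signature M) A (op_term M n x, \<epsilon>, op_term M n x')"
      if *: "n \<in> cardinals_below \<kappa>" "x \<in> pts (TO M (D n))" "x' \<in> pts (TO M (D n))"
        "dst (TO M (D n)) x x' \<le> ennreal (of_rat \<epsilon>)" for n x x' and \<epsilon> :: rat
      unfolding satisfies_def
    proof clarify
      fix f assume f: "f \<in> Field \<kappa> \<rightarrow> pts (und A)"
      have "dst (und A) (monad_op M A n x (restrict f n)) (monad_op M A n x' (restrict f n)) \<le> dst (TO M (D n)) x x'"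
        by (rule mod(6)[OF *(1-3) restr[OF *(1) f]])
      also note *(4)
      finally show "dst (und A) (eval (monad_signature M) A f (op_term M n x))
         (eval (monad_signature M) A f (op_term M n x')) \<le> ennreal (of_rat \<epsilon>)"
        using * by (simp add: eval_op_term)
    qed
    show "\<forall>e\<in>monad_equations. satisfies \<kappa> (monad_signature M) A e"
      unfolding monad_equations_def ball_Un ball_UN using 1 2 3 by simp
  next
    assume E: "\<forall>e\<in>monad_equations. satisfies \<kappa> (monad_signature M) A e"
    have U: "und A \<in> UM" using A by (simp add: algebras_monad_iff)
    have mopA: "monad_op M A n x g \<in> pts (und A)"
      if "n \<in> cardinals_below \<kappa>" "x \<in> pts (TO M (D n))" "g \<in> n \<rightarrow>\<^sub>E pts (und A)" for n x g
      using A that by (auto simp: algebras_monad_iff)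
    \<comment> \<open>The extension needs a point \<open>p\<close> of \<open>A\<close>, which every
      clause has to supply because the arity may be empty.\<close>
    have ex: "\<exists>f\<in>Field \<kappa> \<rightarrow> pts (und A). restrict f n = g"
      if "g \<in> n \<rightarrow>\<^sub>E pts (und A)" "p \<in> pts (und A)" for n g p
      using that by (intro bexI[of _ "\<lambda>i. if i \<in> n then g i else p"])
        (auto simp: PiE_iff extensional_def restrict_def fun_eq_iff)
    have sat: "dst (und A) (eval (monad_signature M) A f l) (eval (monad_signature M) A f r) \<le> ennreal (of_rat \<epsilon>)"
      if "(l, \<epsilon>, r) \<in> monad_equations" "f \<in> Field \<kappa> \<rightarrow> pts (und A)" for l r \<epsilon> f
      using E that unfolding satisfies_def by fastforce
    show "monad_model M A"
      unfolding monad_model_def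
    proof (intro conjI ballI A)
      fix n i g assume *: "n \<in> cardinals_below \<kappa>" "i \<in> n" "g \<in> n \<rightarrow>\<^sub>E pts (und A)"
      obtain f where f: "f \<in> Field \<kappa> \<rightarrow> pts (und A)" "restrict f n = g"
        using ex[OF *(3), of "g i"] * by auto
      have "(op_term M n (munit M (D n) i), 0, Var i) \<in> monad_equations"
        unfolding monad_equations_def using * by blast
      from sat[OF this f(1)]
      have "dst (und A) (monad_op M A n (munit M (D n) i) g) (f i) \<le> ennreal (of_rat 0)"
        using * f(2) by (simp add: eval_op_term unit_D)
      moreover have "f i = g i" using f(2) *(2) by (metis restrict_apply')
      moreover have "g i \<in> pts (und A)" using * by auto
      ultimately show "monad_op M A n (munit M (D n) i) g = g i"
        using ultrametric_zero[OF UMet_ultra[OF U] mopA[OF *(1) unit_D[OF *(1,2)] *(3)]] by simp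
    next
      fix n m x y g assume *: "n \<in> cardinals_below \<kappa>" "m \<in> cardinals_below \<kappa>" "x \<in> pts (TO M (D n))"
        "y \<in> n \<rightarrow>\<^sub>E pts (TO M (D m))" "g \<in> m \<rightarrow>\<^sub>E pts (und A)"
      let ?z = "mmult M (D m) (TA M (D n) (TO M (D m)) y x)"
      \<comment> \<open>For empty \<open>m\<close> the tuple \<open>g\<close> has no entry; the
        value of the operation itself provides the default point.\<close>
      have z: "monad_op M A m ?z g \<in> pts (und A)" using * by (intro mopA subst_D)
      obtain f where f: "f \<in> Field \<kappa> \<rightarrow> pts (und A)" "restrict f m = g"
        using ex[OF *(5) z] by blast
      have "(App (encode_op M (n, x)) (\<lambda>i\<in>n. op_term M m (y i)), 0, op_term M m ?z) \<in> monad_equations"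
        unfolding monad_equations_def 
        by (rule UnI1, rule UnI2, rule UN_I[OF *(1)], rule UN_I[OF *(2)], rule UN_I[OF *(3)],
            rule UN_I[OF *(4)], rule singletonI)
      from sat[OF this f(1)]
      have "dst (und A) (monad_op M A n x (\<lambda>i\<in>n. eval (monad_signature M) A f (op_term M m (y i)))) (monad_op M A m ?z g) = 0"
        using * f(2) by (simp add: eval_op_term subst_D cong: restrict_cong)
      moreover have "(\<lambda>i\<in>n. eval (monad_signature M) A f (op_term M m (y i))) = (\<lambda>i\<in>n. monad_op M A m (y i) g)"
        using * f(2) by (intro restrict_ext) (simp add: eval_op_term PiE_mem[OF *(4)])
      moreover have "monad_op M A n x (\<lambda>i\<in>n. monad_op M A m (y i) g) \<in> pts (und A)"
        using * by (intro mopA) (auto intro!: mopA)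
      ultimately show "monad_op M A n x (\<lambda>i\<in>n. monad_op M A m (y i) g) = monad_op M A m ?z g"
        using ultrametric_zero[OF UMet_ultra[OF U]] z by simp
    next
      fix n x x' g assume *: "n \<in> cardinals_below \<kappa>" "x \<in> pts (TO M (D n))" "x' \<in> pts (TO M (D n))"
        "g \<in> n \<rightarrow>\<^sub>E pts (und A)"
      obtain f where f: "f \<in> Field \<kappa> \<rightarrow> pts (und A)" "restrict f n = g"
        using ex[OF *(4) mopA[OF *(1,2,4)]] by blast
      show "dst (und A) (monad_op M A n x g) (monad_op M A n x' g) \<le> dst (TO M (D n)) x x'"
      proof (rule ennreal_le_rat_bounds)
        fix \<epsilon> :: rat assume "0 \<le> \<epsilon>" "dst (TO M (D n)) x x' \<le> ennreal (of_rat \<epsilon>)"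
        then have \<epsilon>: "\<epsilon> \<in> {\<epsilon>. 0 \<le> \<epsilon> \<and> dst (TO M (D n)) x x' \<le> ennreal (of_rat \<epsilon>)}" by simp
        have "(op_term M n x, \<epsilon>, op_term M n x') \<in> monad_equations"
          unfolding monad_equations_def
          by (rule UnI2, rule UN_I[OF *(1)], rule UN_I[OF *(2)], rule UN_I[OF *(3)],
              rule UN_I[OF \<epsilon>], rule singletonI)
        from sat[OF this f(1)] show "dst (und A) (monad_op M A n x g) (monad_op M A n x' g) \<le> ennreal (of_rat \<epsilon>)"
          using * f(2) by (simp add: eval_op_term)
      qed
    qed
  qed
  then have "{A. monad_model M A} = {A \<in> algebras \<mu> (monad_signature M).
      \<forall>e\<in>monad_equations. satisfies \<kappa> (monad_signature M) A e}"
    using model_algebra by blast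
  then show ?thesis
    unfolding varieties_def monad_variety_def using is_signature_monad E by blast
qed

end

section \<open>Structure maps\<close>

context ultrametric_monad
begin

definition em_algebra :: "'u space \<Rightarrow> ('u \<Rightarrow> 'u) \<Rightarrow> bool" where
  "em_algebra X a \<longleftrightarrow> X \<in> UM \<and> a \<in> NE (TO M X) X \<and> (\<forall>p\<in>pts X. a (munit M X p) = p) \<and>
    (\<forall>z\<in>pts (TO M (TO M X)). a (mmult M X z) = a (TA M (TO M X) X a z))"

text \<open>One half of the passage between Eilenberg-Moore algebras and models;
  \<open>structure_map\<close> is the other half.\<close>

definition em_model :: "'u space \<Rightarrow> ('u \<Rightarrow> 'u) \<Rightarrow> 'u algebra" where
  "em_model X a = alg_of M X (\<lambda>n x g. a (TA M (D n) X g x))"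

lemma und_em_model [simp]: "und (em_model X a) = X"
  by (simp add: em_model_def)

lemma op_em_model [simp]:
  "n \<in> cardinals_below \<kappa> \<Longrightarrow> x \<in> pts (TO M (D n)) \<Longrightarrow> g \<in> n \<rightarrow>\<^sub>E pts X \<Longrightarrow>
    monad_op M (em_model X a) n x g = a (TA M (D n) X g x)"
  by (simp add: em_model_def)

lemma TA_D: "X \<in> UM \<Longrightarrow> n \<in> cardinals_below \<kappa> \<Longrightarrow> g \<in> n \<rightarrow>\<^sub>E pts X \<Longrightarrow> x \<in> pts (TO M (D n)) \<Longrightarrow>
    TA M (D n) X g x \<in> pts (TO M X)"
  by (rule NE_app[OF TA_NE]) (auto simp: discrete_obj)

lemma TA_D_D: "m \<in> cardinals_below \<kappa> \<Longrightarrow> n \<in> cardinals_below \<kappa> \<Longrightarrow> g \<in> n \<rightarrow>\<^sub>E m \<Longrightarrow> x \<in> pts (TO M (D n)) \<Longrightarrow>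
    TA M (D n) (D m) g x \<in> pts (TO M (D m))"
  using TA_D[OF discrete_obj] by simp

text \<open>The projection law is naturality of the unit and the unit law of \<open>a\<close>. The
  substitution law is functoriality, associativity of \<open>a\<close> and naturality of the
  multiplication along \<open>g\<close>. The distance law holds because \<open>a\<close> and
  \<open>M g\<close> are nonexpanding.\<close>

lemma em_model:
  assumes "em_algebra X a"
  shows "monad_model M (em_model X a)"
proof -
  have X: "X \<in> UM" and a: "a \<in> NE (TO M X) X" and unit: "\<And>p. p \<in> pts X \<Longrightarrow> a (munit M X p) = p"
    and assoc: "\<And>z. z \<in> pts (TO M (TO M X)) \<Longrightarrow> a (mmult M X z) = a (TA M (TO M X) X a z)"
    using assms by (auto simp: em_algebra_def)
  have op: "a (TA M (D n) X g x) \<in> pts X"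
    if "n \<in> cardinals_below \<kappa>" "x \<in> pts (TO M (D n))" "g \<in> n \<rightarrow>\<^sub>E pts X" for n x g
    using that X by (intro NE_app[OF a] TA_D)
  have alg: "em_model X a \<in> algebras \<mu> (monad_signature M)"
    unfolding em_model_def
  proof (rule alg_of_algebra[OF X op])
    fix n x g g' e assume *: "n \<in> cardinals_below \<kappa>" "x \<in> pts (TO M (D n))" "g \<in> n \<rightarrow>\<^sub>E pts X"
      "g' \<in> n \<rightarrow>\<^sub>E pts X" "\<And>i. i \<in> n \<Longrightarrow> dst X (g i) (g' i) \<le> e"
    have "dst X (a (TA M (D n) X g x)) (a (TA M (D n) X g' x)) \<le> dst (TO M X) (TA M (D n) X g x) (TA M (D n) X g' x)"
      using * X by (intro NE_le[OF a] TA_D)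
    also have "\<dots> \<le> e"
      using * X by (intro TA_dst) (simp_all add: discrete_obj)
    finally show "dst X (a (TA M (D n) X g x)) (a (TA M (D n) X g' x)) \<le> e" .
  qed
  show ?thesis
    unfolding monad_model_def
  proof (intro conjI ballI alg; unfold und_em_model)
    fix n i g assume *: "n \<in> cardinals_below \<kappa>" "i \<in> n" "g \<in> n \<rightarrow>\<^sub>E pts X"
    have "TA M (D n) X g (munit M (D n) i) = munit M X (g i)"
      using * X by (intro unit_nat[symmetric]) (simp_all add: discrete_obj)
    then show "monad_op M (em_model X a) n (munit M (D n) i) g = g i"
      using * X by (simp add: unit_D unit[OF PiE_mem[OF *(3,2)]])
  next
    fix n m x y g assume *: "n \<in> cardinals_below \<kappa>" "m \<in> cardinals_below \<kappa>" "x \<in> pts (TO M (D n))"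
      "y \<in> n \<rightarrow>\<^sub>E pts (TO M (D m))" "g \<in> m \<rightarrow>\<^sub>E pts X"
    note obj = X TO_obj[OF X] TO_obj[OF discrete_obj[OF *(2)]] discrete_obj[OF *(1)] discrete_obj[OF *(2)]
    have g: "g \<in> NE (D m) X" and y: "y \<in> NE (D n) (TO M (D m))" using * obj by simp_all
    have Tg: "TA M (D m) X g \<in> NE (TO M (D m)) (TO M X)" by (rule TA_NE[OF _ _ g]) (rule obj)+
    have Ty: "TA M (D n) (TO M (D m)) y x \<in> pts (TO M (TO M (D m)))"
      by (rule NE_app[OF TA_NE[OF _ _ y] *(3)]) (rule obj)+
    have ops: "(\<lambda>i\<in>n. monad_op M (em_model X a) m (y i) g) = compose n a (compose n (TA M (D m) X g) y)"
      using * by (auto simp: compose_def PiE_mem[OF *(4)] fun_eq_iff)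
    have c1: "compose n (TA M (D m) X g) y \<in> NE (D n) (TO M X)"
      using compose_nonexpanding[OF y Tg] by simp
    have c2: "compose n a (compose n (TA M (D m) X g) y) \<in> NE (D n) X"
      using compose_nonexpanding[OF c1 a] by simp
    have "monad_op M (em_model X a) n x (\<lambda>i\<in>n. monad_op M (em_model X a) m (y i) g) =
        a (TA M (D n) X (compose n a (compose n (TA M (D m) X g) y)) x)"
      unfolding ops using * c2 obj by simp
    also have "TA M (D n) X (compose n a (compose n (TA M (D m) X g) y)) x =
        TA M (TO M X) X a (TA M (D n) (TO M X) (compose n (TA M (D m) X g) y) x)"
      using TA_cmp[OF obj(4) obj(2) obj(1) c1 a *(3)] by simp
    also have "TA M (D n) (TO M X) (compose n (TA M (D m) X g) y) x =
        TA M (TO M (D m)) (TO M X) (TA M (D m) X g) (TA M (D n) (TO M (D m)) y x)"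
      using TA_cmp[OF obj(4) obj(3) obj(2) y Tg *(3)] by simp
    also have "a (TA M (TO M X) X a \<dots>) = a (mmult M X \<dots>)"
      by (rule assoc[symmetric], rule NE_app[OF TA_NE[OF _ _ Tg] Ty]) (rule obj)+
    also have "mmult M X (TA M (TO M (D m)) (TO M X) (TA M (D m) X g) (TA M (D n) (TO M (D m)) y x)) =
        TA M (D m) X g (mmult M (D m) (TA M (D n) (TO M (D m)) y x))"
      by (rule mult_nat[OF obj(5) obj(1) g Ty])
    finally show "monad_op M (em_model X a) n x (\<lambda>i\<in>n. monad_op M (em_model X a) m (y i) g) =
        monad_op M (em_model X a) m (mmult M (D m) (TA M (D n) (TO M (D m)) y x)) g"
      unfolding op_em_model[OF *(2) subst_D[OF *(1-4)] *(5)] .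
  next
    fix n x x' g assume *: "n \<in> cardinals_below \<kappa>" "x \<in> pts (TO M (D n))" "x' \<in> pts (TO M (D n))"
      "g \<in> n \<rightarrow>\<^sub>E pts X"
    have g: "TA M (D n) X g \<in> NE (TO M (D n)) (TO M X)"
      using * X by (intro TA_NE) (simp_all add: discrete_obj)
    have "dst X (a (TA M (D n) X g x)) (a (TA M (D n) X g x')) \<le> dst (TO M X) (TA M (D n) X g x) (TA M (D n) X g x')"
      using * X by (intro NE_le[OF a] TA_D)
    also have "\<dots> \<le> dst (TO M (D n)) x x'"
      using * by (intro NE_le[OF g])
    finally show "dst X (monad_op M (em_model X a) n x g) (monad_op M (em_model X a) n x' g) \<le> dst (TO M (D n)) x x'"
      using * by simp
  qed
qed

lemma em_hom:
  assumes a: "em_algebra X a" and b: "em_algebra Y b" and h: "h \<in> NE X Y"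
    and eq: "\<And>z. z \<in> pts (TO M X) \<Longrightarrow> h (a z) = b (TA M X Y h z)"
  shows "h \<in> homomorphisms (monad_signature M) (em_model X a) (em_model Y b)"
  unfolding homomorphisms_monad_iff
proof (intro conjI ballI; unfold und_em_model)
  fix n x g assume *: "n \<in> cardinals_below \<kappa>" "x \<in> pts (TO M (D n))" "g \<in> n \<rightarrow>\<^sub>E pts X"
  have XY: "X \<in> UM" "Y \<in> UM" using a b by (auto simp: em_algebra_def)
  have "compose n h g \<in> n \<rightarrow>\<^sub>E pts Y" using NE_app[OF h] * by (auto simp: compose_def)
  moreover have "TA M (D n) Y (compose n h g) x = TA M X Y h (TA M (D n) X g x)"
    using TA_cmp[OF discrete_obj[OF *(1)] XY _ h *(2), of g] * XY by simp
  ultimately show "h (monad_op M (em_model X a) n x g) = monad_op M (em_model Y b) n x (\<lambda>i\<in>n. h (g i))"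
    using * XY by (simp add: eq TA_D compose_def)
qed (rule h)

lemma em_algebra_free: "X \<in> UM \<Longrightarrow> em_algebra (TO M X) (mmult M X)"
  by (simp add: em_algebra_def TO_obj mult_NE unit_left mult_assoc)

text \<open>The cardinal one as an arity: it turns single points into tuples, to which the laws of a
  model apply.\<close>

lemma exists_singleton_cardinal: obtains n i where "n \<in> cardinals_below \<kappa>" "n = {i}"
proof -
  obtain n and f :: "'u \<Rightarrow> unit" where n: "n \<in> cardinals_below \<kappa>" "bij_betw f n {()}"
    using exists_cardinal_below[OF below_arity_finite, of "{()}"] by blast
  have "card n = 1" using bij_betw_same_card[OF n(2)] by simp
  then obtain i where "n = {i}" by (rule card_1_singletonE)
  then show thesis using that n by blast
qed

end

section \<open>Models of an accessible monad are its Eilenberg-Moore algebras\<close>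

locale accessible_monad = ultrametric_monad \<kappa> \<mu> M for \<kappa> \<mu> :: "'u rel" and M +
  assumes accessible: "strongly_accessible_functor \<kappa> \<mu> (mfun M)"
begin

lemmas cover = accessible_cover[OF accessible]

text \<open>Each entry of \<open>g\<close> comes from an arity of its own. The points of
  \<open>X\<close> used by all of them together number fewer than \<kappa>, so one tuple
  \<open>b\<close> enumerates them and every entry is moved to its arity. Nested operations need
  this.\<close>

lemma common_cover:
  assumes X: "X \<in> UM" and n: "|n| <o \<kappa>" and g: "g \<in> n \<rightarrow>\<^sub>E pts (TO M X)"
  obtains m b y where "m \<in> cardinals_below \<kappa>" "b \<in> m \<rightarrow>\<^sub>E pts X" "y \<in> n \<rightarrow>\<^sub>E pts (TO M (D m))"
    "g = compose n (TA M (D m) X b) y"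
proof -
  have "\<forall>i\<in>n. \<exists>k h y. k \<in> cardinals_below \<kappa> \<and> h \<in> k \<rightarrow>\<^sub>E pts X \<and> y \<in> pts (TO M (D k)) \<and> g i = TA M (D k) X h y"
  proof
    fix i assume "i \<in> n"
    from cover[OF X PiE_mem[OF g this]]
    show "\<exists>k h y. k \<in> cardinals_below \<kappa> \<and> h \<in> k \<rightarrow>\<^sub>E pts X \<and> y \<in> pts (TO M (D k)) \<and> g i = TA M (D k) X h y"
      by metis
  qed
  then obtain k h y where k: "\<And>i. i \<in> n \<Longrightarrow> k i \<in> cardinals_below \<kappa>" and h: "\<And>i. i \<in> n \<Longrightarrow> h i \<in> k i \<rightarrow>\<^sub>E pts X"
    and y: "\<And>i. i \<in> n \<Longrightarrow> y i \<in> pts (TO M (D (k i)))" and gi: "\<And>i. i \<in> n \<Longrightarrow> g i = TA M (D (k i)) X (h i) (y i)"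
    by metis
  \<comment> \<open>Regularity of \<kappa> bounds the set of all points of \<open>X\<close> that
    occur in some presentation.\<close>
  have "|\<Union>i\<in>n. h i ` k i| <o \<kappa>"
    by (intro below_arity_UN n below_arity_image cardinals_belowD(1) k)
  then obtain m b where m: "m \<in> cardinals_below \<kappa>" and b: "bij_betw b m (\<Union>i\<in>n. h i ` k i)"
    using exists_cardinal_below by metis
  define b' where "b' = restrict b m"
  have b'X: "b' \<in> m \<rightarrow>\<^sub>E pts X"
  proof -
    have "b j \<in> pts X" if "j \<in> m" for j
    proof -
      have "b j \<in> (\<Union>i\<in>n. h i ` k i)" using bij_betw_apply[OF b that] .
      then obtain i l where "i \<in> n" "l \<in> k i" "b j = h i l" by blast
      then show ?thesis using PiE_mem[OF h] by simp
    qed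
    then show ?thesis by (auto simp: b'_def)
  qed
  define q where "q i = (\<lambda>j\<in>k i. inv_into m b (h i j))" for i
  have inv: "inv_into m b (h i j) \<in> m \<and> b' (inv_into m b (h i j)) = h i j" if "i \<in> n" "j \<in> k i" for i j
  proof -
    have "h i j \<in> b ` m" using b that by (auto simp: bij_betw_def)
    then show ?thesis by (simp add: b'_def inv_into_into f_inv_into_f)
  qed
  have q: "q i \<in> k i \<rightarrow>\<^sub>E m" if "i \<in> n" for i
    using inv that by (auto simp: q_def)
  have bq: "compose (k i) b' (q i) = h i" if "i \<in> n" for i
    using inv[OF that] h[OF that] by (auto simp: q_def compose_def fun_eq_iff PiE_iff extensional_def)
  define y' where "y' = (\<lambda>i\<in>n. TA M (D (k i)) (D m) (q i) (y i))"
  have "y' \<in> n \<rightarrow>\<^sub>E pts (TO M (D m))"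
    using TA_D_D[OF m] k q y by (auto simp: y'_def)
  moreover have "g = compose n (TA M (D m) X b') y'"
  proof
    fix i
    show "g i = compose n (TA M (D m) X b') y' i"
    proof (cases "i \<in> n")
      case True
      have "TA M (D (k i)) X (compose (k i) b' (q i)) (y i) = TA M (D m) X b' (TA M (D (k i)) (D m) (q i) (y i))"
        using TA_cmp[OF discrete_obj[OF k[OF True]] discrete_obj[OF m] X, of "q i" b' "y i"]
          q[OF True] b'X X y[OF True] by (simp add: NE_D_D)
      then show ?thesis
        using gi[OF True] bq[OF True] True by (simp add: compose_def y'_def)
    qed (use g in \<open>simp add: compose_def PiE_iff extensional_def\<close>)
  qed
  ultimately show thesis using that m b'X by blast
qed

text \<open>For a model the choice is unique: the prescribed values fix the map on all
  \<open>M g\<close>, and these cover \<open>M A\<close>.\<close>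

definition structure_map :: "'u algebra \<Rightarrow> 'u \<Rightarrow> 'u" where
  "structure_map A = (SOME a. a \<in> NE (TO M (und A)) (und A) \<and>
    (\<forall>n\<in>cardinals_below \<kappa>. \<forall>g\<in>n \<rightarrow>\<^sub>E pts (und A). \<forall>x\<in>pts (TO M (D n)).
      a (TA M (D n) (und A) g x) = monad_op M A n x g))"

text \<open>The operations of \<open>A\<close> form a cocone with vertex \<open>A\<close>, and
  strong accessibility extends it to \<open>M A\<close>. The two bounds are clauses of the model;
  naturality in the arity follows from the projection and substitution laws.\<close>

lemma structure_map:
  assumes A: "monad_model M A"
  shows structure_NE: "structure_map A \<in> NE (TO M (und A)) (und A)"
    and structure_TA: "n \<in> cardinals_below \<kappa> \<Longrightarrow> g \<in> n \<rightarrow>\<^sub>E pts (und A) \<Longrightarrow> x \<in> pts (TO M (D n)) \<Longrightarrow>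
      structure_map A (TA M (D n) (und A) g x) = monad_op M A n x g"
proof -
  let ?X = "und A"
  note X = model_und[OF A]
  define \<theta> where "\<theta> n g = (\<lambda>x\<in>pts (TO M (D n)). monad_op M A n x g)" for n g
  have "cocone (mfun M) ?X ?X \<theta>"
    unfolding cocone_def
  proof (intro conjI ballI allI impI)
    fix n g assume *: "n \<in> cardinals_below \<kappa>" "g \<in> n \<rightarrow>\<^sub>E pts ?X"
    then show "\<theta> n g \<in> NE (TO M (D n)) ?X"
      unfolding \<theta>_def by (intro restrict_NE model_op[OF A] model_dst[OF A])
  next
    fix n g g' e x assume *: "n \<in> cardinals_below \<kappa>" "g \<in> n \<rightarrow>\<^sub>E pts ?X" "g' \<in> n \<rightarrow>\<^sub>E pts ?X"
      "\<forall>i\<in>n. dst ?X (g i) (g' i) \<le> e" "x \<in> pts (TO M (D n))"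
    then show "dst ?X (\<theta> n g x) (\<theta> n g' x) \<le> e"
      using model_op_dst[OF A *(1) *(5) *(2,3)] by (simp add: \<theta>_def)
  next
    fix m n h g x assume *: "m \<in> cardinals_below \<kappa>" "n \<in> cardinals_below \<kappa>" "h \<in> m \<rightarrow>\<^sub>E n"
      "g \<in> n \<rightarrow>\<^sub>E pts ?X" "x \<in> pts (TO M (D m))"
    \<comment> \<open>Renaming along \<open>h\<close> is substitution of the variables
      \<open>h i\<close>; by \<open>unit_right\<close> the Kleisli extension of \<open>?y\<close> is
      \<open>M h\<close>.\<close>
    let ?y = "\<lambda>i\<in>m. munit M (D n) (h i)"
    have hi: "h i \<in> n" if "i \<in> m" for i using *(3) that by auto
    have y: "?y = compose m (munit M (D n)) h" by (simp add: compose_def)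
    have y_in: "?y \<in> m \<rightarrow>\<^sub>E pts (TO M (D n))"
      using unit_D[OF *(2)] hi by auto
    have "TA M (D m) (TO M (D n)) ?y x = TA M (D n) (TO M (D n)) (munit M (D n)) (TA M (D m) (D n) h x)"
      using TA_cmp[OF discrete_obj[OF *(1)] discrete_obj[OF *(2)] TO_obj[OF discrete_obj[OF *(2)]], of h "munit M (D n)" x]
        * unit_NE[OF discrete_obj[OF *(2)]] by (simp add: y NE_D_D)
    then have "mmult M (D n) (TA M (D m) (TO M (D n)) ?y x) = TA M (D m) (D n) h x"
      using unit_right[OF discrete_obj[OF *(2)] TA_D_D[OF *(2,1,3,5)]] by simp
    then have "monad_op M A n (TA M (D m) (D n) h x) g = monad_op M A m x (\<lambda>i\<in>m. monad_op M A n (?y i) g)"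
      using model_mult[OF A *(1,2,5) y_in *(4)] by simp
    also have "(\<lambda>i\<in>m. monad_op M A n (?y i) g) = compose m g h"
      unfolding compose_def using hi by (intro restrict_ext) (simp add: model_unit[OF A *(2) _ *(4)])
    finally show "\<theta> m (compose m g h) x = \<theta> n g (TA M (D m) (D n) h x)"
      using * TA_D_D[OF *(2,1,3,5)] by (simp add: \<theta>_def)
  qed
  then obtain a where "a \<in> NE (TO M ?X) ?X" "\<And>n g x. n \<in> cardinals_below \<kappa> \<Longrightarrow> g \<in> n \<rightarrow>\<^sub>E pts ?X \<Longrightarrow>
      x \<in> pts (TO M (D n)) \<Longrightarrow> a (TA M (D n) ?X g x) = \<theta> n g x"
    using accessible_extension[OF accessible X X] by blast
  then have ex: "\<exists>a. a \<in> NE (TO M ?X) ?X \<and> (\<forall>n\<in>cardinals_below \<kappa>. \<forall>g\<in>n \<rightarrow>\<^sub>E pts ?X. \<forall>x\<in>pts (TO M (D n)).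
      a (TA M (D n) ?X g x) = monad_op M A n x g)"
    by (intro exI[of _ a]) (auto simp: \<theta>_def)
  show "structure_map A \<in> NE (TO M ?X) ?X"
    and "n \<in> cardinals_below \<kappa> \<Longrightarrow> g \<in> n \<rightarrow>\<^sub>E pts ?X \<Longrightarrow> x \<in> pts (TO M (D n)) \<Longrightarrow>
      structure_map A (TA M (D n) ?X g x) = monad_op M A n x g"
    using someI_ex[OF ex] unfolding structure_map_def by auto
qed

text \<open>A point is a tuple of length one, and on tuples this is the projection law.\<close>

lemma structure_unit:
  assumes A: "monad_model M A" and p: "p \<in> pts (und A)"
  shows "structure_map A (munit M (und A) p) = p"
proof -
  obtain n i where n: "n \<in> cardinals_below \<kappa>" "n = {i}" by (rule exists_singleton_cardinal)
  define g where "g = (\<lambda>j\<in>n. p)"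
  have g: "g \<in> n \<rightarrow>\<^sub>E pts (und A)" using p by (simp add: g_def)
  have i: "i \<in> n" "g i = p" using n by (auto simp: g_def)
  have "TA M (D n) (und A) g (munit M (D n) i) = munit M (und A) (g i)"
    using g i(1) model_und[OF A] by (intro unit_nat[symmetric]) (simp_all add: discrete_obj n(1))
  then have "structure_map A (munit M (und A) (g i)) = monad_op M A n (munit M (D n) i) g"
    using structure_TA[OF A n(1) g unit_D[OF n(1) i(1)]] by simp
  then show ?thesis using model_unit[OF A n(1) i(1) g] i by simp
qed

text \<open>After presenting \<open>z\<close> by a tuple in \<open>M A\<close>, and all entries of
  that tuple over a single arity, both sides are operations of \<open>A\<close> on the same tuple
  \<open>b\<close>, and they agree by the substitution law.\<close>

lemma structure_assoc:
  assumes A: "monad_model M A" and z: "z \<in> pts (TO M (TO M (und A)))"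
  shows "structure_map A (mmult M (und A) z) = structure_map A (TA M (TO M (und A)) (und A) (structure_map A) z)"
proof -
  let ?X = "und A"
  note X = model_und[OF A]
  obtain n g x where n: "n \<in> cardinals_below \<kappa>" and g: "g \<in> n \<rightarrow>\<^sub>E pts (TO M ?X)" and x: "x \<in> pts (TO M (D n))"
    and z: "z = TA M (D n) (TO M ?X) g x"
    using cover[OF TO_obj[OF X] z] by blast
  obtain m b y where m: "m \<in> cardinals_below \<kappa>" and b: "b \<in> m \<rightarrow>\<^sub>E pts ?X" and y: "y \<in> n \<rightarrow>\<^sub>E pts (TO M (D m))"
    and g_eq: "g = compose n (TA M (D m) ?X b) y"
    using common_cover[OF X cardinals_belowD(1)[OF n] g] by blast
  have gN: "g \<in> NE (D n) (TO M ?X)" and bN: "b \<in> NE (D m) ?X" and yN: "y \<in> NE (D n) (TO M (D m))"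
    using g b y by (simp_all add: X TO_obj discrete_obj m)
  have Tb: "TA M (D m) ?X b \<in> NE (TO M (D m)) (TO M ?X)"
    by (rule TA_NE[OF discrete_obj[OF m] X bN])
  have Ty: "TA M (D n) (TO M (D m)) y x \<in> pts (TO M (TO M (D m)))"
    by (rule NE_app[OF TA_NE[OF discrete_obj[OF n] TO_obj[OF discrete_obj[OF m]] yN] x])
  have "TA M (TO M ?X) ?X (structure_map A) z = TA M (D n) ?X (compose n (structure_map A) g) x"
    unfolding z using TA_cmp[OF discrete_obj[OF n] TO_obj[OF X] X gN structure_NE[OF A] x] by simp
  moreover have "compose n (structure_map A) g \<in> n \<rightarrow>\<^sub>E pts ?X"
    using g NE_app[OF structure_NE[OF A]] by (auto simp: compose_def)
  ultimately have "structure_map A (TA M (TO M ?X) ?X (structure_map A) z) = monad_op M A n x (compose n (structure_map A) g)"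
    by (simp add: structure_TA[OF A n _ x])
  also have "compose n (structure_map A) g = (\<lambda>i\<in>n. monad_op M A m (y i) b)"
    unfolding compose_def using g_eq by (intro restrict_ext) (simp add: structure_TA[OF A m b] PiE_mem[OF y] compose_def)
  also have "monad_op M A n x \<dots> = monad_op M A m (mmult M (D m) (TA M (D n) (TO M (D m)) y x)) b"
    by (rule model_mult[OF A n m x y b])
  also have "\<dots> = structure_map A (TA M (D m) ?X b (mmult M (D m) (TA M (D n) (TO M (D m)) y x)))"
    by (rule structure_TA[OF A m b, symmetric]) (rule subst_D[OF n m x y])
  also have "TA M (D m) ?X b (mmult M (D m) (TA M (D n) (TO M (D m)) y x)) =
      mmult M ?X (TA M (TO M (D m)) (TO M ?X) (TA M (D m) ?X b) (TA M (D n) (TO M (D m)) y x))"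
    by (rule mult_nat[symmetric, OF discrete_obj[OF m] X bN Ty])
  also have "TA M (TO M (D m)) (TO M ?X) (TA M (D m) ?X b) (TA M (D n) (TO M (D m)) y x) = z"
    unfolding z g_eq
    using TA_cmp[OF discrete_obj[OF n] TO_obj[OF discrete_obj[OF m]] TO_obj[OF X] yN Tb x] by simp
  finally show ?thesis by simp
qed

lemma em_algebra_structure: "monad_model M A \<Longrightarrow> em_algebra (und A) (structure_map A)"
  by (simp add: em_algebra_def model_und structure_NE structure_unit structure_assoc)

lemma em_model_structure: 
  assumes A: "monad_model M A"
  shows "em_model (und A) (structure_map A) = A"
proof (rule algebras_monad_eqI)
  show "em_model (und A) (structure_map A) \<in> algebras \<mu> (monad_signature M)"
    by (rule model_algebra[OF em_model[OF em_algebra_structure[OF A]]])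
qed (simp_all add: model_algebra[OF A] structure_TA[OF A])

lemma cover_eqI:
  assumes "X \<in> UM" "f \<in> NE (TO M X) Y" "f' \<in> NE (TO M X) Z"
    and "\<And>n g x. n \<in> cardinals_below \<kappa> \<Longrightarrow> g \<in> n \<rightarrow>\<^sub>E pts X \<Longrightarrow> x \<in> pts (TO M (D n)) \<Longrightarrow>
      f (TA M (D n) X g x) = f' (TA M (D n) X g x)"
  shows "f = f'"
proof (rule NE_eqI[OF assms(2,3)])
  fix z assume "z \<in> pts (TO M X)"
  from cover[OF assms(1) this] show "f z = f' z" using assms(4) by metis
qed

text \<open>Both maps take the same values on all \<open>M g\<close>, and these cover
  \<open>M X\<close>.\<close>

lemma structure_em_model:
  assumes a: "em_algebra X a"
  shows "structure_map (em_model X a) = a"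
proof (rule cover_eqI[of X])
  show "structure_map (em_model X a) \<in> NE (TO M X) X" using structure_NE[OF em_model[OF a]] by simp
  fix n g x assume "n \<in> cardinals_below \<kappa>" "g \<in> n \<rightarrow>\<^sub>E pts X" "x \<in> pts (TO M (D n))"
  then show "structure_map (em_model X a) (TA M (D n) X g x) = a (TA M (D n) X g x)"
    using structure_TA[OF em_model[OF a], of n g x] by simp
qed (use a in \<open>auto simp: em_algebra_def\<close>)

text \<open>At a covered point \<open>M g x\<close> both sides are the operation \<open>x\<close> of
  \<open>B\<close> applied to the image of the tuple \<open>g\<close>.\<close>

lemma structure_hom:
  assumes A: "monad_model M A" and B: "monad_model M B" and h: "h \<in> homomorphisms (monad_signature M) A B"
    and z: "z \<in> pts (TO M (und A))"
  shows "h (structure_map A z) = structure_map B (TA M (und A) (und B) h z)"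
proof -
  have hN: "h \<in> NE (und A) (und B)" using h by (simp add: homomorphisms_def)
  obtain n g x where n: "n \<in> cardinals_below \<kappa>" and g: "g \<in> n \<rightarrow>\<^sub>E pts (und A)" and x: "x \<in> pts (TO M (D n))"
    and z: "z = TA M (D n) (und A) g x"
    using cover[OF model_und[OF A] z] by blast
  have c: "compose n h g \<in> n \<rightarrow>\<^sub>E pts (und B)" using g NE_app[OF hN] by (auto simp: compose_def)
  have "TA M (und A) (und B) h z = TA M (D n) (und B) (compose n h g) x"
    unfolding z using TA_cmp[OF discrete_obj[OF n] model_und[OF A] model_und[OF B] _ hN x, of g] g
    by (simp add: model_und[OF A])
  then have "structure_map B (TA M (und A) (und B) h z) = monad_op M B n x (compose n h g)"
    by (simp add: structure_TA[OF B n c x])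
  also have "\<dots> = h (monad_op M A n x g)"
    using h g n x by (simp add: homomorphisms_monad_iff compose_def)
  also have "monad_op M A n x g = structure_map A z"
    unfolding z by (rule structure_TA[OF A n g x, symmetric])
  finally show ?thesis by simp
qed

end

section \<open>Concrete functors\<close>

lemma variety_cat_simps [simp]:
  "obj (variety_cat \<mu> V) = snd V"
  "hom (variety_cat \<mu> V) = homomorphisms (fst V)"
  "idn (variety_cat \<mu> V) A = (\<lambda>x\<in>pts (und A). x)"
  "cmp (variety_cat \<mu> V) A B C g f = compose (pts (und A)) g f"
  by (simp_all add: variety_cat_def full_subcat_def Alg_cat_def)

lemma hom_space_variety_cat:
  "hom_space (variety_cat \<mu> V) A B = sup_space (homomorphisms (fst V) A B) (pts (und A)) (und B)"
  by (simp add: hom_space_def variety_cat_def full_subcat_def Alg_cat_def sup_space_def)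

lemma varieties_algebras: "V \<in> varieties \<kappa> \<mu> \<Longrightarrow> A \<in> snd V \<Longrightarrow> A \<in> algebras \<mu> (fst V)"
  by (auto simp: varieties_def)

text \<open>Concrete functors act as the identity on maps, so they are encoded by their object part
  \<Phi>.\<close>

definition conc :: "'u variety \<Rightarrow> ('u algebra \<Rightarrow> 'u algebra) \<Rightarrow> ('u algebra, 'u \<Rightarrow> 'u, 'u algebra, 'u \<Rightarrow> 'u) fctr" where
  "conc V \<Phi> = \<lparr>fobj = (\<lambda>A\<in>snd V. \<Phi> A),
    farr = (\<lambda>A\<in>snd V. \<lambda>B\<in>snd V. \<lambda>h\<in>homomorphisms (fst V) A B. h)\<rparr>"

lemma fobj_conc [simp]: "A \<in> snd V \<Longrightarrow> fobj (conc V \<Phi>) A = \<Phi> A"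
  by (simp add: conc_def)

lemma farr_conc [simp]:
  "A \<in> snd V \<Longrightarrow> B \<in> snd V \<Longrightarrow> h \<in> homomorphisms (fst V) A B \<Longrightarrow> farr (conc V \<Phi>) A B h = h"
  by (simp add: conc_def)

lemma conc_cong: "(\<And>A. A \<in> snd V \<Longrightarrow> \<Phi> A = \<Psi> A) \<Longrightarrow> conc V \<Phi> = conc V \<Psi>"
  by (simp add: conc_def cong: restrict_cong)

text \<open>Nonexpansion on hom-spaces is automatic: with equal underlying spaces, both
  hom-distances are the same supremum over the same points.\<close>

lemma concrete_functor_conc:
  assumes V: "V \<in> varieties \<kappa> \<mu>"
    and \<Phi>: "\<And>A. A \<in> snd V \<Longrightarrow> \<Phi> A \<in> snd W" "\<And>A. A \<in> snd V \<Longrightarrow> und (\<Phi> A) = und A"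
    and hom: "\<And>A B h. A \<in> snd V \<Longrightarrow> B \<in> snd V \<Longrightarrow> h \<in> homomorphisms (fst V) A B \<Longrightarrow>
      h \<in> homomorphisms (fst W) (\<Phi> A) (\<Phi> B)"
  shows "concrete_functor \<mu> V W (conc V \<Phi>)"
proof -
  have "is_functor (variety_cat \<mu> V) (variety_cat \<mu> W) (conc V \<Phi>)"
    unfolding is_functor_def variety_cat_simps
  proof (intro conjI ballI)
    fix A assume A: "A \<in> snd V"
    then show "farr (conc V \<Phi>) A A (\<lambda>x\<in>pts (und A). x) = (\<lambda>x\<in>pts (und (fobj (conc V \<Phi>) A)). x)"
      using id_homomorphism[OF varieties_algebras[OF V A]] by (simp add: \<Phi>)
  next
    fix A B C f g assume "A \<in> snd V" "B \<in> snd V" "C \<in> snd V"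
      "f \<in> homomorphisms (fst V) A B" "g \<in> homomorphisms (fst V) B C"
    then show "farr (conc V \<Phi>) A C (compose (pts (und A)) g f) =
        compose (pts (und (fobj (conc V \<Phi>) A))) (farr (conc V \<Phi>) B C g) (farr (conc V \<Phi>) A B f)"
      using compose_homomorphisms[of f "fst V" A B g C \<mu>] varieties_algebras[OF V] by (simp add: \<Phi>)
  qed (auto simp: conc_def \<Phi> hom)
  moreover have "farr (conc V \<Phi>) A B \<in> NE (hom_space (variety_cat \<mu> V) A B)
      (hom_space (variety_cat \<mu> W) (fobj (conc V \<Phi>) A) (fobj (conc V \<Phi>) B))"
    if "A \<in> snd V" "B \<in> snd V" for A B
    unfolding hom_space_variety_cat nonexpanding_maps_def[of "sup_space _ _ _"]
    using that by (auto simp: sup_space_def \<Phi> hom) (auto simp: conc_def)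
  moreover have "comp_functor (variety_cat \<mu> V) (forgetful_functor \<mu> W) (conc V \<Phi>) = forgetful_functor \<mu> V"
    unfolding comp_functor_def forgetful_functor_def Let_def
    by (auto simp: \<Phi> hom intro!: restrict_ext)
  ultimately show ?thesis
    by (simp add: concrete_functor_def enriched_functor_def)
qed

text \<open>Forgetful functors keep every homomorphism as a function, so commuting with them forces
  \<open>F\<close> to fix all maps. Extensionality of the records then recovers \<open>F\<close>
  from its object part.\<close>

lemma concrete_functorD:
  assumes F: "concrete_functor \<mu> V W F"
  shows concrete_obj: "A \<in> snd V \<Longrightarrow> fobj F A \<in> snd W"
    and concrete_und: "A \<in> snd V \<Longrightarrow> und (fobj F A) = und A"
    and concrete_hom: "A \<in> snd V \<Longrightarrow> B \<in> snd V \<Longrightarrow> h \<in> homomorphisms (fst V) A B \<Longrightarrow>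
      h \<in> homomorphisms (fst W) (fobj F A) (fobj F B)"
    and concrete_conc: "F = conc V (fobj F)"
proof -
  have isF: "is_functor (variety_cat \<mu> V) (variety_cat \<mu> W) F"
    and eq: "comp_functor (variety_cat \<mu> V) (forgetful_functor \<mu> W) F = forgetful_functor \<mu> V"
    using F by (auto simp: concrete_functor_def enriched_functor_def)
  show obj: "fobj F A \<in> snd W" if "A \<in> snd V" for A
    using isF that by (auto simp: is_functor_def)
  have arr: "farr F A B \<in> homomorphisms (fst V) A B \<rightarrow>\<^sub>E homomorphisms (fst W) (fobj F A) (fobj F B)"
    if "A \<in> snd V" "B \<in> snd V" for A B
    using isF that by (simp add: is_functor_def)
  show "und (fobj F A) = und A" if "A \<in> snd V"
  proof -
    have "fobj (comp_functor (variety_cat \<mu> V) (forgetful_functor \<mu> W) F) A = fobj (forgetful_functor \<mu> V) A"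
      by (simp add: eq)
    then show ?thesis using that obj by (simp add: comp_functor_def forgetful_functor_def Let_def)
  qed
  have id: "farr F A B h = h" if *: "A \<in> snd V" "B \<in> snd V" "h \<in> homomorphisms (fst V) A B" for A B h
  proof -
    have "farr (comp_functor (variety_cat \<mu> V) (forgetful_functor \<mu> W) F) A B h = farr (forgetful_functor \<mu> V) A B h"
      by (simp add: eq)
    then show ?thesis
      using * obj PiE_mem[OF arr[OF *(1,2)] *(3)] by (simp add: comp_functor_def forgetful_functor_def Let_def)
  qed
  show "h \<in> homomorphisms (fst W) (fobj F A) (fobj F B)"
    if "A \<in> snd V" "B \<in> snd V" "h \<in> homomorphisms (fst V) A B"
    using PiE_mem[OF arr[OF that(1,2)] that(3)] id[OF that] by simp
  have ext: "fobj F \<in> extensional (snd V)" "farr F \<in> extensional (snd V)"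
    "\<And>A. A \<in> snd V \<Longrightarrow> farr F A \<in> extensional (snd V)"
    using isF by (auto simp: is_functor_def PiE_iff)
  have farr: "farr F = farr (conc V (fobj F))"
  proof (rule extensionalityI[OF ext(2)])
    fix A assume A: "A \<in> snd V"
    show "farr F A = farr (conc V (fobj F)) A"
    proof (rule extensionalityI[OF ext(3)[OF A]])
      fix B assume B: "B \<in> snd V"
      show "farr F A B = farr (conc V (fobj F)) A B"
        using arr[OF A B] A B id
        by (intro extensionalityI[of _ "homomorphisms (fst V) A B"]) (auto simp: PiE_iff conc_def)
    qed (use A in \<open>simp add: conc_def\<close>)
  qed (simp add: conc_def)
  have fobj: "fobj F = fobj (conc V (fobj F))"
    by (rule extensionalityI[OF ext(1)]) (simp_all add: conc_def)
  show "F = conc V (fobj F)"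
    by (rule fctr.equality) (use fobj farr in simp_all)
qed

lemma comp_functor_conc:
  assumes F: "concrete_functor \<mu> V W F" and G: "concrete_functor \<mu> W Z G"
  shows "comp_functor (variety_cat \<mu> V) G F = conc V (\<lambda>A. fobj G (fobj F A))"
proof -
  have id: "farr F A B h = h" if "A \<in> snd V" "B \<in> snd V" "h \<in> homomorphisms (fst V) A B" for A B h
    using that by (subst concrete_conc[OF F]) simp
  have "farr G A B h = h" if "A \<in> snd W" "B \<in> snd W" "h \<in> homomorphisms (fst W) A B" for A B h
    using that by (subst concrete_conc[OF G]) simp
  then show ?thesis
    unfolding comp_functor_def conc_def
    by (auto intro!: restrict_ext simp: id concrete_obj[OF F] concrete_hom[OF F])
qed

lemma id_functor_conc: "id_functor (variety_cat \<mu> V) = conc V (\<lambda>A. A)"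
  by (simp add: id_functor_def conc_def)

section \<open>The category of varieties and concrete functors\<close>

lemma Varieties_cat_simps:
  "obj (Varieties_cat \<kappa> \<mu>) = varieties \<kappa> \<mu>"
  "hom (Varieties_cat \<kappa> \<mu>) V W = {F. concrete_functor \<mu> V W F}"
  "idn (Varieties_cat \<kappa> \<mu>) V = id_functor (variety_cat \<mu> V)"
  "cmp (Varieties_cat \<kappa> \<mu>) V W X G F = comp_functor (variety_cat \<mu> V) G F"
  by (simp_all add: Varieties_cat_def)

lemma concrete_comp:
  assumes V: "V \<in> varieties \<kappa> \<mu>" and F: "concrete_functor \<mu> V W F" and G: "concrete_functor \<mu> W Z G"
  shows "concrete_functor \<mu> V Z (comp_functor (variety_cat \<mu> V) G F)"
  unfolding comp_functor_conc[OF F G]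
  by (rule concrete_functor_conc[OF V])
    (simp_all add: concrete_obj[OF F] concrete_obj[OF G] concrete_und[OF F] concrete_und[OF G]
      concrete_hom[OF F] concrete_hom[OF G])

lemma concrete_id: "V \<in> varieties \<kappa> \<mu> \<Longrightarrow> concrete_functor \<mu> V V (id_functor (variety_cat \<mu> V))"
  unfolding id_functor_conc by (rule concrete_functor_conc) simp_all

lemma category_Varieties_cat: "category (Varieties_cat \<kappa> \<mu>)"
  unfolding category_def Varieties_cat_simps mem_Collect_eq
proof (intro conjI ballI)
  fix V W F assume V: "V \<in> varieties \<kappa> \<mu>" and W: "W \<in> varieties \<kappa> \<mu>" and "F \<in> {F. concrete_functor \<mu> V W F}"
  then have F: "concrete_functor \<mu> V W F" by simp
  show "comp_functor (variety_cat \<mu> V) F (id_functor (variety_cat \<mu> V)) = F"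
    unfolding comp_functor_conc[OF concrete_id[OF V] F]
    by (subst (2) concrete_conc[OF F], rule conc_cong) (simp add: id_functor_conc)
  show "comp_functor (variety_cat \<mu> V) (id_functor (variety_cat \<mu> W)) F = F"
    unfolding comp_functor_conc[OF F concrete_id[OF W]]
    by (subst (2) concrete_conc[OF F], rule conc_cong) (simp add: id_functor_conc concrete_obj[OF F])
next
  fix V W X Y F G H
  assume V: "V \<in> varieties \<kappa> \<mu>" and W: "W \<in> varieties \<kappa> \<mu>" and "F \<in> {F. concrete_functor \<mu> V W F}"
    "G \<in> {F. concrete_functor \<mu> W X F}" "H \<in> {F. concrete_functor \<mu> X Y F}"
  then have F: "concrete_functor \<mu> V W F" and G: "concrete_functor \<mu> W X G" and H: "concrete_functor \<mu> X Y H"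
    by auto
  show "comp_functor (variety_cat \<mu> V) H (comp_functor (variety_cat \<mu> V) G F) =
      comp_functor (variety_cat \<mu> V) (comp_functor (variety_cat \<mu> W) H G) F"
    unfolding comp_functor_conc[OF F concrete_comp[OF W G H]] comp_functor_conc[OF concrete_comp[OF V F G] H]
    unfolding comp_functor_conc[OF F G] comp_functor_conc[OF G H]
    by (rule conc_cong) (simp add: concrete_obj[OF F])
qed (auto intro: concrete_comp concrete_id)

section \<open>Monad morphisms and concrete functors\<close>

context arity_universe
begin

text \<open>Restriction of scalars along a monad morphism from \<open>M\<close> to
  \<open>N\<close>.\<close>

definition reindex :: "('u space, 'u \<Rightarrow> 'u) monad \<Rightarrow> ('u space, 'u \<Rightarrow> 'u) monad \<Rightarrow> ('u space \<Rightarrow> 'u \<Rightarrow> 'u) \<Rightarrow>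
    'u algebra \<Rightarrow> 'u algebra" where
  "reindex M N \<alpha> A = alg_of M (und A) (\<lambda>n x g. monad_op N A n (\<alpha> (D n) x) g)"

lemma und_reindex [simp]: "und (reindex M N \<alpha> A) = und A"
  by (simp add: reindex_def alg_of_def)

end

locale ultrametric_monad_morphism =
  arity_universe \<kappa> \<mu> + M: ultrametric_monad \<kappa> \<mu> M + N: ultrametric_monad \<kappa> \<mu> N for \<kappa> \<mu> :: "'u rel" and M N +
  fixes \<alpha>
  assumes morphism: "monad_morphism (UMet \<mu>) M N \<alpha>"
begin

lemmas \<alpha>_NE = monad_morphism_NE[OF morphism]
lemmas \<alpha>_nat = monad_morphism_nat[OF morphism]
lemmas \<alpha>_unit = monad_morphism_unit[OF morphism]
lemmas \<alpha>_mult = monad_morphism_mult[OF morphism]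

lemma \<alpha>_D: "n \<in> cardinals_below \<kappa> \<Longrightarrow> x \<in> pts (TO M (D n)) \<Longrightarrow>
    \<alpha> (D n) x \<in> pts (TO N (D n))"
  by (rule NE_app[OF \<alpha>_NE[OF discrete_obj]])

lemma op_reindex:
  "n \<in> cardinals_below \<kappa> \<Longrightarrow> x \<in> pts (TO M (D n)) \<Longrightarrow> g \<in> n \<rightarrow>\<^sub>E pts (und A) \<Longrightarrow>
    monad_op M (reindex M N \<alpha> A) n x g = monad_op N A n (\<alpha> (D n) x) g"
  by (simp add: reindex_def)

lemma reindex_algebra:
  assumes A: "monad_model N A"
  shows "reindex M N \<alpha> A \<in> algebras \<mu> (monad_signature M)"
  unfolding reindex_def
  by (rule M.alg_of_algebra[OF N.model_und[OF A] N.model_op[OF A] N.model_op_dst[OF A]]) (simp_all add: \<alpha>_D)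

text \<open>A monad morphism preserves units and, by naturality and its multiplication law, Kleisli
  extensions; hence projections and substitutions are preserved. The distance clause survives
  because each component is nonexpanding.\<close>

lemma reindex_model:
  assumes A: "monad_model N A"
  shows "monad_model M (reindex M N \<alpha> A)"
  unfolding monad_model_def
proof (intro conjI ballI reindex_algebra[OF A]; unfold und_reindex)
  fix n i g assume *: "n \<in> cardinals_below \<kappa>" "i \<in> n" "g \<in> n \<rightarrow>\<^sub>E pts (und A)"
  then show "monad_op M (reindex M N \<alpha> A) n (munit M (D n) i) g = g i"
    by (simp add: op_reindex M.unit_D \<alpha>_unit discrete_obj N.model_unit[OF A])
next
  fix n m x y g
  assume *: "n \<in> cardinals_below \<kappa>" "m \<in> cardinals_below \<kappa>" "x \<in> pts (TO M (D n))"
    "y \<in> n \<rightarrow>\<^sub>E pts (TO M (D m))" "g \<in> m \<rightarrow>\<^sub>E pts (und A)"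
  let ?n = "D n" and ?m = "D m"
  let ?z = "TA M ?n (TO M ?m) y x"
  note n = discrete_obj[OF *(1)] and m = discrete_obj[OF *(2)]
  note Mm = M.TO_obj[OF m] and Nm = N.TO_obj[OF m]
  have yN: "y \<in> NE ?n (TO M ?m)" using *(4) by (simp add: Mm)
  have y': "compose n (\<alpha> ?m) y \<in> n \<rightarrow>\<^sub>E pts (TO N ?m)"
    using \<alpha>_D[OF *(2)] *(4) by (auto simp: compose_def)
  have z: "?z \<in> pts (TO M (TO M ?m))" by (rule NE_app[OF M.TA_NE[OF n Mm yN] *(3)])
  have "\<alpha> ?m (mmult M ?m ?z) = mmult N ?m (TA N (TO M ?m) (TO N ?m) (\<alpha> ?m) (\<alpha> (TO M ?m) ?z))"
    by (rule \<alpha>_mult[OF m z])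
  also have "\<alpha> (TO M ?m) ?z = TA N ?n (TO M ?m) y (\<alpha> ?n x)"
    by (rule \<alpha>_nat[OF n Mm yN *(3)])
  also have "TA N (TO M ?m) (TO N ?m) (\<alpha> ?m) (TA N ?n (TO M ?m) y (\<alpha> ?n x)) =
      TA N ?n (TO N ?m) (compose n (\<alpha> ?m) y) (\<alpha> ?n x)"
    using N.TA_cmp[OF n Mm Nm yN \<alpha>_NE[OF m] \<alpha>_D[OF *(1,3)]] by simp
  finally have mult: "\<alpha> ?m (mmult M ?m ?z) =
      mmult N ?m (TA N ?n (TO N ?m) (compose n (\<alpha> ?m) y) (\<alpha> ?n x))" .
  have ops: "(\<lambda>i\<in>n. monad_op M (reindex M N \<alpha> A) m (y i) g) = (\<lambda>i\<in>n. monad_op N A m (compose n (\<alpha> ?m) y i) g)"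
    using * by (intro restrict_ext) (simp add: op_reindex PiE_mem[OF *(4)] compose_def)
  have in_A: "(\<lambda>i\<in>n. monad_op N A m (compose n (\<alpha> ?m) y i) g) \<in> n \<rightarrow>\<^sub>E pts (und A)"
    using N.model_op[OF A *(2) PiE_mem[OF y'] *(5)] by simp
  show "monad_op M (reindex M N \<alpha> A) n x (\<lambda>i\<in>n. monad_op M (reindex M N \<alpha> A) m (y i) g) =
      monad_op M (reindex M N \<alpha> A) m (mmult M ?m ?z) g"
    unfolding ops op_reindex[OF *(1,3) in_A] op_reindex[OF *(2) M.subst_D[OF *(1-4)] *(5)] mult
    by (rule N.model_mult[OF A *(1,2) \<alpha>_D[OF *(1,3)] y' *(5)])
next
  fix n x x' g assume *: "n \<in> cardinals_below \<kappa>" "x \<in> pts (TO M (D n))"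
    "x' \<in> pts (TO M (D n))" "g \<in> n \<rightarrow>\<^sub>E pts (und A)"
  have "dst (und A) (monad_op N A n (\<alpha> (D n) x) g) (monad_op N A n (\<alpha> (D n) x') g) \<le>
      dst (TO N (D n)) (\<alpha> (D n) x) (\<alpha> (D n) x')"
    by (rule N.model_dst[OF A *(1) \<alpha>_D[OF *(1,2)] \<alpha>_D[OF *(1,3)] *(4)])
  also have "\<dots> \<le> dst (TO M (D n)) x x'"
    by (rule NE_le[OF \<alpha>_NE[OF discrete_obj[OF *(1)]] *(2,3)])
  finally show "dst (und A) (monad_op M (reindex M N \<alpha> A) n x g) (monad_op M (reindex M N \<alpha> A) n x' g) \<le>
      dst (TO M (D n)) x x'"
    using * by (simp add: op_reindex)
qed

lemma reindex_hom:
  assumes h: "h \<in> homomorphisms (monad_signature N) A B"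
  shows "h \<in> homomorphisms (monad_signature M) (reindex M N \<alpha> A) (reindex M N \<alpha> B)"
  unfolding M.homomorphisms_monad_iff
proof (intro conjI ballI; unfold und_reindex)
  show hN: "h \<in> NE (und A) (und B)" using h by (simp add: homomorphisms_def)
  fix n x g assume *: "n \<in> cardinals_below \<kappa>" "x \<in> pts (TO M (D n))" "g \<in> n \<rightarrow>\<^sub>E pts (und A)"
  have "(\<lambda>i\<in>n. h (g i)) \<in> n \<rightarrow>\<^sub>E pts (und B)" using NE_app[OF hN] *(3) by auto
  then show "h (monad_op M (reindex M N \<alpha> A) n x g) = monad_op M (reindex M N \<alpha> B) n x (\<lambda>i\<in>n. h (g i))"
    using * \<alpha>_D h by (simp add: op_reindex N.homomorphisms_monad_iff)
qed

lemma concrete_reindex: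
  "concrete_functor \<mu> (monad_variety N) (monad_variety M) (conc (monad_variety N) (reindex M N \<alpha>))"
  by (rule concrete_functor_conc[OF N.monad_variety_in_varieties])
    (simp_all add: monad_variety_def reindex_model reindex_hom)

end

context ultrametric_monad
begin

lemma reindex_id:
  assumes A: "monad_model M A"
  shows "reindex M M (\<lambda>X\<in>UM. \<lambda>x\<in>pts (TO M X). x) A = A"
proof -
  interpret id: ultrametric_monad_morphism \<kappa> \<mu> M M "\<lambda>X\<in>UM. \<lambda>x\<in>pts (TO M X). x"
    by unfold_locales (rule monad_morphism_id[OF monad])
  show ?thesis
    by (rule algebras_monad_eqI[OF id.reindex_algebra[OF A] model_algebra[OF A]])
      (simp_all add: id.op_reindex discrete_obj)
qed

end

section \<open>Restriction of scalars is functorial, faithful and full\<close>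

context arity_universe
begin

lemma reindex_compose:
  assumes M: "enriched_monad (UMet \<mu>) M" and N: "enriched_monad (UMet \<mu>) N" and P: "enriched_monad (UMet \<mu>) P"
    and \<alpha>: "monad_morphism (UMet \<mu>) M N \<alpha>" and \<beta>: "monad_morphism (UMet \<mu>) N P \<beta>"
    and A: "monad_model P A"
  shows "reindex M P (\<lambda>X\<in>UM. compose (pts (TO M X)) (\<beta> X) (\<alpha> X)) A = reindex M N \<alpha> (reindex N P \<beta> A)"
proof -
  interpret a: ultrametric_monad_morphism \<kappa> \<mu> M N \<alpha> by unfold_locales (rule M N \<alpha>)+
  interpret b: ultrametric_monad_morphism \<kappa> \<mu> N P \<beta> by unfold_locales (rule P \<beta>)+
  interpret ba: ultrametric_monad_morphism \<kappa> \<mu> M P "\<lambda>X\<in>UM. compose (pts (TO M X)) (\<beta> X) (\<alpha> X)"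
    by unfold_locales (rule monad_morphism_compose[OF M N P \<alpha> \<beta>])
  show ?thesis
    by (rule a.M.algebras_monad_eqI[OF ba.reindex_algebra[OF A] a.reindex_algebra[OF b.reindex_model[OF A]]])
      (simp_all add: ba.op_reindex a.op_reindex b.op_reindex a.\<alpha>_D discrete_obj compose_eq)
qed

text \<open>The free algebra on a discrete arity reveals the morphism there, and the cover of
  \<open>M X\<close> by discrete arities determines it everywhere.\<close>

lemma reindex_faithful:
  assumes M: "M \<in> strongly_accessible_monads \<kappa> \<mu>" and N: "N \<in> strongly_accessible_monads \<kappa> \<mu>"
    and \<alpha>: "monad_morphism (UMet \<mu>) M N \<alpha>" and \<beta>: "monad_morphism (UMet \<mu>) M N \<beta>"
    and eq: "\<And>A. monad_model N A \<Longrightarrow> reindex M N \<alpha> A = reindex M N \<beta> A"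
  shows "\<alpha> = \<beta>"
proof -
  interpret M: accessible_monad \<kappa> \<mu> M
    using M by unfold_locales (simp_all add: strongly_accessible_monads_def)
  interpret N: accessible_monad \<kappa> \<mu> N
    using N by unfold_locales (simp_all add: strongly_accessible_monads_def)
  interpret a: ultrametric_monad_morphism \<kappa> \<mu> M N \<alpha> by unfold_locales (rule \<alpha>)
  interpret b: ultrametric_monad_morphism \<kappa> \<mu> M N \<beta> by unfold_locales (rule \<beta>)
  have D: "\<alpha> (D n) x = \<beta> (D n) x" if n: "n \<in> cardinals_below \<kappa>" and x: "x \<in> pts (TO M (D n))" for n x
  proof -
    let ?F = "N.em_model (TO N (D n)) (mmult N (D n))"
    note Dn = discrete_obj[OF n]
    have u: "munit N (D n) \<in> n \<rightarrow>\<^sub>E pts (TO N (D n))"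
      using N.unit_NE[OF Dn] by (simp add: N.TO_obj[OF Dn])
    \<comment> \<open>In the free algebra an element of \<open>N n\<close> is recovered as its own
      operation applied to the generators.\<close>
    have op: "monad_op N ?F n y (munit N (D n)) = y" if "y \<in> pts (TO N (D n))" for y
      using N.op_em_model[OF n that u] N.unit_right[OF Dn that] by simp
    have "monad_op M (reindex M N \<alpha> ?F) n x (munit N (D n)) = monad_op M (reindex M N \<beta> ?F) n x (munit N (D n))"
      using eq[OF N.em_model[OF N.em_algebra_free[OF Dn]]] by simp
    moreover have "munit N (D n) \<in> n \<rightarrow>\<^sub>E pts (und ?F)" using u by simp
    ultimately show ?thesis
      using a.op_reindex[OF n x, of _ ?F] b.op_reindex[OF n x, of _ ?F] op a.\<alpha>_D[OF n x] b.\<alpha>_D[OF n x] by metis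
  qed
  have "\<alpha> X = \<beta> X" if X: "X \<in> UM" for X
    by (rule M.cover_eqI[OF X a.\<alpha>_NE[OF X] b.\<alpha>_NE[OF X]])
      (simp add: a.\<alpha>_nat[OF discrete_obj X] b.\<alpha>_nat[OF discrete_obj X] X D)
  then show ?thesis
    by (rule PiE_ext[OF monad_morphism_PiE[OF \<alpha>] monad_morphism_PiE[OF \<beta>]])
qed

text \<open>The functor \<open>F\<close> preserves homomorphisms without changing the underlying
  maps. Hence every homomorphism of \<open>N\<close>-algebras commutes with the
  \<open>M\<close>-structures produced by \<open>F\<close>; applied to the maps \<open>N f\<close>,
  the multiplication of \<open>N\<close> and the structure map of an algebra, this gives naturality,
  the multiplication law and the agreement with \<open>F\<close>.\<close>

lemma reindex_full:
  assumes M: "M \<in> strongly_accessible_monads \<kappa> \<mu>" and N: "N \<in> strongly_accessible_monads \<kappa> \<mu>"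
    and F: "concrete_functor \<mu> (monad_variety N) (monad_variety M) F"
  obtains \<alpha> where "monad_morphism (UMet \<mu>) M N \<alpha>" "conc (monad_variety N) (reindex M N \<alpha>) = F"
proof -
  interpret M: accessible_monad \<kappa> \<mu> M
    using M by unfold_locales (simp_all add: strongly_accessible_monads_def)
  interpret N: accessible_monad \<kappa> \<mu> N
    using N by unfold_locales (simp_all add: strongly_accessible_monads_def)
  have F_model: "monad_model M (fobj F A)" and F_und [simp]: "und (fobj F A) = und A" if "monad_model N A" for A
    using concrete_obj[OF F, of A] concrete_und[OF F, of A] that by (simp_all add: monad_variety_def)
  have F_hom: "h \<in> homomorphisms (monad_signature M) (fobj F A) (fobj F B)"
    if "monad_model N A" "monad_model N B" "h \<in> homomorphisms (monad_signature N) A B" for A B h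
    using concrete_hom[OF F, of A B h] that by (simp add: monad_variety_def)
  define L where "L X = N.em_model (TO N X) (mmult N X)" for X
  have L: "monad_model N (L X)" and L_und [simp]: "und (L X) = TO N X" if "X \<in> UM" for X
    unfolding L_def by (simp_all add: N.em_model[OF N.em_algebra_free[OF that]])
  \<comment> \<open>The \<open>M\<close>-structure that \<open>F\<close> puts on the free
    \<open>N\<close>-algebra on \<open>X\<close>.\<close>
  define s where "s X = M.structure_map (fobj F (L X))" for X
  have s: "s X \<in> NE (TO M (TO N X)) (TO N X)" if "X \<in> UM" for X
    unfolding s_def using M.structure_NE[OF F_model[OF L[OF that]]] by (simp add: F_und[OF L[OF that]] that)
  have s_unit: "s X (munit M (TO N X) p) = p" if "X \<in> UM" "p \<in> pts (TO N X)" for X p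
    unfolding s_def using M.structure_unit[OF F_model[OF L[OF that(1)]]] by (simp add: F_und[OF L[OF that(1)]] that)
  have s_assoc: "s X (mmult M (TO N X) z) = s X (TA M (TO M (TO N X)) (TO N X) (s X) z)"
    if "X \<in> UM" "z \<in> pts (TO M (TO M (TO N X)))" for X z
    unfolding s_def using M.structure_assoc[OF F_model[OF L[OF that(1)]]] by (simp add: F_und[OF L[OF that(1)]] that)
  \<comment> \<open>The assumption on \<open>h\<close> says that it is a homomorphism from the free
    \<open>N\<close>-algebra on \<open>X\<close> to \<open>A\<close>; then \<open>F\<close> makes it
    one for the \<open>M\<close>-structures.\<close>
  have s_hom: "h (s X z) = M.structure_map (fobj F A) (TA M (TO N X) (und A) h z)"
    if "X \<in> UM" "monad_model N A" "h \<in> NE (TO N X) (und A)" "z \<in> pts (TO M (TO N X))"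
      "\<And>w. w \<in> pts (TO N (TO N X)) \<Longrightarrow> h (mmult N X w) = N.structure_map A (TA N (TO N X) (und A) h w)" for X A h z
  proof -
    have "h \<in> homomorphisms (monad_signature N) (L X) (N.em_model (und A) (N.structure_map A))"
      unfolding L_def
      by (rule N.em_hom[OF N.em_algebra_free[OF that(1)] N.em_algebra_structure[OF that(2)] that(3,5)])
    then have "h \<in> homomorphisms (monad_signature M) (fobj F (L X)) (fobj F A)"
      using F_hom[OF L[OF that(1)] that(2)] by (simp add: N.em_model_structure[OF that(2)])
    from M.structure_hom[OF F_model[OF L[OF that(1)]] F_model[OF that(2)] this] show ?thesis
      using that(4) by (simp add: s_def F_und[OF L[OF that(1)]] F_und[OF that(2)] that(1))
  qed
  have s_hom': "h (s X z) = s Y (TA M (TO N X) (TO N Y) h z)"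
    if "X \<in> UM" "Y \<in> UM" "h \<in> NE (TO N X) (TO N Y)" "z \<in> pts (TO M (TO N X))"
      "\<And>w. w \<in> pts (TO N (TO N X)) \<Longrightarrow> h (mmult N X w) = mmult N Y (TA N (TO N X) (TO N Y) h w)" for X Y h z
    using s_hom[OF that(1) L[OF that(2)] _ that(4), of h] that
    by (simp add: s_def L_def N.structure_em_model N.em_algebra_free)
  define \<alpha> where "\<alpha> = (\<lambda>X\<in>UM. compose (pts (TO M X)) (s X) (TA M X (TO N X) (munit N X)))"
  have u: "TA M X (TO N X) (munit N X) \<in> NE (TO M X) (TO M (TO N X))" if "X \<in> UM" for X
    using that by (intro M.TA_NE N.TO_obj N.unit_NE)
  have \<alpha>_NE: "\<alpha> X \<in> NE (TO M X) (TO N X)" if "X \<in> UM" for X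
    using compose_nonexpanding[OF u[OF that] s[OF that]] that by (simp add: \<alpha>_def)
  have \<alpha>_app: "\<alpha> X z = s X (TA M X (TO N X) (munit N X) z)" if "X \<in> UM" "z \<in> pts (TO M X)" for X z
    using that by (simp add: \<alpha>_def compose_eq)
  have \<alpha>_nat: "\<alpha> Y (TA M X Y f z) = TA N X Y f (\<alpha> X z)"
    if X: "X \<in> UM" and Y: "Y \<in> UM" and f: "f \<in> NE X Y" and z: "z \<in> pts (TO M X)" for X Y f z
  proof -
    note NX = N.TO_obj[OF X] and NY = N.TO_obj[OF Y] and Nf = N.TA_NE[OF X Y f]
    have "TA M Y (TO N Y) (munit N Y) (TA M X Y f z) = TA M X (TO N Y) (compose (pts X) (munit N Y) f) z"
      by (rule M.TA_cmp[OF X Y NY f N.unit_NE[OF Y] z, symmetric])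
    also have "compose (pts X) (munit N Y) f = compose (pts X) (TA N X Y f) (munit N X)"
      by (simp add: compose_eq_iff N.unit_nat[OF X Y f])
    also have "TA M X (TO N Y) \<dots> z = TA M (TO N X) (TO N Y) (TA N X Y f) (TA M X (TO N X) (munit N X) z)"
      by (rule M.TA_cmp[OF X NX NY N.unit_NE[OF X] Nf z])
    finally have "\<alpha> Y (TA M X Y f z) = s Y (TA M (TO N X) (TO N Y) (TA N X Y f) (TA M X (TO N X) (munit N X) z))"
      using NE_app[OF M.TA_NE[OF X Y f] z] Y by (simp add: \<alpha>_app)
    also have "\<dots> = TA N X Y f (s X (TA M X (TO N X) (munit N X) z))"
      by (rule s_hom'[symmetric, OF X Y Nf NE_app[OF u[OF X] z]]) (simp add: N.mult_nat[OF X Y f])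
    finally show ?thesis using X z by (simp add: \<alpha>_app)
  qed
  have morphism: "monad_morphism (UMet \<mu>) M N \<alpha>"
  proof (rule monad_morphismI[OF M.monad N.monad _ \<alpha>_nat])
    show "\<alpha> \<in> (\<Pi>\<^sub>E X\<in>UM. NE (TO M X) (TO N X))"
      using \<alpha>_NE by (auto simp: \<alpha>_def)
  next
    fix X x assume X: "X \<in> UM" and x: "x \<in> pts X"
    have "\<alpha> X (munit M X x) = s X (TA M X (TO N X) (munit N X) (munit M X x))"
      using \<alpha>_app[OF X NE_app[OF M.unit_NE[OF X] x]] .
    also have "TA M X (TO N X) (munit N X) (munit M X x) = munit M (TO N X) (munit N X x)"
      by (rule M.unit_nat[symmetric, OF X N.TO_obj[OF X] N.unit_NE[OF X] x])
    also have "s X \<dots> = munit N X x"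
      by (rule s_unit[OF X NE_app[OF N.unit_NE[OF X] x]])
    finally show "\<alpha> X (munit M X x) = munit N X x" .
  next
    fix X z assume X: "X \<in> UM" and z: "z \<in> pts (TO M (TO M X))"
    note NX = N.TO_obj[OF X] and MX = M.TO_obj[OF X]
    note NNX = N.TO_obj[OF NX] and MNX = M.TO_obj[OF NX]
    \<comment> \<open>Both sides of the multiplication law reduce to \<open>s X w\<close>.\<close>
    define w where "w = TA M (TO M X) (TO N X) (\<alpha> X) z"
    have w: "w \<in> pts (TO M (TO N X))"
      unfolding w_def by (rule NE_app[OF M.TA_NE[OF MX NX \<alpha>_NE[OF X]] z])
    have uz: "TA M (TO M X) (TO M (TO N X)) (TA M X (TO N X) (munit N X)) z \<in> pts (TO M (TO M (TO N X)))"
      by (rule NE_app[OF M.TA_NE[OF MX MNX u[OF X]] z])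
    have "\<alpha> X (mmult M X z) = s X (TA M X (TO N X) (munit N X) (mmult M X z))"
      by (rule \<alpha>_app[OF X NE_app[OF M.mult_NE[OF X] z]])
    also have "TA M X (TO N X) (munit N X) (mmult M X z) =
        mmult M (TO N X) (TA M (TO M X) (TO M (TO N X)) (TA M X (TO N X) (munit N X)) z)"
      by (rule M.mult_nat[symmetric, OF X NX N.unit_NE[OF X] z])
    also have "s X \<dots> = s X (TA M (TO M (TO N X)) (TO N X) (s X)
        (TA M (TO M X) (TO M (TO N X)) (TA M X (TO N X) (munit N X)) z))"
      by (rule s_assoc[OF X uz])
    also have "TA M (TO M (TO N X)) (TO N X) (s X) (TA M (TO M X) (TO M (TO N X)) (TA M X (TO N X) (munit N X)) z) = w"
      unfolding w_def using M.TA_cmp[OF MX MNX NX u[OF X] s[OF X] z] X by (simp add: \<alpha>_def)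
    finally have lhs: "\<alpha> X (mmult M X z) = s X w" .
    \<comment> \<open>The multiplication of \<open>N\<close> is a homomorphism from the free algebra
      on \<open>N X\<close> to the free algebra on \<open>X\<close>.\<close>
    have mu: "mmult N X (s (TO N X) v) = s X (TA M (TO N (TO N X)) (TO N X) (mmult N X) v)"
      if "v \<in> pts (TO M (TO N (TO N X)))" for v
      by (rule s_hom'[OF NX X N.mult_NE[OF X] that]) (rule N.mult_assoc[OF X])
    have uw: "TA M (TO N X) (TO N (TO N X)) (munit N (TO N X)) w \<in> pts (TO M (TO N (TO N X)))"
      by (rule NE_app[OF u[OF NX] w])
    have id: "compose (pts (TO N X)) (mmult N X) (munit N (TO N X)) = (\<lambda>x\<in>pts (TO N X). x)"
      by (simp add: compose_eq_id_iff N.unit_left[OF X])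
    have "mmult N X (TA N (TO M X) (TO N X) (\<alpha> X) (\<alpha> (TO M X) z)) = mmult N X (\<alpha> (TO N X) w)"
      unfolding w_def by (simp add: \<alpha>_nat[OF MX NX \<alpha>_NE[OF X] z])
    also have "\<dots> = s X (TA M (TO N (TO N X)) (TO N X) (mmult N X) (TA M (TO N X) (TO N (TO N X)) (munit N (TO N X)) w))"
      by (simp add: \<alpha>_app[OF NX w] mu[OF uw])
    also have "\<dots> = s X (TA M (TO N X) (TO N X) (\<lambda>x\<in>pts (TO N X). x) w)"
      using M.TA_cmp[OF NX NNX NX N.unit_NE[OF NX] N.mult_NE[OF X] w] by (simp add: id)
    also have "\<dots> = s X w" by (simp only: M.TA_id[OF NX w])
    finally show "\<alpha> X (mmult M X z) = mmult N X (TA N (TO M X) (TO N X) (\<alpha> X) (\<alpha> (TO M X) z))"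
      using lhs by simp
  qed
  interpret a: ultrametric_monad_morphism \<kappa> \<mu> M N \<alpha> by unfold_locales (rule morphism)
  have "reindex M N \<alpha> A = fobj F A" if A: "monad_model N A" for A
  proof (rule M.algebras_monad_eqI[OF a.reindex_algebra[OF A]])
    show "fobj F A \<in> algebras \<mu> (monad_signature M)" by (rule M.model_algebra[OF F_model[OF A]])
    show "und (reindex M N \<alpha> A) = und (fobj F A)" by (simp add: F_und[OF A])
    fix n x g assume n: "n \<in> cardinals_below \<kappa>" and x: "x \<in> pts (TO M (D n))" and "g \<in> n \<rightarrow>\<^sub>E pts (und (reindex M N \<alpha> A))"
    then have g: "g \<in> n \<rightarrow>\<^sub>E pts (und A)" by simp
    let ?X = "und A" and ?b = "N.structure_map A"
    note X = N.model_und[OF A] and Dn = discrete_obj[OF n]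
    note NX = N.TO_obj[OF X] and b = N.structure_NE[OF A]
    have gN: "g \<in> NE (D n) ?X" using g by (simp add: X)
    define v where "v = TA M (D n) ?X g x"
    have v: "v \<in> pts (TO M ?X)" unfolding v_def by (rule M.TA_D[OF X n g x])
    have "monad_op M (reindex M N \<alpha> A) n x g = ?b (TA N (D n) ?X g (\<alpha> (D n) x))"
      by (simp add: a.op_reindex[OF n x g] N.structure_TA[OF A n g a.\<alpha>_D[OF n x]])
    also have "TA N (D n) ?X g (\<alpha> (D n) x) = \<alpha> ?X v"
      unfolding v_def by (rule \<alpha>_nat[symmetric, OF Dn X gN x])
    \<comment> \<open>By associativity the structure map \<open>?b\<close> is a homomorphism from
      the free algebra to \<open>A\<close>, so it passes through \<open>s\<close>; the unit law then
      cancels it.\<close>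
    also have "?b (\<alpha> ?X v) = M.structure_map (fobj F A) (TA M (TO N ?X) ?X ?b (TA M ?X (TO N ?X) (munit N ?X) v))"
      unfolding \<alpha>_app[OF X v] by (rule s_hom[OF X A b NE_app[OF u[OF X] v] N.structure_assoc[OF A]])
    also have "TA M (TO N ?X) ?X ?b (TA M ?X (TO N ?X) (munit N ?X) v) = TA M ?X ?X (compose (pts ?X) ?b (munit N ?X)) v"
      by (rule M.TA_cmp[symmetric, OF X NX X N.unit_NE[OF X] b v])
    also have "compose (pts ?X) ?b (munit N ?X) = (\<lambda>p\<in>pts ?X. p)"
      by (simp add: compose_eq_id_iff N.structure_unit[OF A])
    also have "TA M ?X ?X (\<lambda>p\<in>pts ?X. p) v = v" by (rule M.TA_id[OF X v])
    also have "M.structure_map (fobj F A) v = monad_op M (fobj F A) n x g"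
      using M.structure_TA[OF F_model[OF A] n _ x, of g] g by (simp add: v_def F_und[OF A])
    finally show "monad_op M (reindex M N \<alpha> A) n x g = monad_op M (fobj F A) n x g" .
  qed
  then have "conc (monad_variety N) (reindex M N \<alpha>) = F"
    by (subst concrete_conc[OF F], intro conc_cong) (simp add: monad_variety_def)
  then show thesis using that morphism by blast
qed

end

section \<open>Presentations of algebras\<close>

primrec tsubst :: "'u signature \<Rightarrow> ('u \<Rightarrow> 'u trm) \<Rightarrow> 'u trm \<Rightarrow> 'u trm" where
  "tsubst \<Sigma> f (Var x) = f x"
| "tsubst \<Sigma> f (App \<sigma> ts) = App \<sigma> (\<lambda>i\<in>arity \<Sigma> \<sigma>. tsubst \<Sigma> f (ts i))"

abbreviation "tmap \<Sigma> f \<equiv> tsubst \<Sigma> (\<lambda>x. Var (f x))"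

lemma tsubst_in_terms:
  assumes "t \<in> terms \<Sigma> V" "\<And>x. x \<in> V \<Longrightarrow> f x \<in> terms \<Sigma> W"
  shows "tsubst \<Sigma> f t \<in> terms \<Sigma> W"
  using assms(1) by induction (auto intro: assms(2) terms.App)

lemma tmap_in_terms: "t \<in> terms \<Sigma> V \<Longrightarrow> (\<And>x. x \<in> V \<Longrightarrow> f x \<in> W) \<Longrightarrow> tmap \<Sigma> f t \<in> terms \<Sigma> W"
  by (rule tsubst_in_terms) (auto intro: terms.Var)

lemma tsubst_cong:
  assumes "t \<in> terms \<Sigma> V" "\<And>x. x \<in> V \<Longrightarrow> f x = g x"
  shows "tsubst \<Sigma> f t = tsubst \<Sigma> g t"
  using assms(1) by induction (auto simp: assms(2) cong: restrict_cong)

lemma tsubst_tsubst: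
  assumes "t \<in> terms \<Sigma> V"
  shows "tsubst \<Sigma> g (tsubst \<Sigma> f t) = tsubst \<Sigma> (\<lambda>x. tsubst \<Sigma> g (f x)) t"
  using assms by induction (auto cong: restrict_cong)

lemma tsubst_Var:
  assumes "t \<in> terms \<Sigma> V"
  shows "tsubst \<Sigma> Var t = t"
  using assms by induction (auto simp: restrict_def extensional_def fun_eq_iff)

lemma eval_tsubst:
  assumes "t \<in> terms \<Sigma> V"
  shows "eval \<Sigma> A f (tsubst \<Sigma> g t) = eval \<Sigma> A (\<lambda>x. eval \<Sigma> A f (g x)) t"
  using assms by induction (auto cong: restrict_cong)

lemma terms_mono: "t \<in> terms \<Sigma> V \<Longrightarrow> V \<subseteq> W \<Longrightarrow> t \<in> terms \<Sigma> W"
  by (induction rule: terms.induct) (auto intro: terms.intros)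

lemma algebras_opn:
  assumes "A \<in> algebras \<mu> \<Sigma>" "\<sigma> \<in> syms \<Sigma>" "g \<in> arity \<Sigma> \<sigma> \<rightarrow>\<^sub>E pts (und A)"
  shows "opn A \<sigma> g \<in> pts (und A)"
proof -
  have "opn A \<sigma> \<in> NE (power_space (und A) (arity \<Sigma> \<sigma>)) (und A)" using assms by (auto simp: algebras_def)
  then show ?thesis using assms(3) by (auto simp: power_space_NE_iff)
qed

lemma algebras_opn_dst:
  assumes "A \<in> algebras \<mu> \<Sigma>" "\<sigma> \<in> syms \<Sigma>" "g \<in> arity \<Sigma> \<sigma> \<rightarrow>\<^sub>E pts (und A)" "g' \<in> arity \<Sigma> \<sigma> \<rightarrow>\<^sub>E pts (und A)"
    "\<And>i. i \<in> arity \<Sigma> \<sigma> \<Longrightarrow> dst (und A) (g i) (g' i) \<le> e"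
  shows "dst (und A) (opn A \<sigma> g) (opn A \<sigma> g') \<le> e"
proof -
  have "opn A \<sigma> \<in> NE (power_space (und A) (arity \<Sigma> \<sigma>)) (und A)" using assms by (auto simp: algebras_def)
  then show ?thesis using assms(3-) by (simp add: power_space_NE_iff)
qed

lemma eval_in:
  assumes A: "A \<in> algebras \<mu> \<Sigma>" and t: "t \<in> terms \<Sigma> V" and f: "\<And>x. x \<in> V \<Longrightarrow> f x \<in> pts (und A)"
  shows "eval \<Sigma> A f t \<in> pts (und A)"
  using t by induction (auto simp: f intro: algebras_opn[OF A])

lemma eval_dst:
  assumes A: "A \<in> algebras \<mu> \<Sigma>" and t: "t \<in> terms \<Sigma> V" and f: "\<And>x. x \<in> V \<Longrightarrow> f x \<in> pts (und A)"
    and g: "\<And>x. x \<in> V \<Longrightarrow> g x \<in> pts (und A)" and e: "\<And>x. x \<in> V \<Longrightarrow> dst (und A) (f x) (g x) \<le> e"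
  shows "dst (und A) (eval \<Sigma> A f t) (eval \<Sigma> A g t) \<le> e"
  using t
proof induction
  case (App \<sigma> ts)
  have "(\<lambda>i\<in>arity \<Sigma> \<sigma>. eval \<Sigma> A h (ts i)) \<in> arity \<Sigma> \<sigma> \<rightarrow>\<^sub>E pts (und A)"
    if "\<And>x. x \<in> V \<Longrightarrow> h x \<in> pts (und A)" for h
    using App(3) that by (auto intro: eval_in[OF A])
  from this[of f] this[of g] show ?case
    unfolding eval.simps using App(1,4) f g by (intro algebras_opn_dst[OF A]) simp_all
qed (simp add: e)

lemma hom_eval:
  assumes A: "A \<in> algebras \<mu> \<Sigma>" and h: "h \<in> homomorphisms \<Sigma> A B" and t: "t \<in> terms \<Sigma> V"
    and f: "\<And>x. x \<in> V \<Longrightarrow> f x \<in> pts (und A)"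
  shows "h (eval \<Sigma> A f t) = eval \<Sigma> B (\<lambda>x. h (f x)) t"
  using t
proof induction
  case (App \<sigma> ts)
  have "(\<lambda>i\<in>arity \<Sigma> \<sigma>. eval \<Sigma> A f (ts i)) \<in> arity \<Sigma> \<sigma> \<rightarrow>\<^sub>E pts (und A)"
    using App f by (auto intro: eval_in[OF A])
  then show ?case using h App by (auto simp: homomorphisms_def cong: restrict_cong)
qed simp

section \<open>Models of a theory as quotients of its terms\<close>

locale quantitative_theory = arity_universe \<kappa> \<mu> for \<kappa> \<mu> :: "'u rel" +
  fixes \<Sigma> :: "'u signature" and E
  assumes signature: "is_signature \<kappa> \<mu> \<Sigma>" and equations: "E \<subseteq> quantitative_equations \<kappa> \<Sigma>"
begin

definition models :: "'u algebra set" where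
  "models = {A \<in> algebras \<mu> \<Sigma>. \<forall>e\<in>E. satisfies \<kappa> \<Sigma> A e}"

lemma models_algebra: "A \<in> models \<Longrightarrow> A \<in> algebras \<mu> \<Sigma>"
  by (simp add: models_def)

lemma models_und: "A \<in> models \<Longrightarrow> und A \<in> UM"
  by (simp add: models_def algebras_def)

lemma models_ultra: "A \<in> models \<Longrightarrow> ultrametric_space (und A)"
  by (rule UMet_ultra[OF models_und])

lemma arity_below: "\<sigma> \<in> syms \<Sigma> \<Longrightarrow> arity \<Sigma> \<sigma> \<in> cardinals_below \<kappa>"
  using signature by (auto simp: is_signature_def)

text \<open>These are the ultra-pseudometrics on terms whose quotients are models: the fourth clause
  makes the operations well defined and nonexpanding, the last imposes the equations under every
  substitution.\<close>

definition term_metric :: "'u set \<Rightarrow> ('u trm \<Rightarrow> 'u trm \<Rightarrow> ennreal) \<Rightarrow> bool" where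
  "term_metric X e \<longleftrightarrow>
    (\<forall>s\<in>terms \<Sigma> X. e s s = 0) \<and>
    (\<forall>s\<in>terms \<Sigma> X. \<forall>t\<in>terms \<Sigma> X. e s t = e t s) \<and>
    (\<forall>s\<in>terms \<Sigma> X. \<forall>t\<in>terms \<Sigma> X. \<forall>u\<in>terms \<Sigma> X. e s u \<le> max (e s t) (e t u)) \<and>
    (\<forall>\<sigma>\<in>syms \<Sigma>. \<forall>ts\<in>arity \<Sigma> \<sigma> \<rightarrow>\<^sub>E terms \<Sigma> X. \<forall>us\<in>arity \<Sigma> \<sigma> \<rightarrow>\<^sub>E terms \<Sigma> X. \<forall>c.
      (\<forall>i\<in>arity \<Sigma> \<sigma>. e (ts i) (us i) \<le> c) \<longrightarrow> e (App \<sigma> ts) (App \<sigma> us) \<le> c) \<and>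
    (\<forall>l \<epsilon> r. (l, \<epsilon>, r) \<in> E \<longrightarrow> (\<forall>f\<in>Field \<kappa> \<rightarrow> terms \<Sigma> X. e (tsubst \<Sigma> f l) (tsubst \<Sigma> f r) \<le> ennreal (of_rat \<epsilon>)))"

definition presents :: "'u set \<Rightarrow> ('u trm \<Rightarrow> 'u trm \<Rightarrow> ennreal) \<Rightarrow> 'u algebra \<Rightarrow> ('u trm \<Rightarrow> 'u) \<Rightarrow> bool" where
  "presents X e A c \<longleftrightarrow> A \<in> models \<and> c ` terms \<Sigma> X = pts (und A) \<and>
    (\<forall>s\<in>terms \<Sigma> X. \<forall>t\<in>terms \<Sigma> X. dst (und A) (c s) (c t) = e s t) \<and>
    (\<forall>\<sigma>\<in>syms \<Sigma>. \<forall>ts\<in>arity \<Sigma> \<sigma> \<rightarrow>\<^sub>E terms \<Sigma> X. opn A \<sigma> (\<lambda>i\<in>arity \<Sigma> \<sigma>. c (ts i)) = c (App \<sigma> ts))"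

lemma App_in_terms: "\<sigma> \<in> syms \<Sigma> \<Longrightarrow> ts \<in> arity \<Sigma> \<sigma> \<rightarrow>\<^sub>E terms \<Sigma> X \<Longrightarrow> App \<sigma> ts \<in> terms \<Sigma> X"
  by (intro terms.App) (auto simp: PiE_iff)

lemma eval_quotient:
  assumes c: "\<And>\<sigma> ts. \<sigma> \<in> syms \<Sigma> \<Longrightarrow> ts \<in> arity \<Sigma> \<sigma> \<rightarrow>\<^sub>E terms \<Sigma> X \<Longrightarrow>
      opn A \<sigma> (\<lambda>i\<in>arity \<Sigma> \<sigma>. c (ts i)) = c (App \<sigma> ts)"
    and t: "t \<in> terms \<Sigma> W" and f: "\<And>x. x \<in> W \<Longrightarrow> f x \<in> terms \<Sigma> X"
  shows "eval \<Sigma> A (\<lambda>x. c (f x)) t = c (tsubst \<Sigma> f t)"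
  using t
proof induction
  case (App \<sigma> ts)
  have "(\<lambda>i\<in>arity \<Sigma> \<sigma>. tsubst \<Sigma> f (ts i)) \<in> arity \<Sigma> \<sigma> \<rightarrow>\<^sub>E terms \<Sigma> X"
    using tsubst_in_terms[OF App(3) f] by simp
  from c[OF App(1) this] show ?case using App by (simp cong: restrict_cong)
qed simp

text \<open>The model is the quotient of the terms by distance 0. Its points have to lie in
  \<open>'u\<close>, so a class is named by the code of a chosen representative.\<close>

lemma exists_presentation:
  assumes X: "small X" and e: "term_metric X e"
  shows "\<exists>A c. presents X e A c"
proof -
  have refl: "e s s = 0" if "s \<in> terms \<Sigma> X" for s using e that by (simp add: term_metric_def)
  have sym: "e s t = e t s" if "s \<in> terms \<Sigma> X" "t \<in> terms \<Sigma> X" for s t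
    using e that unfolding term_metric_def by blast
  have tri: "e s u \<le> max (e s t) (e t u)" if "s \<in> terms \<Sigma> X" "t \<in> terms \<Sigma> X" "u \<in> terms \<Sigma> X" for s t u
    using e that by (simp add: term_metric_def)
  have cong: "e (App \<sigma> ts) (App \<sigma> us) \<le> c"
    if "\<sigma> \<in> syms \<Sigma>" "ts \<in> arity \<Sigma> \<sigma> \<rightarrow>\<^sub>E terms \<Sigma> X" "us \<in> arity \<Sigma> \<sigma> \<rightarrow>\<^sub>E terms \<Sigma> X"
      "\<And>i. i \<in> arity \<Sigma> \<sigma> \<Longrightarrow> e (ts i) (us i) \<le> c" for \<sigma> ts us c
    using e that by (simp add: term_metric_def)
  have eqs: "e (tsubst \<Sigma> f l) (tsubst \<Sigma> f r) \<le> ennreal (of_rat \<epsilon>)"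
    if "(l, \<epsilon>, r) \<in> E" "f \<in> Field \<kappa> \<rightarrow> terms \<Sigma> X" for l \<epsilon> r f
    using e that unfolding term_metric_def by blast
  obtain B :: "'u set" and j where j: "bij_betw j (terms \<Sigma> X) B" and B: "small B"
    using small_encoding[OF small_terms[OF signature X]] .
  \<comment> \<open>Equivalent terms satisfy the same predicate, so the choice gives one
    representative for the whole class.\<close>
  define rep where "rep t = (SOME s. s \<in> terms \<Sigma> X \<and> e s t = 0)" for t
  have rep: "rep t \<in> terms \<Sigma> X" "e (rep t) t = 0" if "t \<in> terms \<Sigma> X" for t
    using someI[of "\<lambda>s. s \<in> terms \<Sigma> X \<and> e s t = 0" t] that refl unfolding rep_def by auto
  have zero_trans: "e s u = 0" if "s \<in> terms \<Sigma> X" "t \<in> terms \<Sigma> X" "u \<in> terms \<Sigma> X" "e s t = 0" "e t u = 0" for s t u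
    using tri[OF that(1-3)] that by simp
  have rep_eq: "rep s = rep t \<longleftrightarrow> e s t = 0" if s: "s \<in> terms \<Sigma> X" and t: "t \<in> terms \<Sigma> X" for s t
  proof
    assume "rep s = rep t"
    then show "e s t = 0"
      using zero_trans[OF s rep(1)[OF s] t] rep[OF s] rep[OF t] sym[OF s rep(1)[OF s]] by simp
  next
    assume "e s t = 0"
    then have "u \<in> terms \<Sigma> X \<and> e u s = 0 \<longleftrightarrow> u \<in> terms \<Sigma> X \<and> e u t = 0" for u
      using zero_trans[of u s t] zero_trans[of u t s] s t sym[OF s t] by auto
    then show "rep s = rep t" by (simp add: rep_def)
  qed
  define c where "c t = j (rep t)" for t
  have c_eq: "c s = c t \<longleftrightarrow> e s t = 0" if "s \<in> terms \<Sigma> X" "t \<in> terms \<Sigma> X" for s t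
    using j rep that rep_eq[OF that] unfolding c_def by (metis bij_betw_def inj_on_eq_iff)
  define P where "P = c ` terms \<Sigma> X"
  define \<rho> where "\<rho> = inv_into (terms \<Sigma> X) c"
  have \<rho>: "\<rho> p \<in> terms \<Sigma> X" "c (\<rho> p) = p" if "p \<in> P" for p
    using that by (auto simp: \<rho>_def P_def inv_into_into f_inv_into_f)
  have c_in: "c t \<in> P" if "t \<in> terms \<Sigma> X" for t using that by (simp add: P_def)
  have \<rho>c: "e (\<rho> (c t)) t = 0" if "t \<in> terms \<Sigma> X" for t
    using \<rho>[OF c_in[OF that]] c_eq that by simp
  \<comment> \<open>By the ultrametric inequality on both sides, \<open>e\<close> depends on the
    classes alone.\<close>
  have e_eq: "e s t = e s' t'" if "s \<in> terms \<Sigma> X" "t \<in> terms \<Sigma> X" "s' \<in> terms \<Sigma> X" "t' \<in> terms \<Sigma> X"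
    "e s s' = 0" "e t t' = 0" for s t s' t'
  proof -
    have le: "e s t \<le> e s' t'" if "s \<in> terms \<Sigma> X" "t \<in> terms \<Sigma> X" "s' \<in> terms \<Sigma> X" "t' \<in> terms \<Sigma> X"
      "e s s' = 0" "e t t' = 0" for s t s' t'
    proof -
      have "e s t \<le> max (e s s') (max (e s' t') (e t' t))"
        using tri[OF that(1,3,2)] tri[OF that(3,4,2)] by (meson max.mono order_refl order_trans)
      then show ?thesis using that sym[OF that(2,4)] by simp
    qed
    show ?thesis
      using le[OF that] le[OF that(3,4,1,2)] that sym[OF that(1,3)] sym[OF that(2,4)] by simp
  qed
  define Y where "Y = \<lparr>pts = P, dst = (\<lambda>p q. if p \<in> P \<and> q \<in> P then e (\<rho> p) (\<rho> q) else 0)\<rparr>"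
  have Y_pts [simp]: "pts Y = P" by (simp add: Y_def)
  have Y_dst: "dst Y (c s) (c t) = e s t" if "s \<in> terms \<Sigma> X" "t \<in> terms \<Sigma> X" for s t
    using e_eq[OF \<rho>(1)[OF c_in] \<rho>(1)[OF c_in], of s t s t] \<rho>c that by (simp add: Y_def c_in)
  have c_ex: "\<exists>s\<in>terms \<Sigma> X. p = c s" if "p \<in> P" for p using that by (auto simp: P_def)
  have "ultrametric_space Y"
    unfolding ultrametric_space_def Y_pts
  proof (intro conjI ballI allI impI)
    fix p q assume "p \<in> P" "q \<in> P"
    then obtain s t where "s \<in> terms \<Sigma> X" "p = c s" "t \<in> terms \<Sigma> X" "q = c t" by (auto dest!: c_ex)
    then show "dst Y p q = 0 \<longleftrightarrow> p = q" "dst Y p q = dst Y q p"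
      using sym[of s t] by (simp_all add: Y_dst c_eq)
  next
    fix p q r assume "p \<in> P" "q \<in> P" "r \<in> P"
    then obtain s t u where "s \<in> terms \<Sigma> X" "p = c s" "t \<in> terms \<Sigma> X" "q = c t" "u \<in> terms \<Sigma> X" "r = c u"
      by (auto dest!: c_ex)
    then show "dst Y p r \<le> max (dst Y p q) (dst Y q r)" using tri[of s t u] by (simp add: Y_dst)
  qed (auto simp: Y_def)
  moreover have "P \<subseteq> B" using j rep(1) by (auto simp: P_def c_def bij_betw_def)
  then have "small P" using B by (rule small_subset)
  ultimately have Y: "Y \<in> UM" by (simp add: obj_UMet)
  define A where "A = \<lparr>und = Y, opn = (\<lambda>\<sigma>\<in>syms \<Sigma>. \<lambda>g\<in>arity \<Sigma> \<sigma> \<rightarrow>\<^sub>E P. c (App \<sigma> (\<lambda>i\<in>arity \<Sigma> \<sigma>. \<rho> (g i))))\<rparr>"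
  have und_A [simp]: "und A = Y" by (simp add: A_def)
  have \<rho>_PiE: "(\<lambda>i\<in>arity \<Sigma> \<sigma>. \<rho> (g i)) \<in> arity \<Sigma> \<sigma> \<rightarrow>\<^sub>E terms \<Sigma> X" if "g \<in> arity \<Sigma> \<sigma> \<rightarrow>\<^sub>E P" for \<sigma> g
    using \<rho>(1)[OF PiE_mem[OF that]] by auto
  have opn: "opn A \<sigma> g = c (App \<sigma> (\<lambda>i\<in>arity \<Sigma> \<sigma>. \<rho> (g i)))" if "\<sigma> \<in> syms \<Sigma>" "g \<in> arity \<Sigma> \<sigma> \<rightarrow>\<^sub>E P" for \<sigma> g
    using that by (simp add: A_def)
  have opn_c: "opn A \<sigma> (\<lambda>i\<in>arity \<Sigma> \<sigma>. c (ts i)) = c (App \<sigma> ts)"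
    if \<sigma>: "\<sigma> \<in> syms \<Sigma>" and ts: "ts \<in> arity \<Sigma> \<sigma> \<rightarrow>\<^sub>E terms \<Sigma> X" for \<sigma> ts
  proof -
    let ?g = "\<lambda>i\<in>arity \<Sigma> \<sigma>. c (ts i)"
    have g: "?g \<in> arity \<Sigma> \<sigma> \<rightarrow>\<^sub>E P" using c_in[OF PiE_mem[OF ts]] by auto
    \<comment> \<open>With bound 0 the clause for operations says that they respect the
      classes.\<close>
    have "e (App \<sigma> (\<lambda>i\<in>arity \<Sigma> \<sigma>. \<rho> (?g i))) (App \<sigma> ts) \<le> 0"
      by (rule cong[OF \<sigma> \<rho>_PiE[OF g] ts]) (simp add: \<rho>c PiE_mem[OF ts])
    then show ?thesis
      using opn[OF \<sigma> g] c_eq[OF App_in_terms[OF \<sigma> \<rho>_PiE[OF g]] App_in_terms[OF \<sigma> ts]] by simp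
  qed
  have "opn A \<sigma> \<in> NE (power_space Y (arity \<Sigma> \<sigma>)) Y" if \<sigma>: "\<sigma> \<in> syms \<Sigma>" for \<sigma>
    unfolding power_space_NE_iff
  proof (intro conjI ballI allI impI)
    show "opn A \<sigma> \<in> (arity \<Sigma> \<sigma> \<rightarrow>\<^sub>E pts Y) \<rightarrow>\<^sub>E pts Y"
      using \<sigma> c_in[OF App_in_terms[OF \<sigma> \<rho>_PiE]] by (auto simp: A_def PiE_iff[of _ "PiE _ _"])
    fix g g' d assume g: "g \<in> arity \<Sigma> \<sigma> \<rightarrow>\<^sub>E pts Y" "g' \<in> arity \<Sigma> \<sigma> \<rightarrow>\<^sub>E pts Y"
      and d: "\<forall>i\<in>arity \<Sigma> \<sigma>. dst Y (g i) (g' i) \<le> d"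
    then have g: "g \<in> arity \<Sigma> \<sigma> \<rightarrow>\<^sub>E P" "g' \<in> arity \<Sigma> \<sigma> \<rightarrow>\<^sub>E P" by auto
    have "e (App \<sigma> (\<lambda>i\<in>arity \<Sigma> \<sigma>. \<rho> (g i))) (App \<sigma> (\<lambda>i\<in>arity \<Sigma> \<sigma>. \<rho> (g' i))) \<le> d"
    proof (rule cong[OF \<sigma> \<rho>_PiE[OF g(1)] \<rho>_PiE[OF g(2)]])
      fix i assume i: "i \<in> arity \<Sigma> \<sigma>"
      then show "e ((\<lambda>i\<in>arity \<Sigma> \<sigma>. \<rho> (g i)) i) ((\<lambda>i\<in>arity \<Sigma> \<sigma>. \<rho> (g' i)) i) \<le> d"
        using d PiE_mem[OF g(1) i] PiE_mem[OF g(2) i] by (auto simp: Y_def)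
    qed
    then show "dst Y (opn A \<sigma> g) (opn A \<sigma> g') \<le> d"
      using opn[OF \<sigma> g(1)] opn[OF \<sigma> g(2)] \<sigma> g
        Y_dst[OF App_in_terms[OF \<sigma> \<rho>_PiE[OF g(1)]] App_in_terms[OF \<sigma> \<rho>_PiE[OF g(2)]]] by simp
  qed
  then have alg: "A \<in> algebras \<mu> \<Sigma>"
    unfolding algebras_def using Y by (auto simp: PiE_iff) (simp add: A_def)
  have "satisfies \<kappa> \<Sigma> A (l, \<epsilon>, r)" if E: "(l, \<epsilon>, r) \<in> E" for l \<epsilon> r
    unfolding satisfies_def
  proof clarify
    fix f assume f: "f \<in> Field \<kappa> \<rightarrow> pts (und A)"
    have lr: "l \<in> terms \<Sigma> (Field \<kappa>)" "r \<in> terms \<Sigma> (Field \<kappa>)"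
      using equations E by (auto simp: quantitative_equations_def)
    \<comment> \<open>An assignment into the quotient lifts along \<rho> to a substitution, to which
      the last clause of \<open>term_metric\<close> applies.\<close>
    have \<rho>f: "\<rho> (f x) \<in> terms \<Sigma> X" "c (\<rho> (f x)) = f x" if "x \<in> Field \<kappa>" for x
      using \<rho> f that by (auto simp: Pi_iff)
    have ev: "eval \<Sigma> A f t = c (tsubst \<Sigma> (\<lambda>x. \<rho> (f x)) t)" if t: "t \<in> terms \<Sigma> (Field \<kappa>)" for t
      using eval_quotient[OF opn_c t, where f = "\<lambda>x. \<rho> (f x)"] eval_cong[OF t, of "\<lambda>x. c (\<rho> (f x))" f] \<rho>f by simp
    have "e (tsubst \<Sigma> (\<lambda>x. \<rho> (f x)) l) (tsubst \<Sigma> (\<lambda>x. \<rho> (f x)) r) \<le> ennreal (of_rat \<epsilon>)"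
      using \<rho>f(1) by (intro eqs[OF E]) simp
    then show "dst (und A) (eval \<Sigma> A f l) (eval \<Sigma> A f r) \<le> ennreal (of_rat \<epsilon>)"
      using ev lr \<rho>f(1) by (simp add: Y_dst tsubst_in_terms)
  qed
  then have "A \<in> models" using alg by (auto simp: models_def)
  then have "presents X e A c"
    unfolding presents_def by (simp add: Y_dst opn_c P_def)
  then show ?thesis by blast
qed

definition sup_dist :: "('u algebra \<times> ('u \<Rightarrow> 'u)) set \<Rightarrow> 'u trm \<Rightarrow> 'u trm \<Rightarrow> ennreal" where
  "sup_dist P s t = (SUP (A, f)\<in>P. dst (und A) (eval \<Sigma> A f s) (eval \<Sigma> A f t))"

lemma sup_dist_le_iff:
  "sup_dist P s t \<le> e \<longleftrightarrow> (\<forall>A f. (A, f) \<in> P \<longrightarrow> dst (und A) (eval \<Sigma> A f s) (eval \<Sigma> A f t) \<le> e)"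
  unfolding sup_dist_def by (auto simp: SUP_le_iff)

lemma sup_dist_upper: "(A, f) \<in> P \<Longrightarrow> dst (und A) (eval \<Sigma> A f s) (eval \<Sigma> A f t) \<le> sup_dist P s t"
  using sup_dist_le_iff[of P s t "sup_dist P s t"] by simp

text \<open>Each clause holds for the distance of evaluations in a single model and passes to
  suprema. For the equations, evaluating a substituted term is evaluating the term under the
  composed assignment.\<close>

lemma term_metric_sup_dist:
  assumes P: "\<And>A f. (A, f) \<in> P \<Longrightarrow> A \<in> models \<and> (\<forall>x\<in>X. f x \<in> pts (und A))"
  shows "term_metric X (sup_dist P)"
  unfolding term_metric_def
proof (intro conjI ballI allI impI)
  have ev: "eval \<Sigma> A f t \<in> pts (und A)" if "(A, f) \<in> P" "t \<in> terms \<Sigma> X" for A f t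
    using P[OF that(1)] that(2) by (intro eval_in[OF models_algebra]) auto
  fix s assume s: "s \<in> terms \<Sigma> X"
  have "sup_dist P s s \<le> 0" unfolding sup_dist_le_iff using P by (simp add: ultrametric_refl models_ultra)
  then show "sup_dist P s s = 0" by simp
  fix t assume t: "t \<in> terms \<Sigma> X"
  have "sup_dist P a b \<le> sup_dist P b a" for a b
    unfolding sup_dist_le_iff
  proof (intro allI impI)
    fix A f assume "(A, f) \<in> P"
    then show "dst (und A) (eval \<Sigma> A f a) (eval \<Sigma> A f b) \<le> sup_dist P b a"
      using sup_dist_upper[of A f P b a] ultrametric_sym[OF models_ultra] P by metis
  qed
  then show "sup_dist P s t = sup_dist P t s" by (intro order_antisym)
  fix u assume u: "u \<in> terms \<Sigma> X"
  show "sup_dist P s u \<le> max (sup_dist P s t) (sup_dist P t u)"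
    unfolding sup_dist_le_iff
  proof (intro allI impI)
    fix A f assume Af: "(A, f) \<in> P"
    have "ultrametric_space (und A)" using P[OF Af] models_ultra by blast
    then show "dst (und A) (eval \<Sigma> A f s) (eval \<Sigma> A f u) \<le> max (sup_dist P s t) (sup_dist P t u)"
      by (rule ultrametric_trans[OF _ ev[OF Af s] ev[OF Af t] ev[OF Af u]])
        (simp_all add: le_max_iff_disj sup_dist_upper[OF Af])
  qed
next
  fix \<sigma> ts us c assume *: "\<sigma> \<in> syms \<Sigma>" "ts \<in> arity \<Sigma> \<sigma> \<rightarrow>\<^sub>E terms \<Sigma> X" "us \<in> arity \<Sigma> \<sigma> \<rightarrow>\<^sub>E terms \<Sigma> X"
    "\<forall>i\<in>arity \<Sigma> \<sigma>. sup_dist P (ts i) (us i) \<le> c"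
  show "sup_dist P (App \<sigma> ts) (App \<sigma> us) \<le> c"
    unfolding sup_dist_le_iff
  proof (intro allI impI)
    fix A f assume Af: "(A, f) \<in> P"
    have A: "A \<in> algebras \<mu> \<Sigma>" using P[OF Af] models_algebra by blast
    have ev: "(\<lambda>i\<in>arity \<Sigma> \<sigma>. eval \<Sigma> A f (vs i)) \<in> arity \<Sigma> \<sigma> \<rightarrow>\<^sub>E pts (und A)"
      if "vs \<in> arity \<Sigma> \<sigma> \<rightarrow>\<^sub>E terms \<Sigma> X" for vs
      using P[OF Af] eval_in[OF A PiE_mem[OF that]] by simp
    show "dst (und A) (eval \<Sigma> A f (App \<sigma> ts)) (eval \<Sigma> A f (App \<sigma> us)) \<le> c"
      unfolding eval.simps
      by (rule algebras_opn_dst[OF A *(1) ev[OF *(2)] ev[OF *(3)]])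
        (use *(4) Af in \<open>simp add: sup_dist_le_iff\<close>)
  qed
next
  fix l \<epsilon> r f assume E: "(l, \<epsilon>, r) \<in> E" and f: "f \<in> Field \<kappa> \<rightarrow> terms \<Sigma> X"
  have lr: "l \<in> terms \<Sigma> (Field \<kappa>)" "r \<in> terms \<Sigma> (Field \<kappa>)"
    using equations E by (auto simp: quantitative_equations_def)
  show "sup_dist P (tsubst \<Sigma> f l) (tsubst \<Sigma> f r) \<le> ennreal (of_rat \<epsilon>)"
    unfolding sup_dist_le_iff
  proof (intro allI impI)
    fix A g assume Ag: "(A, g) \<in> P"
    have A: "A \<in> models" and g: "\<And>x. x \<in> X \<Longrightarrow> g x \<in> pts (und A)" using P[OF Ag] by auto
    have "(\<lambda>x. eval \<Sigma> A g (f x)) \<in> Field \<kappa> \<rightarrow> pts (und A)"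
      using f eval_in[OF models_algebra[OF A], of _ X g] g by (auto simp: Pi_iff)
    moreover have "satisfies \<kappa> \<Sigma> A (l, \<epsilon>, r)" using A E by (simp add: models_def)
    ultimately show "dst (und A) (eval \<Sigma> A g (tsubst \<Sigma> f l)) (eval \<Sigma> A g (tsubst \<Sigma> f r)) \<le> ennreal (of_rat \<epsilon>)"
      unfolding satisfies_def eval_tsubst[OF lr(1)] eval_tsubst[OF lr(2)] by simp
  qed
qed

end

section \<open>The monad of a variety\<close>

context quantitative_theory
begin

definition free_dist :: "'u space \<Rightarrow> 'u trm \<Rightarrow> 'u trm \<Rightarrow> ennreal" where
  "free_dist X = sup_dist {(A, f). A \<in> models \<and> f \<in> NE X (und A)}"

definition free :: "'u space \<Rightarrow> 'u algebra \<times> ('u trm \<Rightarrow> 'u)" where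
  "free X = (SOME p. presents (pts X) (free_dist X) (fst p) (snd p))"

definition free_algebra :: "'u space \<Rightarrow> 'u algebra" where "free_algebra X = fst (free X)"

definition term_class :: "'u space \<Rightarrow> 'u trm \<Rightarrow> 'u" where "term_class X = snd (free X)"

lemma free_dist_upper: "A \<in> models \<Longrightarrow> f \<in> NE X (und A) \<Longrightarrow>
    dst (und A) (eval \<Sigma> A f s) (eval \<Sigma> A f t) \<le> free_dist X s t"
  unfolding free_dist_def by (rule sup_dist_upper) simp

lemma free_dist_least: "(\<And>A f. A \<in> models \<Longrightarrow> f \<in> NE X (und A) \<Longrightarrow>
    dst (und A) (eval \<Sigma> A f s) (eval \<Sigma> A f t) \<le> e) \<Longrightarrow> free_dist X s t \<le> e"
  unfolding free_dist_def by (simp add: sup_dist_le_iff)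

lemma presents_free_algebra: 
  assumes "X \<in> UM"
  shows "presents (pts X) (free_dist X) (free_algebra X) (term_class X)"
proof -
  have "term_metric (pts X) (free_dist X)"
    unfolding free_dist_def by (rule term_metric_sup_dist) (auto simp: NE_app)
  then have "\<exists>p. presents (pts X) (free_dist X) (fst p) (snd p)"
    using exists_presentation[of "pts X"] assms by (simp add: obj_UMet)
  then show ?thesis
    unfolding free_algebra_def term_class_def free_def by (rule someI_ex)
qed

lemma
  assumes "X \<in> UM"
  shows free_algebra_models: "free_algebra X \<in> models"
    and class_image: "term_class X ` terms \<Sigma> (pts X) = pts (und (free_algebra X))"
    and class_dst: "s \<in> terms \<Sigma> (pts X) \<Longrightarrow> t \<in> terms \<Sigma> (pts X) \<Longrightarrow>
      dst (und (free_algebra X)) (term_class X s) (term_class X t) = free_dist X s t"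
    and class_App: "\<sigma> \<in> syms \<Sigma> \<Longrightarrow> ts \<in> arity \<Sigma> \<sigma> \<rightarrow>\<^sub>E terms \<Sigma> (pts X) \<Longrightarrow>
      opn (free_algebra X) \<sigma> (\<lambda>i\<in>arity \<Sigma> \<sigma>. term_class X (ts i)) = term_class X (App \<sigma> ts)"
  using presents_free_algebra[OF assms] by (auto simp: presents_def)

lemma free_algebra_und: "X \<in> UM \<Longrightarrow> und (free_algebra X) \<in> UM"
  by (rule models_und[OF free_algebra_models])

lemma class_in: "X \<in> UM \<Longrightarrow> t \<in> terms \<Sigma> (pts X) \<Longrightarrow> term_class X t \<in> pts (und (free_algebra X))"
  using class_image by blast

lemma class_surj:
  assumes "X \<in> UM" "p \<in> pts (und (free_algebra X))"
  obtains t where "t \<in> terms \<Sigma> (pts X)" "p = term_class X t"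
  using assms class_image[OF assms(1)] by blast

lemma eval_class:
  assumes "X \<in> UM" "t \<in> terms \<Sigma> W" "\<And>x. x \<in> W \<Longrightarrow> f x \<in> terms \<Sigma> (pts X)"
  shows "eval \<Sigma> (free_algebra X) (\<lambda>x. term_class X (f x)) t = term_class X (tsubst \<Sigma> f t)"
  by (rule eval_quotient[OF class_App[OF assms(1)] assms(2,3)])

definition ext :: "'u space \<Rightarrow> 'u algebra \<Rightarrow> ('u \<Rightarrow> 'u) \<Rightarrow> 'u \<Rightarrow> 'u" where
  "ext X A f = (\<lambda>p\<in>pts (und (free_algebra X)). eval \<Sigma> A f (inv_into (terms \<Sigma> (pts X)) (term_class X) p))"

text \<open>Terms of the same class are at free distance 0, and the free distance bounds the
  distance of their values in every model; so the term picked by \<open>inv_into\<close> does not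
  matter.\<close>

lemma ext_class:
  assumes X: "X \<in> UM" and A: "A \<in> models" and f: "f \<in> NE X (und A)" and t: "t \<in> terms \<Sigma> (pts X)"
  shows "ext X A f (term_class X t) = eval \<Sigma> A f t"
proof -
  let ?s = "inv_into (terms \<Sigma> (pts X)) (term_class X) (term_class X t)"
  have s: "?s \<in> terms \<Sigma> (pts X)" "term_class X ?s = term_class X t"
    using t by (auto intro: inv_into_into f_inv_into_f)
  have "dst (und A) (eval \<Sigma> A f ?s) (eval \<Sigma> A f t) \<le> free_dist X ?s t"
    by (rule free_dist_upper[OF A f])
  also have "\<dots> = dst (und (free_algebra X)) (term_class X t) (term_class X t)"
    using class_dst[OF X s(1) t] s(2) by simp
  also have "\<dots> = 0" by (rule ultrametric_refl[OF models_ultra[OF free_algebra_models[OF X]]])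
  finally have "eval \<Sigma> A f ?s = eval \<Sigma> A f t"
    using ultrametric_zero[OF models_ultra[OF A]] eval_in[OF models_algebra[OF A] _ NE_app[OF f]] s t by simp
  then show ?thesis using class_in[OF X t] by (simp add: ext_def)
qed

lemma ext_NE:
  assumes X: "X \<in> UM" and A: "A \<in> models" and f: "f \<in> NE X (und A)"
  shows "ext X A f \<in> NE (und (free_algebra X)) (und A)"
proof -
  have "restrict (ext X A f) (pts (und (free_algebra X))) \<in> NE (und (free_algebra X)) (und A)"
  proof (rule restrict_NE)
    fix p assume "p \<in> pts (und (free_algebra X))"
    then obtain s where s: "s \<in> terms \<Sigma> (pts X)" "p = term_class X s" by (rule class_surj[OF X])
    then show "ext X A f p \<in> pts (und A)"
      using ext_class[OF X A f] eval_in[OF models_algebra[OF A] _ NE_app[OF f]] by simp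
    fix q assume "q \<in> pts (und (free_algebra X))"
    then obtain t where t: "t \<in> terms \<Sigma> (pts X)" "q = term_class X t" by (rule class_surj[OF X])
    show "dst (und A) (ext X A f p) (ext X A f q) \<le> dst (und (free_algebra X)) p q"
      using s t free_dist_upper[OF A f] by (simp add: ext_class[OF X A f] class_dst[OF X])
  qed
  then show ?thesis by (simp add: ext_def)
qed

lemma ext_hom:
  assumes X: "X \<in> UM" and A: "A \<in> models" and f: "f \<in> NE X (und A)"
  shows "ext X A f \<in> homomorphisms \<Sigma> (free_algebra X) A"
  unfolding homomorphisms_def
proof (intro CollectI conjI ballI ext_NE[OF assms])
  fix \<sigma> g assume \<sigma>: "\<sigma> \<in> syms \<Sigma>" and g: "g \<in> arity \<Sigma> \<sigma> \<rightarrow>\<^sub>E pts (und (free_algebra X))"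
  have "\<forall>i\<in>arity \<Sigma> \<sigma>. \<exists>t\<in>terms \<Sigma> (pts X). g i = term_class X t"
    using class_surj[OF X PiE_mem[OF g]] by metis
  then obtain u where u: "\<And>i. i \<in> arity \<Sigma> \<sigma> \<Longrightarrow> u i \<in> terms \<Sigma> (pts X) \<and> g i = term_class X (u i)" by metis
  let ?ts = "restrict u (arity \<Sigma> \<sigma>)"
  have ts: "?ts \<in> arity \<Sigma> \<sigma> \<rightarrow>\<^sub>E terms \<Sigma> (pts X)" using u by auto
  have "g = (\<lambda>i\<in>arity \<Sigma> \<sigma>. term_class X (?ts i))"
    using g u by (auto simp: fun_eq_iff PiE_iff extensional_def)
  then have "ext X A f (opn (free_algebra X) \<sigma> g) = eval \<Sigma> A f (App \<sigma> ?ts)"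
    using class_App[OF X \<sigma> ts] ext_class[OF X A f App_in_terms[OF \<sigma> ts]] by simp
  also have "\<dots> = opn A \<sigma> (\<lambda>i\<in>arity \<Sigma> \<sigma>. ext X A f (g i))"
    using u ext_class[OF X A f] by (simp cong: restrict_cong)
  finally show "ext X A f (opn (free_algebra X) \<sigma> g) = opn A \<sigma> (\<lambda>i\<in>arity \<Sigma> \<sigma>. ext X A f (g i))" .
qed

section \<open>Unit, functor and multiplication of the free algebra monad\<close>

definition eta :: "'u space \<Rightarrow> 'u \<Rightarrow> 'u" where "eta X = (\<lambda>x\<in>pts X. term_class X (Var x))"

lemma eta_NE:
  assumes X: "X \<in> UM"
  shows "eta X \<in> NE X (und (free_algebra X))"
  unfolding eta_def
proof (rule restrict_NE)
  fix x y assume x: "x \<in> pts X" and y: "y \<in> pts X"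
  show "term_class X (Var x) \<in> pts (und (free_algebra X))" using x by (intro class_in[OF X] terms.Var)
  have "free_dist X (Var x) (Var y) \<le> dst X x y"
    by (rule free_dist_least) (simp add: NE_le x y)
  then show "dst (und (free_algebra X)) (term_class X (Var x)) (term_class X (Var y)) \<le> dst X x y"
    using x y by (simp add: class_dst[OF X] terms.Var)
qed

definition free_map :: "'u space \<Rightarrow> 'u space \<Rightarrow> ('u \<Rightarrow> 'u) \<Rightarrow> 'u \<Rightarrow> 'u" where
  "free_map X Y f = ext X (free_algebra Y) (compose (pts X) (eta Y) f)"

text \<open>The extension of the identity, that is the counit of the free algebra adjunction at a
  free algebra.\<close>

definition free_mult :: "'u space \<Rightarrow> 'u \<Rightarrow> 'u" where
  "free_mult X = ext (und (free_algebra X)) (free_algebra X) (\<lambda>p\<in>pts (und (free_algebra X)). p)"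

definition free_monad :: "('u space, 'u \<Rightarrow> 'u) monad" where
  "free_monad = \<lparr>mfun = \<lparr>fobj = (\<lambda>X\<in>UM. und (free_algebra X)), farr = (\<lambda>X\<in>UM. \<lambda>Y\<in>UM. \<lambda>f\<in>NE X Y. free_map X Y f)\<rparr>,
    munit = (\<lambda>X\<in>UM. eta X), mmult = (\<lambda>X\<in>UM. free_mult X)\<rparr>"

lemma free_monad_simps:
  "X \<in> UM \<Longrightarrow> TO free_monad X = und (free_algebra X)"
  "X \<in> UM \<Longrightarrow> Y \<in> UM \<Longrightarrow> f \<in> NE X Y \<Longrightarrow> TA free_monad X Y f = free_map X Y f"
  "X \<in> UM \<Longrightarrow> munit free_monad X = eta X"
  "X \<in> UM \<Longrightarrow> mmult free_monad X = free_mult X"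
  by (simp_all add: free_monad_def)

lemma free_map_NE: "X \<in> UM \<Longrightarrow> Y \<in> UM \<Longrightarrow> f \<in> NE X Y \<Longrightarrow> free_map X Y f \<in> NE (und (free_algebra X)) (und (free_algebra Y))"
  unfolding free_map_def by (intro ext_NE free_algebra_models compose_nonexpanding[OF _ eta_NE])

lemma free_map_hom: "X \<in> UM \<Longrightarrow> Y \<in> UM \<Longrightarrow> f \<in> NE X Y \<Longrightarrow> free_map X Y f \<in> homomorphisms \<Sigma> (free_algebra X) (free_algebra Y)"
  unfolding free_map_def by (intro ext_hom free_algebra_models compose_nonexpanding[OF _ eta_NE])

lemma free_map_class:
  assumes X: "X \<in> UM" and Y: "Y \<in> UM" and f: "f \<in> NE X Y" and t: "t \<in> terms \<Sigma> (pts X)"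
  shows "free_map X Y f (term_class X t) = term_class Y (tmap \<Sigma> f t)"
proof -
  have "free_map X Y f (term_class X t) = eval \<Sigma> (free_algebra Y) (compose (pts X) (eta Y) f) t"
    unfolding free_map_def using X t by (intro ext_class free_algebra_models[OF Y] compose_nonexpanding[OF f eta_NE[OF Y]])
  also have "\<dots> = eval \<Sigma> (free_algebra Y) (\<lambda>x. term_class Y (Var (f x))) t"
    by (rule eval_cong[OF t]) (simp add: eta_def compose_eq NE_app[OF f])
  also have "\<dots> = term_class Y (tmap \<Sigma> f t)"
    by (rule eval_class[OF Y t]) (simp add: terms.Var NE_app[OF f])
  finally show ?thesis .
qed

lemma free_mult_NE: "X \<in> UM \<Longrightarrow> free_mult X \<in> NE (und (free_algebra (und (free_algebra X)))) (und (free_algebra X))"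
  unfolding free_mult_def by (intro ext_NE free_algebra_models free_algebra_und id_nonexpanding)

lemma free_mult_hom: "X \<in> UM \<Longrightarrow> free_mult X \<in> homomorphisms \<Sigma> (free_algebra (und (free_algebra X))) (free_algebra X)"
  unfolding free_mult_def by (intro ext_hom free_algebra_models free_algebra_und id_nonexpanding)

lemma free_mult_class:
  assumes X: "X \<in> UM" and t: "t \<in> terms \<Sigma> (pts (und (free_algebra X)))"
  shows "free_mult X (term_class (und (free_algebra X)) t) = eval \<Sigma> (free_algebra X) (\<lambda>p. p) t"
proof -
  have "free_mult X (term_class (und (free_algebra X)) t) = eval \<Sigma> (free_algebra X) (\<lambda>p\<in>pts (und (free_algebra X)). p) t"
    unfolding free_mult_def using X t by (intro ext_class free_algebra_models free_algebra_und id_nonexpanding)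
  also have "\<dots> = eval \<Sigma> (free_algebra X) (\<lambda>p. p) t" by (rule eval_cong[OF t]) simp
  finally show ?thesis .
qed

lemma tmap_NE: "f \<in> NE X Y \<Longrightarrow> t \<in> terms \<Sigma> (pts X) \<Longrightarrow> tmap \<Sigma> f t \<in> terms \<Sigma> (pts Y)"
  by (rule tmap_in_terms) (auto simp: NE_app)

lemma eval_tmap:
  "t \<in> terms \<Sigma> V \<Longrightarrow> eval \<Sigma> A f (tmap \<Sigma> g t) = eval \<Sigma> A (\<lambda>x. f (g x)) t"
  by (simp add: eval_tsubst)

text \<open>Under a test map \<open>h\<close> the two renamed terms are values of the same term at
  assignments within \<open>e\<close>, and evaluation is nonexpanding in the assignment.\<close>

lemma free_map_dst:
  assumes X: "X \<in> UM" and Y: "Y \<in> UM" and f: "f \<in> NE X Y" and g: "g \<in> NE X Y"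
    and e: "\<And>x. x \<in> pts X \<Longrightarrow> dst Y (f x) (g x) \<le> e" and z: "z \<in> pts (und (free_algebra X))"
  shows "dst (und (free_algebra Y)) (free_map X Y f z) (free_map X Y g z) \<le> e"
proof -
  obtain t where t: "t \<in> terms \<Sigma> (pts X)" and z: "z = term_class X t" using z by (rule class_surj[OF X])
  have "free_dist Y (tmap \<Sigma> f t) (tmap \<Sigma> g t) \<le> e"
  proof (rule free_dist_least)
    fix A h assume A: "A \<in> models" and h: "h \<in> NE Y (und A)"
    show "dst (und A) (eval \<Sigma> A h (tmap \<Sigma> f t)) (eval \<Sigma> A h (tmap \<Sigma> g t)) \<le> e"
      unfolding eval_tmap[OF t]
    proof (rule eval_dst[OF models_algebra[OF A] t])
      fix x assume x: "x \<in> pts X"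
      show "h (f x) \<in> pts (und A)" "h (g x) \<in> pts (und A)"
        using NE_app[OF h] NE_app[OF f x] NE_app[OF g x] by auto
      show "dst (und A) (h (f x)) (h (g x)) \<le> e"
        using NE_le[OF h NE_app[OF f x] NE_app[OF g x]] e[OF x] by (rule order_trans)
    qed
  qed
  then show ?thesis
    unfolding z by (simp add: free_map_class X Y f g t class_dst[OF Y] tmap_NE[OF f] tmap_NE[OF g])
qed

lemma free_functor: "enriched_functor (UMet \<mu>) (UMet \<mu>) (mfun free_monad)"
  unfolding enriched_endofunctor_iff
proof (intro conjI ballI allI impI)
  fix X z assume X: "X \<in> UM" and "z \<in> pts (TO free_monad X)"
  then obtain t where t: "t \<in> terms \<Sigma> (pts X)" and z: "z = term_class X t"
    using class_surj[OF X] by (auto simp: free_monad_simps)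
  have "tmap \<Sigma> (\<lambda>x\<in>pts X. x) t = tsubst \<Sigma> Var t" by (rule tsubst_cong[OF t]) simp
  then show "TA free_monad X X (\<lambda>x\<in>pts X. x) z = z"
    unfolding z by (simp add: free_monad_simps X id_nonexpanding free_map_class t tsubst_Var[OF t])
next
  fix X Y Z f g z assume X: "X \<in> UM" and Y: "Y \<in> UM" and Z: "Z \<in> UM" and f: "f \<in> NE X Y" and g: "g \<in> NE Y Z"
    and "z \<in> pts (TO free_monad X)"
  then obtain t where t: "t \<in> terms \<Sigma> (pts X)" and z: "z = term_class X t"
    using class_surj[OF X] by (auto simp: free_monad_simps)
  have "tmap \<Sigma> (compose (pts X) g f) t = tmap \<Sigma> g (tmap \<Sigma> f t)"
    unfolding tsubst_tsubst[OF t] by (rule tsubst_cong[OF t]) (simp add: compose_eq)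
  then show "TA free_monad X Z (compose (pts X) g f) z = TA free_monad Y Z g (TA free_monad X Y f z)"
    unfolding z by (simp add: free_monad_simps X Y Z f g compose_nonexpanding[OF f g] free_map_class t tmap_NE[OF f])
next
  fix X Y f g e z assume "X \<in> UM" "Y \<in> UM" "f \<in> NE X Y" "g \<in> NE X Y"
    "\<forall>x\<in>pts X. dst Y (f x) (g x) \<le> e" "z \<in> pts (TO free_monad X)"
  then show "dst (TO free_monad Y) (TA free_monad X Y f z) (TA free_monad X Y g z) \<le> e"
    by (simp add: free_monad_simps free_map_dst)
qed (auto simp: free_monad_simps free_algebra_und free_map_NE, auto simp: free_monad_def free_algebra_und)

text \<open>On classes of terms the multiplication is evaluation in the free algebra. Since it and
  the maps \<open>free_map\<close> are homomorphisms, \<open>hom_eval\<close> moves them inside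
  evaluations, which proves naturality and associativity.\<close>

lemma enriched_free_monad: "enriched_monad (UMet \<mu>) free_monad"
  unfolding enriched_monad_iff
proof (intro conjI ballI free_functor)
  fix X Y f assume X: "X \<in> UM" and Y: "Y \<in> UM" and f: "f \<in> NE X Y"
  note FX = free_algebra_und[OF X] and FY = free_algebra_und[OF Y]
  { fix x assume x: "x \<in> pts X"
    then show "munit free_monad Y (f x) = TA free_monad X Y f (munit free_monad X x)"
      by (simp add: free_monad_simps X Y f eta_def NE_app[OF f] free_map_class terms.Var)
  }
  fix z assume "z \<in> pts (TO free_monad (TO free_monad X))"
  then obtain t where t: "t \<in> terms \<Sigma> (pts (und (free_algebra X)))" and z: "z = term_class (und (free_algebra X)) t"
    using class_surj[OF FX] by (auto simp: free_monad_simps X FX)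
  note Ff = free_map_NE[OF X Y f]
  have "free_mult Y (free_map (und (free_algebra X)) (und (free_algebra Y)) (free_map X Y f) z) = eval \<Sigma> (free_algebra Y) (free_map X Y f) t"
    unfolding z by (simp add: free_map_class[OF FX FY Ff t] free_mult_class[OF Y tmap_NE[OF Ff t]] eval_tmap[OF t])
  also have "\<dots> = free_map X Y f (eval \<Sigma> (free_algebra X) (\<lambda>p. p) t)"
    by (rule hom_eval[symmetric, OF models_algebra[OF free_algebra_models[OF X]] free_map_hom[OF X Y f] t])
  also have "eval \<Sigma> (free_algebra X) (\<lambda>p. p) t = free_mult X z"
    unfolding z by (rule free_mult_class[symmetric, OF X t])
  finally show "mmult free_monad Y (TA free_monad (TO free_monad X) (TO free_monad Y) (TA free_monad X Y f) z) =
      TA free_monad X Y f (mmult free_monad X z)"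
    by (simp add: free_monad_simps X Y f FX FY Ff)
next
  fix X z assume X: "X \<in> UM" and z: "z \<in> pts (TO free_monad X)"
  note FX = free_algebra_und[OF X]
  have z: "z \<in> pts (und (free_algebra X))" using z by (simp add: free_monad_simps X)
  then show "mmult free_monad X (munit free_monad (TO free_monad X) z) = z"
    by (simp add: free_monad_simps X FX eta_def free_mult_class terms.Var)
  obtain t where t: "t \<in> terms \<Sigma> (pts X)" and z: "z = term_class X t" using z by (rule class_surj[OF X])
  note e = eta_NE[OF X]
  have "free_mult X (free_map X (und (free_algebra X)) (eta X) z) = eval \<Sigma> (free_algebra X) (eta X) t"
    unfolding z by (simp add: free_map_class[OF X FX e t] free_mult_class[OF X tmap_NE[OF e t]] eval_tmap[OF t])
  also have "\<dots> = eval \<Sigma> (free_algebra X) (\<lambda>x. term_class X (Var x)) t"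
    by (rule eval_cong[OF t]) (simp add: eta_def)
  also have "\<dots> = z"
    unfolding z by (subst eval_class[OF X t]) (simp_all add: terms.Var tsubst_Var[OF t])
  finally show "mmult free_monad X (TA free_monad X (TO free_monad X) (munit free_monad X) z) = z"
    by (simp add: free_monad_simps X FX e)
next
  fix X z assume X: "X \<in> UM" and "z \<in> pts (TO free_monad (TO free_monad (TO free_monad X)))"
  note FX = free_algebra_und[OF X] and FFX = free_algebra_und[OF free_algebra_und[OF X]]
  obtain t where t: "t \<in> terms \<Sigma> (pts (und (free_algebra (und (free_algebra X)))))" and z: "z = term_class (und (free_algebra (und (free_algebra X)))) t"
    using \<open>z \<in> _\<close> class_surj[OF FFX] by (auto simp: free_monad_simps X FX FFX)
  note m = free_mult_NE[OF X]
  have "free_mult X (free_mult (und (free_algebra X)) z) = free_mult X (eval \<Sigma> (free_algebra (und (free_algebra X))) (\<lambda>p. p) t)"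
    unfolding z free_mult_class[OF FX t] ..
  also have "\<dots> = eval \<Sigma> (free_algebra X) (free_mult X) t"
    by (rule hom_eval[OF models_algebra[OF free_algebra_models[OF FX]] free_mult_hom[OF X] t])
  also have "\<dots> = free_mult X (free_map (und (free_algebra (und (free_algebra X)))) (und (free_algebra X)) (free_mult X) z)"
    unfolding z by (simp add: free_map_class[OF FFX FX m t] free_mult_class[OF X tmap_NE[OF m t]] eval_tmap[OF t])
  finally show "mmult free_monad X (mmult free_monad (TO free_monad X) z) =
      mmult free_monad X (TA free_monad (TO free_monad (TO free_monad X)) (TO free_monad X) (mmult free_monad X) z)"
    by (simp add: free_monad_simps X FX FFX m)
qed (auto simp: free_monad_simps free_algebra_und eta_NE free_mult_NE, auto simp: free_monad_def)

end

section \<open>Strong accessibility of the free algebra monad\<close>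

context arity_universe
begin

lemma below_arity_Un: "|A| <o \<kappa> \<Longrightarrow> |B| <o \<kappa> \<Longrightarrow> |A \<union> B| <o \<kappa>"
  using below_arity_UN[OF below_arity_finite, of "{True, False}" "\<lambda>b. if b then A else B"]
  by (simp add: Un_commute)

lemma exists_cardinal_indexing:
  assumes S: "|S :: 'u set| <o \<kappa>"
  obtains n q where "n \<in> cardinals_below \<kappa>" "q \<in> n \<rightarrow>\<^sub>E S" "inj_on q n" "q ` n = S"
proof -
  obtain n f where n: "n \<in> cardinals_below \<kappa>" and f: "bij_betw f n S"
    using exists_cardinal_below[OF S] by blast
  show thesis
    by (rule that[OF n, of "restrict f n"]) (use f in \<open>auto simp: bij_betw_def inj_on_def\<close>)
qed

end

section \<open>Supports of terms and collapsing of variables\<close>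

context quantitative_theory
begin

text \<open>A variable needs one element, and regularity of \<kappa> keeps unions over an arity
  below \<kappa>.\<close>

lemma term_support:
  assumes "t \<in> terms \<Sigma> V"
  shows "\<exists>S\<subseteq>V. |S| <o \<kappa> \<and> t \<in> terms \<Sigma> S"
  using assms
proof induction
  case (Var x)
  then show ?case by (intro exI[of _ "{x}"]) (auto intro: terms.Var below_arity_finite)
next
  case (App \<sigma> ts)
  then obtain S where S: "\<And>i. i \<in> arity \<Sigma> \<sigma> \<Longrightarrow> S i \<subseteq> V \<and> |S i| <o \<kappa> \<and> ts i \<in> terms \<Sigma> (S i)" by metis
  show ?case
  proof (intro exI[of _ "\<Union>i\<in>arity \<Sigma> \<sigma>. S i"] conjI)
    show "|\<Union>i\<in>arity \<Sigma> \<sigma>. S i| <o \<kappa>"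
      using S cardinals_belowD(1)[OF arity_below[OF App(1)]] by (intro below_arity_UN) auto
    show "App \<sigma> ts \<in> terms \<Sigma> (\<Union>i\<in>arity \<Sigma> \<sigma>. S i)"
      using App(1,2) S by (intro terms.App) (auto intro: terms_mono)
  qed (use S in auto)
qed

text \<open>The distance of terms over all of \<open>'u\<close> taken as a discrete set of
  variables. The whole type is too large to be an object of \<open>UMet\<close>, so this is not an
  instance of \<open>free_dist\<close>; using all variables at once makes renamings
  unrestricted.\<close>

definition discrete_dist :: "'u trm \<Rightarrow> 'u trm \<Rightarrow> ennreal" where
  "discrete_dist = sup_dist {(A, f). A \<in> models \<and> (\<forall>x. f x \<in> pts (und A))}"

lemma term_metric_discrete: "term_metric UNIV discrete_dist"
  unfolding discrete_dist_def by (rule term_metric_sup_dist) auto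

lemma discrete_dist_upper: "A \<in> models \<Longrightarrow> (\<And>x. f x \<in> pts (und A)) \<Longrightarrow>
    dst (und A) (eval \<Sigma> A f s) (eval \<Sigma> A f t) \<le> discrete_dist s t"
  unfolding discrete_dist_def by (rule sup_dist_upper) simp

text \<open>An evaluation of renamed terms is an evaluation of the original terms under the composed
  assignment, so the supremum runs over fewer values.\<close>

lemma discrete_dist_tmap:
  assumes s: "s \<in> terms \<Sigma> V" and t: "t \<in> terms \<Sigma> W"
  shows "discrete_dist (tmap \<Sigma> f s) (tmap \<Sigma> f t) \<le> discrete_dist s t"
  unfolding discrete_dist_def sup_dist_le_iff
proof (intro allI impI)
  fix A and g :: "'u \<Rightarrow> 'u" assume "(A, g) \<in> {(A, f). A \<in> models \<and> (\<forall>x. f x \<in> pts (und A))}"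
  then have "(A, \<lambda>x. g (f x)) \<in> {(A, f). A \<in> models \<and> (\<forall>x. f x \<in> pts (und A))}" by simp
  from sup_dist_upper[OF this]
  show "dst (und A) (eval \<Sigma> A g (tmap \<Sigma> f s)) (eval \<Sigma> A g (tmap \<Sigma> f t)) \<le>
      sup_dist {(A, f). A \<in> models \<and> (\<forall>x. f x \<in> pts (und A))} s t"
    unfolding eval_tmap[OF s] eval_tmap[OF t] .
qed

text \<open>If \<open>und A\<close> is empty, an evaluation of a term in \<open>A\<close> is a contradiction, so every
  \<open>f : p \<rightarrow> |A|\<close> that matters extends along \<open>q\<close>.\<close>

lemma free_dist_discrete:
  assumes q: "inj_on q p" and u: "u \<in> terms \<Sigma> p" and v: "v \<in> terms \<Sigma> p"
  shows "free_dist (D p) u v \<le> discrete_dist (tmap \<Sigma> q u) (tmap \<Sigma> q v)"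
proof (rule free_dist_least)
  fix A f assume A: "A \<in> models" and f: "f \<in> NE (D p) (und A)"
  have a: "eval \<Sigma> A f u \<in> pts (und A)"
    using NE_app[OF f] by (intro eval_in[OF models_algebra[OF A] u]) simp
  \<comment> \<open>The value of \<open>u\<close> serves as default off the image of
    \<open>q\<close>: it is a point of \<open>A\<close> even when \<open>p\<close> is empty.\<close>
  define f' where "f' y = (if y \<in> q ` p then f (inv_into p q y) else eval \<Sigma> A f u)" for y
  have f': "f' y \<in> pts (und A)" for y
    using NE_app[OF f] a by (auto simp: f'_def inv_into_into)
  have "f' (q i) = f i" if "i \<in> p" for i using that q by (simp add: f'_def)
  then have "eval \<Sigma> A f' (tmap \<Sigma> q w) = eval \<Sigma> A f w" if "w \<in> terms \<Sigma> p" for w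
    unfolding eval_tmap[OF that] by (intro eval_cong[OF that]) simp
  then show "dst (und A) (eval \<Sigma> A f u) (eval \<Sigma> A f v) \<le> discrete_dist (tmap \<Sigma> q u) (tmap \<Sigma> q v)"
    using discrete_dist_upper[of A f' "tmap \<Sigma> q u" "tmap \<Sigma> q v", OF A f'] u v by simp
qed

text \<open>The choice depends on the closed ball around \<open>x\<close> alone, so points with the
  same ball get the same representative.\<close>

definition repr :: "'u space \<Rightarrow> ennreal \<Rightarrow> 'u \<Rightarrow> 'u" where
  "repr X \<delta> x = (SOME y. y \<in> pts X \<and> dst X x y \<le> \<delta>)"

lemma repr:
  assumes X: "ultrametric_space X" and x: "x \<in> pts X"
  shows repr_in: "repr X \<delta> x \<in> pts X" and repr_dst: "dst X x (repr X \<delta> x) \<le> \<delta>"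
  using someI[of "\<lambda>y. y \<in> pts X \<and> dst X x y \<le> \<delta>" x] x ultrametric_refl[OF X] unfolding repr_def by auto

text \<open>By the ultrametric inequality, points within \<delta> have the same closed ball of
  radius \<delta>.\<close>

lemma repr_eq:
  assumes X: "ultrametric_space X" and x: "x \<in> pts X" and y: "y \<in> pts X" and xy: "dst X x y \<le> \<delta>"
  shows "repr X \<delta> x = repr X \<delta> y"
proof -
  have yx: "dst X y x \<le> \<delta>" using xy ultrametric_sym[OF X] by metis
  have "z \<in> pts X \<and> dst X x z \<le> \<delta> \<longleftrightarrow> z \<in> pts X \<and> dst X y z \<le> \<delta>" for z
    using ultrametric_trans[OF X x y _ xy] ultrametric_trans[OF X y x _ yx] by blast
  then show ?thesis by (simp add: repr_def)
qed

text \<open>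
  In an ultrametric space the relation \<open>d \<le> \<delta>\<close> is an equivalence. Two terms are at distance at most
  \<open>\<delta>\<close> in the free algebra once they are so after collapsing the classes of variables of this relation,
  and the least such \<open>\<delta>\<close> is again the distance of a quotient of the terms by a model.
\<close>

lemma free_dist_collapse:
  assumes X: "X \<in> UM" and u: "u \<in> terms \<Sigma> (pts X)" and v: "v \<in> terms \<Sigma> (pts X)"
    and less: "free_dist X u v < c"
  obtains \<delta> where "\<delta> < c" "discrete_dist (tmap \<Sigma> (repr X \<delta>) u) (tmap \<Sigma> (repr X \<delta>) v) \<le> \<delta>"
proof -
  note U = UMet_ultra[OF X]
  have refl: "discrete_dist s s = 0" if "s \<in> terms \<Sigma> UNIV" for s
    using term_metric_discrete that by (simp add: term_metric_def)
  have sym: "discrete_dist s t = discrete_dist t s" if "s \<in> terms \<Sigma> UNIV" "t \<in> terms \<Sigma> UNIV" for s t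
    using term_metric_discrete that unfolding term_metric_def by blast
  have tri: "discrete_dist s w \<le> max (discrete_dist s t) (discrete_dist t w)"
    if "s \<in> terms \<Sigma> UNIV" "t \<in> terms \<Sigma> UNIV" "w \<in> terms \<Sigma> UNIV" for s t w
    using term_metric_discrete that by (simp add: term_metric_def)
  have cong: "discrete_dist (App \<sigma> ts) (App \<sigma> us) \<le> c"
    if "\<sigma> \<in> syms \<Sigma>" "ts \<in> arity \<Sigma> \<sigma> \<rightarrow>\<^sub>E terms \<Sigma> UNIV" "us \<in> arity \<Sigma> \<sigma> \<rightarrow>\<^sub>E terms \<Sigma> UNIV"
      "\<And>i. i \<in> arity \<Sigma> \<sigma> \<Longrightarrow> discrete_dist (ts i) (us i) \<le> c" for \<sigma> ts us c
    using term_metric_discrete that by (simp add: term_metric_def)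
  have eqs: "discrete_dist (tsubst \<Sigma> f l) (tsubst \<Sigma> f r) \<le> ennreal (of_rat \<epsilon>)"
    if "(l, \<epsilon>, r) \<in> E" "f \<in> Field \<kappa> \<rightarrow> terms \<Sigma> UNIV" for l \<epsilon> r f
    using term_metric_discrete that unfolding term_metric_def by blast
  have UNIV: "s \<in> terms \<Sigma> UNIV" if "s \<in> terms \<Sigma> V" for s V using terms_mono[OF that] by blast
  have tm: "tmap \<Sigma> f s \<in> terms \<Sigma> UNIV" if "s \<in> terms \<Sigma> V" for f s V
    using that by (rule tmap_in_terms) simp
  define R where "R \<delta> s t \<longleftrightarrow> discrete_dist (tmap \<Sigma> (repr X \<delta>) s) (tmap \<Sigma> (repr X \<delta>) t) \<le> \<delta>" for \<delta> s t
  have R_mono: "R \<delta>' s t" if R: "R \<delta> s t" and le: "\<delta> \<le> \<delta>'" and s: "s \<in> terms \<Sigma> (pts X)" and t: "t \<in> terms \<Sigma> (pts X)"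
    for \<delta> \<delta>' s t
  proof -
    \<comment> \<open>Collapsing at the larger radius absorbs the earlier collapse at \<delta>, so
      the coarser terms are renamings of the finer ones.\<close>
    have rr: "tmap \<Sigma> (repr X \<delta>') w = tmap \<Sigma> (repr X \<delta>') (tmap \<Sigma> (repr X \<delta>) w)" if w: "w \<in> terms \<Sigma> (pts X)" for w
    proof -
      have "repr X \<delta>' (repr X \<delta> x) = repr X \<delta>' x" if x: "x \<in> pts X" for x
        using repr_eq[OF U x repr_in[OF U x]] order_trans[OF repr_dst[OF U x] le] by simp
      then show ?thesis unfolding tsubst_tsubst[OF w] by (intro tsubst_cong[OF w]) simp
    qed
    have "discrete_dist (tmap \<Sigma> (repr X \<delta>') s) (tmap \<Sigma> (repr X \<delta>') t) \<le>
        discrete_dist (tmap \<Sigma> (repr X \<delta>) s) (tmap \<Sigma> (repr X \<delta>) t)"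
      unfolding rr[OF s] rr[OF t] by (rule discrete_dist_tmap[OF tm[OF s] tm[OF t]])
    also have "\<dots> \<le> \<delta>'" using R le by (simp add: R_def)
    finally show ?thesis by (simp add: R_def)
  qed
  \<comment> \<open>The infimum need not be attained, so a bound on \<open>e\<close> is tested at
    all strictly larger \<delta>, see \<open>e_le\<close>.\<close>
  define e where "e s t = (INF \<delta>\<in>{\<delta>. R \<delta> s t}. \<delta>)" for s t
  have e_less: "e s t < d \<longleftrightarrow> (\<exists>\<delta><d. R \<delta> s t)" for s t d
    unfolding e_def by (auto simp: Inf_less_iff)
  have e_le: "e s t \<le> d \<longleftrightarrow> (\<forall>\<delta>>d. R \<delta> s t)" if s: "s \<in> terms \<Sigma> (pts X)" and t: "t \<in> terms \<Sigma> (pts X)" for s t d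
  proof
    assume "e s t \<le> d"
    then show "\<forall>\<delta>>d. R \<delta> s t"
      using e_less R_mono[OF _ order_less_imp_le s t] by (meson le_less_trans)
  next
    assume R: "\<forall>\<delta>>d. R \<delta> s t"
    show "e s t \<le> d"
    proof (rule ccontr)
      assume "\<not> e s t \<le> d"
      then obtain \<delta> where "d < \<delta>" "\<delta> < e s t" using dense by (metis not_le)
      moreover have "e s t \<le> \<delta>" unfolding e_def using R \<open>d < \<delta>\<close> by (intro INF_lower) simp
      ultimately show False by simp
    qed
  qed
  have "term_metric (pts X) e"
    unfolding term_metric_def
  proof (intro conjI ballI allI impI)
    fix s assume s: "s \<in> terms \<Sigma> (pts X)"
    have "e s s \<le> 0" unfolding e_le[OF s s] by (simp add: R_def refl tm[OF s])
    then show "e s s = 0" by simp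
    fix t assume t: "t \<in> terms \<Sigma> (pts X)"
    have "R \<delta> s t \<longleftrightarrow> R \<delta> t s" for \<delta> unfolding R_def using sym[OF tm[OF s] tm[OF t]] by simp
    then show "e s t = e t s" by (simp add: e_def)
    fix w assume w: "w \<in> terms \<Sigma> (pts X)"
    show "e s w \<le> max (e s t) (e t w)"
      unfolding e_le[OF s w]
    proof (intro allI impI)
      fix \<delta> assume "max (e s t) (e t w) < \<delta>"
      then have "R \<delta> s t" "R \<delta> t w" using e_le[OF s t, of "e s t"] e_le[OF t w, of "e t w"] by auto
      then show "R \<delta> s w"
        unfolding R_def using tri[OF tm[OF s] tm[OF t] tm[OF w]] by (meson max.boundedI order_trans)
    qed
  next
    fix \<sigma> ts us d assume \<sigma>: "\<sigma> \<in> syms \<Sigma>" and ts: "ts \<in> arity \<Sigma> \<sigma> \<rightarrow>\<^sub>E terms \<Sigma> (pts X)"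
      and us: "us \<in> arity \<Sigma> \<sigma> \<rightarrow>\<^sub>E terms \<Sigma> (pts X)" and d: "\<forall>i\<in>arity \<Sigma> \<sigma>. e (ts i) (us i) \<le> d"
    show "e (App \<sigma> ts) (App \<sigma> us) \<le> d"
      unfolding e_le[OF App_in_terms[OF \<sigma> ts] App_in_terms[OF \<sigma> us]]
    proof (intro allI impI)
      fix \<delta> assume "d < \<delta>"
      then have "R \<delta> (ts i) (us i)" if "i \<in> arity \<Sigma> \<sigma>" for i
        using d that e_le[OF PiE_mem[OF ts that] PiE_mem[OF us that], of d] by simp
      \<comment> \<open>At a fixed \<delta> collapsing commutes with operations, so \<open>R\<close>
        inherits this closure from \<open>discrete_dist\<close>.\<close>
      then show "R \<delta> (App \<sigma> ts) (App \<sigma> us)"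
        unfolding R_def tsubst.simps by (intro cong[OF \<sigma>]) (auto intro: tm PiE_mem[OF ts] PiE_mem[OF us])
    qed
  next
    fix l \<epsilon> r f assume E: "(l, \<epsilon>, r) \<in> E" and f: "f \<in> Field \<kappa> \<rightarrow> terms \<Sigma> (pts X)"
    have lr: "l \<in> terms \<Sigma> (Field \<kappa>)" "r \<in> terms \<Sigma> (Field \<kappa>)"
      using equations E by (auto simp: quantitative_equations_def)
    have sub: "tsubst \<Sigma> f w \<in> terms \<Sigma> (pts X)" if "w \<in> terms \<Sigma> (Field \<kappa>)" for w
      using f by (intro tsubst_in_terms[OF that]) auto
    show "e (tsubst \<Sigma> f l) (tsubst \<Sigma> f r) \<le> ennreal (of_rat \<epsilon>)"
      unfolding e_le[OF sub[OF lr(1)] sub[OF lr(2)]]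
    proof (intro allI impI)
      fix \<delta> assume "ennreal (of_rat \<epsilon>) < \<delta>"
      moreover have "(\<lambda>x. tmap \<Sigma> (repr X \<delta>) (f x)) \<in> Field \<kappa> \<rightarrow> terms \<Sigma> UNIV"
        using f tm by auto
      ultimately show "R \<delta> (tsubst \<Sigma> f l) (tsubst \<Sigma> f r)"
        unfolding R_def tsubst_tsubst[OF lr(1)] tsubst_tsubst[OF lr(2)]
        using eqs[OF E] by (meson order_less_imp_le order_trans)
    qed
  qed
  then obtain B k where B: "presents (pts X) e B k"
    using exists_presentation[of "pts X" e] X unfolding obj_UMet by blast
  have Bm: "B \<in> models" and k_in: "\<And>t. t \<in> terms \<Sigma> (pts X) \<Longrightarrow> k t \<in> pts (und B)"
    and k_dst: "\<And>s t. s \<in> terms \<Sigma> (pts X) \<Longrightarrow> t \<in> terms \<Sigma> (pts X) \<Longrightarrow> dst (und B) (k s) (k t) = e s t"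
    and k_App: "\<And>\<sigma> ts. \<sigma> \<in> syms \<Sigma> \<Longrightarrow> ts \<in> arity \<Sigma> \<sigma> \<rightarrow>\<^sub>E terms \<Sigma> (pts X) \<Longrightarrow>
      opn B \<sigma> (\<lambda>i\<in>arity \<Sigma> \<sigma>. k (ts i)) = k (App \<sigma> ts)"
    using B by (auto simp: presents_def)
  \<comment> \<open>The model \<open>B\<close> presented by \<open>e\<close> serves as test algebra
    for \<open>free_dist\<close>: its variables form a nonexpanding image of \<open>X\<close>,
    because points closer than \<delta> have the same representative.\<close>
  let ?f = "\<lambda>x\<in>pts X. k (Var x)"
  have "?f \<in> NE X (und B)"
  proof (rule restrict_NE)
    fix x y assume x: "x \<in> pts X" and y: "y \<in> pts X"
    show "k (Var x) \<in> pts (und B)" using x by (intro k_in terms.Var)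
    have "e (Var x) (Var y) \<le> dst X x y"
      unfolding e_le[OF terms.Var[OF x] terms.Var[OF y]]
    proof (intro allI impI)
      fix \<delta> assume "dst X x y < \<delta>"
      then have "repr X \<delta> x = repr X \<delta> y" using repr_eq[OF U x y] by simp
      then show "R \<delta> (Var x) (Var y)" by (simp add: R_def refl terms.Var)
    qed
    then show "dst (und B) (k (Var x)) (k (Var y)) \<le> dst X x y"
      using k_dst x y by (simp add: terms.Var)
  qed
  moreover have "eval \<Sigma> B ?f t = k t" if t: "t \<in> terms \<Sigma> (pts X)" for t
  proof -
    have "eval \<Sigma> B ?f t = eval \<Sigma> B (\<lambda>x. k (Var x)) t" by (rule eval_cong[OF t]) simp
    also have "\<dots> = k (tsubst \<Sigma> Var t)" by (rule eval_quotient[where X = "pts X", OF k_App t]) (simp_all add: terms.Var)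
    finally show ?thesis by (simp add: tsubst_Var[OF t])
  qed
  ultimately have "e u v \<le> free_dist X u v"
    using free_dist_upper[OF Bm, of ?f X u v] u v by (simp add: k_dst)
  then have "e u v < c" using less by simp
  then show thesis using that unfolding e_less R_def by blast
qed

text \<open>A term uses fewer than \<kappa> variables; enumerating them by a cardinal makes it the
  renaming of a term over that cardinal.\<close>

lemma free_functor_cover:
  assumes X: "X \<in> UM" and y: "y \<in> pts (TO free_monad X)"
  shows "\<exists>n\<in>cardinals_below \<kappa>. \<exists>g\<in>n \<rightarrow>\<^sub>E pts X. \<exists>x\<in>pts (TO free_monad (D n)).
    y = TA free_monad (D n) X g x"
proof -
  obtain t where t: "t \<in> terms \<Sigma> (pts X)" and y: "y = term_class X t"
    using y class_surj[OF X] by (auto simp: free_monad_simps X)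
  obtain S where S: "S \<subseteq> pts X" "|S| <o \<kappa>" "t \<in> terms \<Sigma> S" using term_support[OF t] by blast
  obtain n q where n: "n \<in> cardinals_below \<kappa>" and q: "q \<in> n \<rightarrow>\<^sub>E S" "inj_on q n" "q ` n = S"
    using exists_cardinal_indexing[OF S(2)] .
  note Dn = discrete_obj[OF n]
  have qX: "q \<in> n \<rightarrow>\<^sub>E pts X" using q(1) S(1) by (auto simp: PiE_iff)
  then have qN: "q \<in> NE (D n) X" using X by simp
  have t': "tmap \<Sigma> (inv_into n q) t \<in> terms \<Sigma> n"
    using q(3) by (intro tmap_in_terms[OF S(3)]) (auto simp: inv_into_into)
  have "tmap \<Sigma> q (tmap \<Sigma> (inv_into n q) t) = tsubst \<Sigma> Var t"
    unfolding tsubst_tsubst[OF S(3)] using q(3) by (intro tsubst_cong[OF S(3)]) (simp add: f_inv_into_f)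
  then have "y = TA free_monad (D n) X q (term_class (D n) (tmap \<Sigma> (inv_into n q) t))"
    unfolding y using t' by (simp add: free_monad_simps(2)[OF Dn X qN] free_map_class[OF Dn X qN] tsubst_Var[OF S(3)])
  moreover have "term_class (D n) (tmap \<Sigma> (inv_into n q) t) \<in> pts (TO free_monad (D n))"
    using class_in[OF Dn] t' by (simp add: free_monad_simps(1)[OF Dn])
  ultimately show ?thesis using n qX by blast
qed

text \<open>If the inequality failed, some collapse radius \<delta> would be smaller than the left
  side. Replacing \<open>g\<close> and \<open>h\<close> by tuples of representatives moves the
  values of the cocone by at most \<delta>. The collapsed tuples factor through a common arity,
  where the values are at most \<delta> apart. The ultrametric inequality then bounds the left side
  by \<delta>.\<close>

lemma free_functor_cocone:
  assumes X: "X \<in> UM" and Y: "Y \<in> UM" and \<theta>: "cocone (mfun free_monad) X Y \<theta>"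
    and n: "n \<in> cardinals_below \<kappa>" and g: "g \<in> n \<rightarrow>\<^sub>E pts X" and x: "x \<in> pts (TO free_monad (D n))"
    and m: "m \<in> cardinals_below \<kappa>" and h: "h \<in> m \<rightarrow>\<^sub>E pts X" and y: "y \<in> pts (TO free_monad (D m))"
  shows "dst Y (\<theta> n g x) (\<theta> m h y) \<le> dst (TO free_monad X) (TA free_monad (D n) X g x) (TA free_monad (D m) X h y)"
proof (rule ccontr)
  note U = UMet_ultra[OF X] and Dn = discrete_obj[OF n] and Dm = discrete_obj[OF m]
  have gN: "g \<in> NE (D n) X" and hN: "h \<in> NE (D m) X" using g h X by simp_all
  obtain s where s: "s \<in> terms \<Sigma> n" and xs: "x = term_class (D n) s"
    using x class_surj[OF Dn] by (auto simp: free_monad_simps Dn)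
  obtain t where t: "t \<in> terms \<Sigma> m" and yt: "y = term_class (D m) t"
    using y class_surj[OF Dm] by (auto simp: free_monad_simps Dm)
  have gs: "tmap \<Sigma> g s \<in> terms \<Sigma> (pts X)" and ht: "tmap \<Sigma> h t \<in> terms \<Sigma> (pts X)"
    using tmap_NE[OF gN] tmap_NE[OF hN] s t by simp_all
  have "dst (TO free_monad X) (TA free_monad (D n) X g x) (TA free_monad (D m) X h y) =
      free_dist X (tmap \<Sigma> g s) (tmap \<Sigma> h t)"
    unfolding xs yt using s t gs ht
    by (simp add: free_monad_simps(1)[OF X] free_monad_simps(2)[OF Dn X gN] free_monad_simps(2)[OF Dm X hN]
        free_map_class[OF Dn X gN] free_map_class[OF Dm X hN] class_dst[OF X])
  moreover assume "\<not> dst Y (\<theta> n g x) (\<theta> m h y) \<le>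
    dst (TO free_monad X) (TA free_monad (D n) X g x) (TA free_monad (D m) X h y)"
  ultimately have "free_dist X (tmap \<Sigma> g s) (tmap \<Sigma> h t) < dst Y (\<theta> n g x) (\<theta> m h y)" by simp
  then obtain \<delta> where \<delta>: "\<delta> < dst Y (\<theta> n g x) (\<theta> m h y)"
    "discrete_dist (tmap \<Sigma> (repr X \<delta>) (tmap \<Sigma> g s)) (tmap \<Sigma> (repr X \<delta>) (tmap \<Sigma> h t)) \<le> \<delta>"
    using free_dist_collapse[OF X gs ht] by blast
  define g' where "g' = (\<lambda>i\<in>n. repr X \<delta> (g i))"
  define h' where "h' = (\<lambda>i\<in>m. repr X \<delta> (h i))"
  have g': "g' \<in> n \<rightarrow>\<^sub>E pts X" and h': "h' \<in> m \<rightarrow>\<^sub>E pts X"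
    using repr_in[OF U PiE_mem[OF g]] repr_in[OF U PiE_mem[OF h]] by (auto simp: g'_def h'_def)
  have "|g' ` n \<union> h' ` m| <o \<kappa>"
    using n m by (intro below_arity_Un below_arity_image cardinals_belowD(1))
  \<comment> \<open>An enumeration \<open>q\<close> of all representatives in use gives one arity
    through which both collapsed tuples factor.\<close>
  then obtain p q where p: "p \<in> cardinals_below \<kappa>" and q: "q \<in> p \<rightarrow>\<^sub>E g' ` n \<union> h' ` m" "inj_on q p"
    "q ` p = g' ` n \<union> h' ` m" by (rule exists_cardinal_indexing)
  note Dp = discrete_obj[OF p]
  have qX: "q \<in> p \<rightarrow>\<^sub>E pts X"
    using q(1) PiE_mem[OF g'] PiE_mem[OF h'] by (fastforce simp: PiE_iff)
  have factor: "\<theta> k f (term_class (D k) w) = \<theta> p q (term_class (D p) (tmap \<Sigma> (inv_into p q) (tmap \<Sigma> f w)))"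
      "term_class (D p) (tmap \<Sigma> (inv_into p q) (tmap \<Sigma> f w)) \<in> pts (TO free_monad (D p))"
      "tmap \<Sigma> (inv_into p q) (tmap \<Sigma> f w) \<in> terms \<Sigma> p"
      "tmap \<Sigma> q (tmap \<Sigma> (inv_into p q) (tmap \<Sigma> f w)) = tmap \<Sigma> f w"
    if k: "k \<in> cardinals_below \<kappa>" and f: "f \<in> k \<rightarrow>\<^sub>E pts X" "f ` k \<subseteq> q ` p" and w: "w \<in> terms \<Sigma> k" for k f w
  proof -
    \<comment> \<open>The tuple \<open>f\<close> in the coordinates of \<open>q\<close>; naturality
      of the cocone along it moves the term to arity \<open>p\<close>.\<close>
    let ?f1 = "\<lambda>i\<in>k. inv_into p q (f i)"
    have f1: "?f1 \<in> k \<rightarrow>\<^sub>E p" using f(2) by (auto simp: inv_into_into)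
    then have f1N: "?f1 \<in> NE (D k) (D p)" by (simp only: NE_D_D)
    have f_eq: "compose k q ?f1 = f"
      using f by (auto simp: compose_def fun_eq_iff PiE_iff extensional_def f_inv_into_f)
    have eq: "tmap \<Sigma> ?f1 w = tmap \<Sigma> (inv_into p q) (tmap \<Sigma> f w)"
      unfolding tsubst_tsubst[OF w] by (rule tsubst_cong[OF w]) simp
    have w': "term_class (D k) w \<in> pts (TO free_monad (D k))"
      using class_in[OF discrete_obj[OF k]] w by (simp add: free_monad_simps(1)[OF discrete_obj[OF k]])
    have "\<theta> k (compose k q ?f1) (term_class (D k) w) = \<theta> p q (TA free_monad (D k) (D p) ?f1 (term_class (D k) w))"
      by (rule cocone_natural[OF \<theta> k p f1 qX w'])
    also have "TA free_monad (D k) (D p) ?f1 (term_class (D k) w) = term_class (D p) (tmap \<Sigma> ?f1 w)"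
      using w by (simp only: free_monad_simps(2)[OF discrete_obj[OF k] Dp f1N])
        (rule free_map_class[OF discrete_obj[OF k] Dp f1N], simp)
    finally show "\<theta> k f (term_class (D k) w) = \<theta> p q (term_class (D p) (tmap \<Sigma> (inv_into p q) (tmap \<Sigma> f w)))"
      unfolding f_eq eq .
    show in_p: "tmap \<Sigma> (inv_into p q) (tmap \<Sigma> f w) \<in> terms \<Sigma> p"
      unfolding eq[symmetric] using f1 by (intro tmap_in_terms[OF w]) auto
    then show "term_class (D p) (tmap \<Sigma> (inv_into p q) (tmap \<Sigma> f w)) \<in> pts (TO free_monad (D p))"
      using class_in[OF Dp] by (simp add: free_monad_simps(1)[OF Dp])
    show "tmap \<Sigma> q (tmap \<Sigma> (inv_into p q) (tmap \<Sigma> f w)) = tmap \<Sigma> f w"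
      unfolding eq[symmetric] unfolding tsubst_tsubst[OF w]
      using f(2) by (intro tsubst_cong[OF w]) (auto simp: f_inv_into_f)
  qed
  note fg = factor[OF n g' _ s] and fh = factor[OF m h' _ t]
  have sub: "g' ` n \<subseteq> q ` p" "h' ` m \<subseteq> q ` p" using q(3) by auto
  let ?s = "tmap \<Sigma> (inv_into p q) (tmap \<Sigma> g' s)" and ?t = "tmap \<Sigma> (inv_into p q) (tmap \<Sigma> h' t)"
  have "dst Y (\<theta> p q (term_class (D p) ?s)) (\<theta> p q (term_class (D p) ?t)) \<le> dst (TO free_monad (D p)) (term_class (D p) ?s) (term_class (D p) ?t)"
    by (rule NE_le[OF cocone_NE[OF \<theta> p qX] fg(2)[OF sub(1)] fh(2)[OF sub(2)]])
  also have "\<dots> = free_dist (D p) ?s ?t"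
    using class_dst[OF Dp] fg(3)[OF sub(1)] fh(3)[OF sub(2)] by (simp add: free_monad_simps(1)[OF Dp])
  \<comment> \<open>Injectivity of \<open>q\<close> lets assignments on \<open>p\<close> extend to
    all variables.\<close>
  also have "\<dots> \<le> discrete_dist (tmap \<Sigma> g' s) (tmap \<Sigma> h' t)"
    using free_dist_discrete[OF q(2) fg(3)[OF sub(1)] fh(3)[OF sub(2)]]
    unfolding fg(4)[OF sub(1)] fh(4)[OF sub(2)] .
  also have "\<dots> \<le> \<delta>"
  proof -
    have "tmap \<Sigma> g' s = tmap \<Sigma> (repr X \<delta>) (tmap \<Sigma> g s)"
      unfolding tsubst_tsubst[OF s] by (rule tsubst_cong[OF s]) (simp add: g'_def)
    moreover have "tmap \<Sigma> h' t = tmap \<Sigma> (repr X \<delta>) (tmap \<Sigma> h t)"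
      unfolding tsubst_tsubst[OF t] by (rule tsubst_cong[OF t]) (simp add: h'_def)
    ultimately show ?thesis using \<delta>(2) by simp
  qed
  finally have mid: "dst Y (\<theta> n g' x) (\<theta> m h' y) \<le> \<delta>"
    unfolding xs yt fg(1)[OF sub(1)] fh(1)[OF sub(2)] .
  have left: "dst Y (\<theta> n g x) (\<theta> n g' x) \<le> \<delta>"
    by (rule cocone_dst[OF \<theta> n g g' _ x]) (simp add: g'_def repr_dst[OF U PiE_mem[OF g]])
  have "dst Y (\<theta> m h y) (\<theta> m h' y) \<le> \<delta>"
    by (rule cocone_dst[OF \<theta> m h h' _ y]) (simp add: h'_def repr_dst[OF U PiE_mem[OF h]])
  then have right: "dst Y (\<theta> m h' y) (\<theta> m h y) \<le> \<delta>"
    using ultrametric_sym[OF UMet_ultra[OF Y]] by metis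
  note in_Y = NE_app[OF cocone_NE[OF \<theta> n g] x] NE_app[OF cocone_NE[OF \<theta> n g'] x]
    NE_app[OF cocone_NE[OF \<theta> m h] y] NE_app[OF cocone_NE[OF \<theta> m h'] y]
  \<comment> \<open>Three distances of at most \<delta> combine to at most \<delta>.\<close>
  have "dst Y (\<theta> n g x) (\<theta> m h y) \<le> \<delta>"
    using ultrametric_trans[OF UMet_ultra[OF Y] in_Y(1,2,3) left
        ultrametric_trans[OF UMet_ultra[OF Y] in_Y(2,4,3) mid right]] .
  then show False using \<delta>(1) by simp
qed

lemma accessible_free_monad: "strongly_accessible_functor \<kappa> \<mu> (mfun free_monad)"
  by (rule strongly_accessibleI[OF free_functor free_functor_cover free_functor_cocone])

end

section \<open>The equivalence\<close>

context quantitative_theory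
begin

lemma free_monad_strongly_accessible: "free_monad \<in> strongly_accessible_monads \<kappa> \<mu>"
  by (simp add: strongly_accessible_monads_def enriched_free_monad accessible_free_monad)

sublocale T: accessible_monad \<kappa> \<mu> free_monad
  by unfold_locales (rule enriched_free_monad accessible_free_monad)+

section \<open>Algebras of a theory are the models of its free algebra monad\<close>

definition counit :: "'u algebra \<Rightarrow> 'u \<Rightarrow> 'u" where
  "counit A = ext (und A) A (\<lambda>x\<in>pts (und A). x)"

lemma counit_NE: "A \<in> models \<Longrightarrow> counit A \<in> NE (und (free_algebra (und A))) (und A)"
  unfolding counit_def by (intro ext_NE models_und id_nonexpanding)

lemma counit_class:
  assumes A: "A \<in> models" and t: "t \<in> terms \<Sigma> (pts (und A))"
  shows "counit A (term_class (und A) t) = eval \<Sigma> A (\<lambda>x. x) t"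
proof -
  have "counit A (term_class (und A) t) = eval \<Sigma> A (\<lambda>x\<in>pts (und A). x) t"
    unfolding counit_def by (rule ext_class[OF models_und[OF A] A id_nonexpanding t])
  also have "\<dots> = eval \<Sigma> A (\<lambda>x. x) t" by (rule eval_cong[OF t]) simp
  finally show ?thesis .
qed

text \<open>The counit is a homomorphism and hence commutes with evaluation; at terms over the free
  algebra this is associativity.\<close>

lemma em_algebra_counit:
  assumes A: "A \<in> models"
  shows "T.em_algebra (und A) (counit A)"
proof -
  note X = models_und[OF A] and k = counit_NE[OF A]
  note FX = free_algebra_und[OF X]
  have "counit A (free_mult (und A) z) = counit A (free_map (und (free_algebra (und A))) (und A) (counit A) z)"
    if "z \<in> pts (und (free_algebra (und (free_algebra (und A)))))" for z
  proof -
    obtain t where t: "t \<in> terms \<Sigma> (pts (und (free_algebra (und A))))" and z: "z = term_class (und (free_algebra (und A))) t"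
      using \<open>z \<in> _\<close> by (rule class_surj[OF FX])
    have "counit A \<in> homomorphisms \<Sigma> (free_algebra (und A)) A"
      unfolding counit_def by (rule ext_hom[OF X A id_nonexpanding])
    then have "counit A (eval \<Sigma> (free_algebra (und A)) (\<lambda>p. p) t) = eval \<Sigma> A (counit A) t"
      using t by (intro hom_eval[OF models_algebra[OF free_algebra_models[OF X]]])
    then show ?thesis
      unfolding z free_mult_class[OF X t] free_map_class[OF FX X k t] counit_class[OF A tmap_NE[OF k t]] eval_tmap[OF t] .
  qed
  then show ?thesis
    unfolding T.em_algebra_def using X FX k
    by (simp add: free_monad_simps eta_def counit_class[OF A] terms.Var)
qed

lemma counit_hom:
  assumes A: "A \<in> models" and B: "B \<in> models" and h: "h \<in> homomorphisms \<Sigma> A B"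
  shows "h \<in> homomorphisms (monad_signature free_monad) (T.em_model (und A) (counit A)) (T.em_model (und B) (counit B))"
proof (rule T.em_hom[OF em_algebra_counit[OF A] em_algebra_counit[OF B]])
  note X = models_und[OF A] and Y = models_und[OF B]
  show hN: "h \<in> NE (und A) (und B)" using h by (simp add: homomorphisms_def)
  fix z assume "z \<in> pts (TO free_monad (und A))"
  then obtain t where t: "t \<in> terms \<Sigma> (pts (und A))" and z: "z = term_class (und A) t"
    using class_surj[OF X] by (auto simp: free_monad_simps X)
  have "h (eval \<Sigma> A (\<lambda>x. x) t) = eval \<Sigma> B h t"
    by (rule hom_eval[OF models_algebra[OF A] h t])
  then show "h (counit A z) = counit B (TA free_monad (und A) (und B) h z)"
    unfolding z free_monad_simps(2)[OF X Y hN]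
    by (simp add: counit_class[OF A t] free_map_class[OF X Y hN t] counit_class[OF B tmap_NE[OF hN t]] eval_tmap[OF t])
qed

text \<open>An operation is recovered from its generic application: the symbol applied to variables
  that are named by the arguments.\<close>

definition of_monad_model :: "'u algebra \<Rightarrow> 'u algebra" where
  "of_monad_model B = \<lparr>und = und B, opn = (\<lambda>\<sigma>\<in>syms \<Sigma>. \<lambda>g\<in>arity \<Sigma> \<sigma> \<rightarrow>\<^sub>E pts (und B).
    T.structure_map B (term_class (und B) (App \<sigma> (\<lambda>i\<in>arity \<Sigma> \<sigma>. Var (g i)))))\<rparr>"

lemma und_of_monad_model [simp]: "und (of_monad_model B) = und B"
  by (simp add: of_monad_model_def)

lemma opn_of_monad_model:
  "\<sigma> \<in> syms \<Sigma> \<Longrightarrow> g \<in> arity \<Sigma> \<sigma> \<rightarrow>\<^sub>E pts (und B) \<Longrightarrow>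
    opn (of_monad_model B) \<sigma> g = T.structure_map B (term_class (und B) (App \<sigma> (\<lambda>i\<in>arity \<Sigma> \<sigma>. Var (g i))))"
  by (simp add: of_monad_model_def)

lemma App_Var_in_terms:
  "\<sigma> \<in> syms \<Sigma> \<Longrightarrow> g \<in> arity \<Sigma> \<sigma> \<rightarrow>\<^sub>E V \<Longrightarrow> App \<sigma> (\<lambda>i\<in>arity \<Sigma> \<sigma>. Var (g i)) \<in> terms \<Sigma> V"
  by (intro App_in_terms) (auto intro: terms.Var)

lemma structure_free_NE: "monad_model free_monad B \<Longrightarrow> T.structure_map B \<in> NE (und (free_algebra (und B))) (und B)"
  using T.structure_NE T.model_und by (simp add: free_monad_simps)

text \<open>For a compound term, apply associativity of the structure map to the top symbol over the
  classes of the subterms: multiplying gives the class of the whole term, mapping by the structure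
  map gives the operation on the values of the subterms.\<close>

lemma eval_of_monad_model:
  assumes B: "monad_model free_monad B" and t: "t \<in> terms \<Sigma> (pts (und B))"
  shows "eval \<Sigma> (of_monad_model B) (\<lambda>x. x) t = T.structure_map B (term_class (und B) t)"
  using t
proof induction
  case (Var x)
  then show ?case
    using T.structure_unit[OF B] T.model_und[OF B] by (simp add: free_monad_simps eta_def)
next
  case (App \<sigma> ts)
  note X = T.model_und[OF B] and b = structure_free_NE[OF B]
  note FX = free_algebra_und[OF X]
  have ts: "ts \<in> arity \<Sigma> \<sigma> \<rightarrow>\<^sub>E terms \<Sigma> (pts (und B))" using App by (simp add: PiE_iff)
  let ?p = "\<lambda>i\<in>arity \<Sigma> \<sigma>. term_class (und B) (ts i)"
  let ?t = "App \<sigma> (\<lambda>i\<in>arity \<Sigma> \<sigma>. Var (?p i))"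
  let ?z = "term_class (und (free_algebra (und B))) ?t"
  have p: "?p \<in> arity \<Sigma> \<sigma> \<rightarrow>\<^sub>E pts (und (free_algebra (und B)))" using class_in[OF X PiE_mem[OF ts]] by auto
  note t = App_Var_in_terms[OF App(1) p]
  have g: "(\<lambda>i\<in>arity \<Sigma> \<sigma>. T.structure_map B (?p i)) \<in> arity \<Sigma> \<sigma> \<rightarrow>\<^sub>E pts (und B)"
    using NE_app[OF b PiE_mem[OF p]] by auto
  have "T.structure_map B (free_mult (und B) ?z) = T.structure_map B (free_map (und (free_algebra (und B))) (und B) (T.structure_map B) ?z)"
    using T.structure_assoc[OF B, of ?z] class_in[OF FX t] by (simp add: free_monad_simps X FX b)
  moreover have "free_mult (und B) ?z = term_class (und B) (App \<sigma> ts)"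
    unfolding free_mult_class[OF X t] using class_App[OF X App(1) ts] by (simp cong: restrict_cong)
  moreover have "free_map (und (free_algebra (und B))) (und B) (T.structure_map B) ?z =
      term_class (und B) (App \<sigma> (\<lambda>i\<in>arity \<Sigma> \<sigma>. Var (T.structure_map B (?p i))))"
    unfolding free_map_class[OF FX X b t] by (simp cong: restrict_cong)
  ultimately have "T.structure_map B (term_class (und B) (App \<sigma> ts)) =
      T.structure_map B (term_class (und B) (App \<sigma> (\<lambda>i\<in>arity \<Sigma> \<sigma>. Var (T.structure_map B (?p i)))))" by simp
  also have "\<dots> = opn (of_monad_model B) \<sigma> (\<lambda>i\<in>arity \<Sigma> \<sigma>. T.structure_map B (?p i))"
    using opn_of_monad_model[OF App(1) g] by (simp cong: restrict_cong)
  also have "\<dots> = eval \<Sigma> (of_monad_model B) (\<lambda>x. x) (App \<sigma> ts)"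
    using App(4) by (simp cong: restrict_cong)
  finally show ?case by simp
qed

text \<open>The structure map is nonexpanding on the free algebra over \<open>und B\<close>, so
  every bound that holds for \<open>free_dist\<close>, and thus in all models, is inherited by
  \<open>B\<close>. Both nonexpansion of the operations and the equations are such bounds.\<close>

lemma of_monad_model_models:
  assumes B: "monad_model free_monad B"
  shows "of_monad_model B \<in> models"
proof -
  note X = T.model_und[OF B] and b = structure_free_NE[OF B]
  have structure_dst: "dst (und B) (T.structure_map B (term_class (und B) s)) (T.structure_map B (term_class (und B) t)) \<le> free_dist (und B) s t"
    if "s \<in> terms \<Sigma> (pts (und B))" "t \<in> terms \<Sigma> (pts (und B))" for s t
    using NE_le[OF b class_in[OF X that(1)] class_in[OF X that(2)]] class_dst[OF X that] by simp
  have "opn (of_monad_model B) \<sigma> \<in> NE (power_space (und B) (arity \<Sigma> \<sigma>)) (und B)" if \<sigma>: "\<sigma> \<in> syms \<Sigma>" for \<sigma>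
    unfolding power_space_NE_iff
  proof (intro conjI ballI allI impI)
    show "opn (of_monad_model B) \<sigma> \<in> (arity \<Sigma> \<sigma> \<rightarrow>\<^sub>E pts (und B)) \<rightarrow>\<^sub>E pts (und B)"
      using \<sigma> NE_app[OF b class_in[OF X App_Var_in_terms[OF \<sigma>]]] by (auto simp: of_monad_model_def PiE_iff[of _ "PiE _ _"])
    fix g g' d assume g: "g \<in> arity \<Sigma> \<sigma> \<rightarrow>\<^sub>E pts (und B)" and g': "g' \<in> arity \<Sigma> \<sigma> \<rightarrow>\<^sub>E pts (und B)"
      and d: "\<forall>i\<in>arity \<Sigma> \<sigma>. dst (und B) (g i) (g' i) \<le> d"
    have "free_dist (und B) (App \<sigma> (\<lambda>i\<in>arity \<Sigma> \<sigma>. Var (g i))) (App \<sigma> (\<lambda>i\<in>arity \<Sigma> \<sigma>. Var (g' i))) \<le> d"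
    proof (rule free_dist_least)
      fix A f assume A: "A \<in> models" and f: "f \<in> NE (und B) (und A)"
      have "dst (und A) (opn A \<sigma> (\<lambda>i\<in>arity \<Sigma> \<sigma>. f (g i))) (opn A \<sigma> (\<lambda>i\<in>arity \<Sigma> \<sigma>. f (g' i))) \<le> d"
      proof (rule algebras_opn_dst[OF models_algebra[OF A] \<sigma>])
        fix i assume i: "i \<in> arity \<Sigma> \<sigma>"
        have "dst (und A) (f (g i)) (f (g' i)) \<le> dst (und B) (g i) (g' i)"
          by (rule NE_le[OF f PiE_mem[OF g i] PiE_mem[OF g' i]])
        then show "dst (und A) ((\<lambda>i\<in>arity \<Sigma> \<sigma>. f (g i)) i) ((\<lambda>i\<in>arity \<Sigma> \<sigma>. f (g' i)) i) \<le> d"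
          using d i by (auto intro: order_trans)
      qed (use NE_app[OF f PiE_mem[OF g]] NE_app[OF f PiE_mem[OF g']] in auto)
      then show "dst (und A) (eval \<Sigma> A f (App \<sigma> (\<lambda>i\<in>arity \<Sigma> \<sigma>. Var (g i))))
          (eval \<Sigma> A f (App \<sigma> (\<lambda>i\<in>arity \<Sigma> \<sigma>. Var (g' i)))) \<le> d"
        by (simp cong: restrict_cong)
    qed
    then show "dst (und B) (opn (of_monad_model B) \<sigma> g) (opn (of_monad_model B) \<sigma> g') \<le> d"
      unfolding opn_of_monad_model[OF \<sigma> g] opn_of_monad_model[OF \<sigma> g']
      using structure_dst[OF App_Var_in_terms[OF \<sigma> g] App_Var_in_terms[OF \<sigma> g']] by (rule order_trans[rotated])
  qed
  then have alg: "of_monad_model B \<in> algebras \<mu> \<Sigma>"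
    unfolding algebras_def using X by (auto simp: PiE_iff) (simp add: of_monad_model_def)
  have "satisfies \<kappa> \<Sigma> (of_monad_model B) (l, \<epsilon>, r)" if E: "(l, \<epsilon>, r) \<in> E" for l \<epsilon> r
    unfolding satisfies_def
  proof clarify
    fix f assume f: "f \<in> Field \<kappa> \<rightarrow> pts (und (of_monad_model B))"
    have lr: "l \<in> terms \<Sigma> (Field \<kappa>)" "r \<in> terms \<Sigma> (Field \<kappa>)"
      using equations E by (auto simp: quantitative_equations_def)
    \<comment> \<open>An assignment into \<open>B\<close> is a renaming of the variables by
      generators of the free algebra on \<open>und B\<close>.\<close>
    have sub: "tmap \<Sigma> f t \<in> terms \<Sigma> (pts (und B))" if "t \<in> terms \<Sigma> (Field \<kappa>)" for t
      using f by (intro tmap_in_terms[OF that]) auto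
    have ev: "eval \<Sigma> (of_monad_model B) f t = T.structure_map B (term_class (und B) (tmap \<Sigma> f t))" if t: "t \<in> terms \<Sigma> (Field \<kappa>)" for t
      using eval_of_monad_model[OF B sub[OF t]] unfolding eval_tmap[OF t] .
    have "free_dist (und B) (tmap \<Sigma> f l) (tmap \<Sigma> f r) \<le> ennreal (of_rat \<epsilon>)"
    proof (rule free_dist_least)
      fix A h assume A: "A \<in> models" and h: "h \<in> NE (und B) (und A)"
      have "(\<lambda>x. h (f x)) \<in> Field \<kappa> \<rightarrow> pts (und A)"
        using f NE_app[OF h] by auto
      moreover have "satisfies \<kappa> \<Sigma> A (l, \<epsilon>, r)" using A E by (simp add: models_def)
      ultimately show "dst (und A) (eval \<Sigma> A h (tmap \<Sigma> f l)) (eval \<Sigma> A h (tmap \<Sigma> f r)) \<le> ennreal (of_rat \<epsilon>)"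
        unfolding satisfies_def eval_tmap[OF lr(1)] eval_tmap[OF lr(2)] by simp
    qed
    then show "dst (und (of_monad_model B)) (eval \<Sigma> (of_monad_model B) f l) (eval \<Sigma> (of_monad_model B) f r) \<le> ennreal (of_rat \<epsilon>)"
      unfolding und_of_monad_model ev[OF lr(1)] ev[OF lr(2)]
      using structure_dst[OF sub[OF lr(1)] sub[OF lr(2)]] by (rule order_trans[rotated])
  qed
  then show ?thesis using alg by (auto simp: models_def)
qed

lemma of_monad_model_hom:
  assumes B: "monad_model free_monad B" and C: "monad_model free_monad C"
    and h: "h \<in> homomorphisms (monad_signature free_monad) B C"
  shows "h \<in> homomorphisms \<Sigma> (of_monad_model B) (of_monad_model C)"
  unfolding homomorphisms_def und_of_monad_model
proof (intro CollectI conjI ballI)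
  note X = T.model_und[OF B] and Y = T.model_und[OF C]
  show hN: "h \<in> NE (und B) (und C)" using h by (simp add: homomorphisms_def)
  fix \<sigma> g assume \<sigma>: "\<sigma> \<in> syms \<Sigma>" and g: "g \<in> arity \<Sigma> \<sigma> \<rightarrow>\<^sub>E pts (und B)"
  let ?t = "App \<sigma> (\<lambda>i\<in>arity \<Sigma> \<sigma>. Var (g i))"
  note t = App_Var_in_terms[OF \<sigma> g]
  have hg: "(\<lambda>i\<in>arity \<Sigma> \<sigma>. h (g i)) \<in> arity \<Sigma> \<sigma> \<rightarrow>\<^sub>E pts (und C)" using NE_app[OF hN PiE_mem[OF g]] by auto
  have "h (T.structure_map B (term_class (und B) ?t)) = T.structure_map C (free_map (und B) (und C) h (term_class (und B) ?t))"
    using T.structure_hom[OF B C h, of "term_class (und B) ?t"] class_in[OF X t]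
    by (simp add: free_monad_simps(1)[OF X] free_monad_simps(2)[OF X Y hN])
  also have "\<dots> = T.structure_map C (term_class (und C) (App \<sigma> (\<lambda>i\<in>arity \<Sigma> \<sigma>. Var ((\<lambda>i\<in>arity \<Sigma> \<sigma>. h (g i)) i))))"
    unfolding free_map_class[OF X Y hN t] by (simp cong: restrict_cong)
  finally show "h (opn (of_monad_model B) \<sigma> g) = opn (of_monad_model C) \<sigma> (\<lambda>i\<in>arity \<Sigma> \<sigma>. h (g i))"
    unfolding opn_of_monad_model[OF \<sigma> g] opn_of_monad_model[OF \<sigma> hg] .
qed

lemma of_em_model_counit:
  assumes A: "A \<in> models"
  shows "of_monad_model (T.em_model (und A) (counit A)) = A"
proof (rule algebra.equality)
  have ext: "opn A \<in> extensional (syms \<Sigma>)"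
    "\<And>\<sigma>. \<sigma> \<in> syms \<Sigma> \<Longrightarrow> opn A \<sigma> \<in> extensional (arity \<Sigma> \<sigma> \<rightarrow>\<^sub>E pts (und A))"
    using models_algebra[OF A] by (auto simp: algebras_def PiE_iff[of _ "syms _"] power_space_NE_iff PiE_iff[of _ "PiE _ _"])
  show "opn (of_monad_model (T.em_model (und A) (counit A))) = opn A"
  proof (rule extensionalityI[OF _ ext(1)])
    fix \<sigma> assume \<sigma>: "\<sigma> \<in> syms \<Sigma>"
    show "opn (of_monad_model (T.em_model (und A) (counit A))) \<sigma> = opn A \<sigma>"
    proof (rule extensionalityI[OF _ ext(2)[OF \<sigma>]])
      fix g assume g: "g \<in> arity \<Sigma> \<sigma> \<rightarrow>\<^sub>E pts (und A)"
      have "opn (of_monad_model (T.em_model (und A) (counit A))) \<sigma> g =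
          counit A (term_class (und A) (App \<sigma> (\<lambda>i\<in>arity \<Sigma> \<sigma>. Var (g i))))"
        using opn_of_monad_model[OF \<sigma>, of g "T.em_model (und A) (counit A)"] g
        by (simp add: T.structure_em_model[OF em_algebra_counit[OF A]])
      also have "\<dots> = opn A \<sigma> (\<lambda>i\<in>arity \<Sigma> \<sigma>. g i)"
        unfolding counit_class[OF A App_Var_in_terms[OF \<sigma> g]] by (simp cong: restrict_cong)
      also have "(\<lambda>i\<in>arity \<Sigma> \<sigma>. g i) = g" using g by (simp add: PiE_restrict)
      finally show "opn (of_monad_model (T.em_model (und A) (counit A))) \<sigma> g = opn A \<sigma> g" .
    qed (use \<sigma> in \<open>simp add: of_monad_model_def\<close>)
  qed (simp add: of_monad_model_def)
qed simp_all

lemma em_model_counit_of: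
  assumes B: "monad_model free_monad B"
  shows "T.em_model (und B) (counit (of_monad_model B)) = B"
proof -
  have "counit (of_monad_model B) = T.structure_map B"
  proof (rule NE_eqI)
    show "counit (of_monad_model B) \<in> NE (und (free_algebra (und B))) (und B)"
      using counit_NE[OF of_monad_model_models[OF B]] by simp
    show "T.structure_map B \<in> NE (und (free_algebra (und B))) (und B)" by (rule structure_free_NE[OF B])
    fix z assume "z \<in> pts (und (free_algebra (und B)))"
    then obtain t where t: "t \<in> terms \<Sigma> (pts (und B))" and z: "z = term_class (und B) t"
      by (rule class_surj[OF T.model_und[OF B]])
    show "counit (of_monad_model B) z = T.structure_map B z"
      unfolding z using counit_class[OF of_monad_model_models[OF B], of t] t eval_of_monad_model[OF B t] by simp
  qed
  then show ?thesis by (simp add: T.em_model_structure[OF B])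
qed

text \<open>The two passages are inverse on the nose and keep underlying maps, so they form an
  isomorphism in the category of varieties itself. This gives essential surjectivity.\<close>

lemma variety_iso:
  "\<exists>F. is_iso (Varieties_cat \<kappa> \<mu>) (\<Sigma>, models) (monad_variety free_monad) F"
proof -
  let ?V = "(\<Sigma>, models)" and ?W = "monad_variety free_monad"
  let ?\<Phi> = "\<lambda>A. T.em_model (und A) (counit A)"
  have V: "?V \<in> varieties \<kappa> \<mu>"
    using signature equations by (auto simp: varieties_def models_def)
  have W: "?W \<in> varieties \<kappa> \<mu>" by (rule T.monad_variety_in_varieties)
  have F: "concrete_functor \<mu> ?V ?W (conc ?V ?\<Phi>)"
    by (rule concrete_functor_conc[OF V])
      (simp_all add: monad_variety_def T.em_model[OF em_algebra_counit] counit_hom)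
  have G: "concrete_functor \<mu> ?W ?V (conc ?W of_monad_model)"
    by (rule concrete_functor_conc[OF W])
      (simp_all add: monad_variety_def of_monad_model_models of_monad_model_hom)
  have "comp_functor (variety_cat \<mu> ?V) (conc ?W of_monad_model) (conc ?V ?\<Phi>) = id_functor (variety_cat \<mu> ?V)"
    unfolding comp_functor_conc[OF F G] id_functor_conc
    using concrete_obj[OF F] by (intro conc_cong) (simp add: of_em_model_counit)
  moreover have "comp_functor (variety_cat \<mu> ?W) (conc ?V ?\<Phi>) (conc ?W of_monad_model) = id_functor (variety_cat \<mu> ?W)"
    unfolding comp_functor_conc[OF G F] id_functor_conc
    by (intro conc_cong) (simp add: monad_variety_def of_monad_model_models em_model_counit_of)
  ultimately show ?thesis
    unfolding is_iso_def Varieties_cat_simps using F G by blast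
qed

end

section \<open>The contravariant functor from monads to varieties\<close>

context arity_universe
begin

text \<open>A morphism from \<open>M\<close> to \<open>N\<close> turns \<open>N\<close>-algebras
  into \<open>M\<close>-algebras, so the arrow part takes \<open>N\<close> first, as in the opposite
  of the category of monads.\<close>

definition variety_functor ::
  "(('u space, 'u \<Rightarrow> 'u) monad, 'u space \<Rightarrow> 'u \<Rightarrow> 'u, 'u variety, ('u algebra, 'u \<Rightarrow> 'u, 'u algebra, 'u \<Rightarrow> 'u) fctr) fctr" where
  "variety_functor = \<lparr>fobj = (\<lambda>M\<in>strongly_accessible_monads \<kappa> \<mu>. monad_variety M),
    farr = (\<lambda>N\<in>strongly_accessible_monads \<kappa> \<mu>. \<lambda>M\<in>strongly_accessible_monads \<kappa> \<mu>.
      \<lambda>\<alpha>\<in>{\<alpha>. monad_morphism (UMet \<mu>) M N \<alpha>}. conc (monad_variety N) (reindex M N \<alpha>))\<rparr>"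

lemma op_Monads_cat_simps:
  "obj (op_cat (Monads_cat \<kappa> \<mu>)) = strongly_accessible_monads \<kappa> \<mu>"
  "hom (op_cat (Monads_cat \<kappa> \<mu>)) N M = {\<alpha>. monad_morphism (UMet \<mu>) M N \<alpha>}"
  "idn (op_cat (Monads_cat \<kappa> \<mu>)) M = (\<lambda>X\<in>UM. \<lambda>x\<in>pts (TO M X). x)"
  "cmp (op_cat (Monads_cat \<kappa> \<mu>)) P N M \<alpha> \<beta> = (\<lambda>X\<in>UM. compose (pts (TO M X)) (\<beta> X) (\<alpha> X))"
  by (simp_all add: op_cat_def Monads_cat_simps)

lemma is_functor_variety_functor:
  "is_functor (op_cat (Monads_cat \<kappa> \<mu>)) (Varieties_cat \<kappa> \<mu>) variety_functor"
  unfolding is_functor_def op_Monads_cat_simps Varieties_cat_simps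
proof (intro conjI ballI)
  have monad: "ultrametric_monad \<kappa> \<mu> M" if "M \<in> strongly_accessible_monads \<kappa> \<mu>" for M
    using that by unfold_locales (simp add: strongly_accessible_monads_def)
  have morphism: "ultrametric_monad_morphism \<kappa> \<mu> M N \<alpha>"
    if "M \<in> strongly_accessible_monads \<kappa> \<mu>" "N \<in> strongly_accessible_monads \<kappa> \<mu>" "monad_morphism (UMet \<mu>) M N \<alpha>" for M N \<alpha>
    using that by unfold_locales (simp_all add: strongly_accessible_monads_def)
  show "fobj variety_functor \<in> strongly_accessible_monads \<kappa> \<mu> \<rightarrow>\<^sub>E varieties \<kappa> \<mu>"
    using ultrametric_monad.monad_variety_in_varieties[OF monad] by (simp add: variety_functor_def)
  { fix N M assume "N \<in> strongly_accessible_monads \<kappa> \<mu>" "M \<in> strongly_accessible_monads \<kappa> \<mu>"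
    then show "farr variety_functor N M \<in> {\<alpha>. monad_morphism (UMet \<mu>) M N \<alpha>} \<rightarrow>\<^sub>E
        {F. concrete_functor \<mu> (fobj variety_functor N) (fobj variety_functor M) F}"
      using ultrametric_monad_morphism.concrete_reindex[OF morphism] by (auto simp: variety_functor_def) }
  fix M assume M: "M \<in> strongly_accessible_monads \<kappa> \<mu>"
  then have em: "enriched_monad (UMet \<mu>) M" by (simp add: strongly_accessible_monads_def)
  show "farr variety_functor M M (\<lambda>X\<in>UM. \<lambda>x\<in>pts (TO M X). x) = id_functor (variety_cat \<mu> (fobj variety_functor M))"
    unfolding id_functor_conc using M monad_morphism_id[OF em] ultrametric_monad.reindex_id[OF monad[OF M]]
    by (simp add: variety_functor_def) (rule conc_cong, simp add: monad_variety_def)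
  fix P N \<alpha> \<beta> assume "P \<in> strongly_accessible_monads \<kappa> \<mu>" "N \<in> strongly_accessible_monads \<kappa> \<mu>"
    "\<beta> \<in> {\<alpha>. monad_morphism (UMet \<mu>) N P \<alpha>}" "\<alpha> \<in> {\<alpha>. monad_morphism (UMet \<mu>) M N \<alpha>}"
  then have P: "P \<in> strongly_accessible_monads \<kappa> \<mu>" and N: "N \<in> strongly_accessible_monads \<kappa> \<mu>"
    and \<beta>: "monad_morphism (UMet \<mu>) N P \<beta>" and \<alpha>: "monad_morphism (UMet \<mu>) M N \<alpha>" by auto
  have en: "enriched_monad (UMet \<mu>) N" and ep: "enriched_monad (UMet \<mu>) P"
    using N P by (simp_all add: strongly_accessible_monads_def)
  have "comp_functor (variety_cat \<mu> (monad_variety P)) (conc (monad_variety N) (reindex M N \<alpha>))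
      (conc (monad_variety P) (reindex N P \<beta>)) =
      conc (monad_variety P) (reindex M P (\<lambda>X\<in>UM. compose (pts (TO M X)) (\<beta> X) (\<alpha> X)))"
    unfolding comp_functor_conc[OF ultrametric_monad_morphism.concrete_reindex[OF morphism[OF N P \<beta>]]
        ultrametric_monad_morphism.concrete_reindex[OF morphism[OF M N \<alpha>]]]
    using ultrametric_monad_morphism.reindex_model[OF morphism[OF N P \<beta>]]
    by (intro conc_cong) (simp add: monad_variety_def reindex_compose[OF em en ep \<alpha> \<beta>])
  then show "farr variety_functor P M (\<lambda>X\<in>UM. compose (pts (TO M X)) (\<beta> X) (\<alpha> X)) =
      comp_functor (variety_cat \<mu> (fobj variety_functor P)) (farr variety_functor N M \<alpha>) (farr variety_functor P N \<beta>)"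
    using M N P \<alpha> \<beta> monad_morphism_compose[OF em en ep \<alpha> \<beta>] by (simp add: variety_functor_def)
qed (auto simp: variety_functor_def)

lemma dually_equivalent_varieties_monads:
  "dually_equivalent (Varieties_cat \<kappa> \<mu>) (Monads_cat \<kappa> \<mu>)"
  unfolding dually_equivalent_def
proof (rule equivalent_categoriesI[OF category_Varieties_cat category_op_cat[OF category_Monads_cat]
    is_functor_variety_functor]; unfold op_Monads_cat_simps)
  fix N M F assume N: "N \<in> strongly_accessible_monads \<kappa> \<mu>" and M: "M \<in> strongly_accessible_monads \<kappa> \<mu>"
    and "F \<in> hom (Varieties_cat \<kappa> \<mu>) (fobj variety_functor N) (fobj variety_functor M)"
  then have "concrete_functor \<mu> (monad_variety N) (monad_variety M) F"
    by (simp add: Varieties_cat_simps variety_functor_def)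
  from reindex_full[OF M N this] obtain \<alpha> where "monad_morphism (UMet \<mu>) M N \<alpha>"
    "conc (monad_variety N) (reindex M N \<alpha>) = F" .
  then show "\<exists>\<alpha>\<in>{\<alpha>. monad_morphism (UMet \<mu>) M N \<alpha>}. farr variety_functor N M \<alpha> = F"
    using M N by (intro bexI[of _ \<alpha>]) (simp_all add: variety_functor_def)
next
  fix N M assume N: "N \<in> strongly_accessible_monads \<kappa> \<mu>" and M: "M \<in> strongly_accessible_monads \<kappa> \<mu>"
  show "inj_on (farr variety_functor N M) {\<alpha>. monad_morphism (UMet \<mu>) M N \<alpha>}"
  proof (rule inj_onI)
    fix \<alpha> \<beta> assume "\<alpha> \<in> {\<alpha>. monad_morphism (UMet \<mu>) M N \<alpha>}" "\<beta> \<in> {\<alpha>. monad_morphism (UMet \<mu>) M N \<alpha>}"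
      and "farr variety_functor N M \<alpha> = farr variety_functor N M \<beta>"
    then have \<alpha>: "monad_morphism (UMet \<mu>) M N \<alpha>" and \<beta>: "monad_morphism (UMet \<mu>) M N \<beta>"
      and eq: "conc (monad_variety N) (reindex M N \<alpha>) = conc (monad_variety N) (reindex M N \<beta>)"
      using M N by (simp_all add: variety_functor_def)
    have "reindex M N \<alpha> A = reindex M N \<beta> A" if "monad_model N A" for A
    proof -
      have "A \<in> snd (monad_variety N)" using that by (simp add: monad_variety_def)
      then show ?thesis using arg_cong[OF eq, of "\<lambda>F. fobj F A"] by simp
    qed
    then show "\<alpha> = \<beta>" by (rule reindex_faithful[OF M N \<alpha> \<beta>])
  qed
next
  fix V assume "V \<in> obj (Varieties_cat \<kappa> \<mu>)"
  then obtain \<Sigma> E where \<Sigma>: "is_signature \<kappa> \<mu> \<Sigma>" "E \<subseteq> quantitative_equations \<kappa> \<Sigma>"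
    and V: "V = (\<Sigma>, {A \<in> algebras \<mu> \<Sigma>. \<forall>e\<in>E. satisfies \<kappa> \<Sigma> A e})"
    by (auto simp: Varieties_cat_simps varieties_def)
  interpret quantitative_theory \<kappa> \<mu> \<Sigma> E by unfold_locales (rule \<Sigma>)+
  obtain F where "is_iso (Varieties_cat \<kappa> \<mu>) (\<Sigma>, models) (monad_variety free_monad) F"
    using variety_iso by blast
  then show "\<exists>M\<in>strongly_accessible_monads \<kappa> \<mu>. \<exists>F. is_iso (Varieties_cat \<kappa> \<mu>) V (fobj variety_functor M) F"
    using free_monad_strongly_accessible
    by (intro bexI[of _ free_monad] exI[of _ F]) (simp_all add: V models_def variety_functor_def)
qed

end

theorem corollary7p9:
  fixes \<kappa> \<mu> :: "'u rel"
  assumes "Cinfinite \<kappa>" and "regularCard \<kappa>"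
    and "universe \<kappa> \<mu>"
  shows "dually_equivalent (Varieties_cat \<kappa> \<mu>) (Monads_cat \<kappa> \<mu>)"
proof -
  interpret arity_universe \<kappa> \<mu> by unfold_locales (rule assms)+
  show ?thesis by (rule dually_equivalent_varieties_monads)
qed

end
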